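(* Let $[X_{n,i}]_{n\ge1,i\in I}$ be a partially $\mathcal G$-c.i.d. array of real-valued, square-integrable random variables with directing random measures $(\alpha_i)_{i\in I}$. For $n\ge1$, $i\in I$ let $$S_{n,i}=\frac1{\sqrt n}\sum_{k=1}^n\big(X_{k,i}-\mathbb E[X_{k,i}\mid\mathcal G_{k-1}]\big),\qquad \mathbf S_n^I=(S_{n,i})_{i\in I}.$$ Then $(\mathbf S_n^I)_{n\ge1}$ converges stably with representing measure $\mathcal N(0,\Sigma)$, where $\Sigma$ is the random diagonal covariance given by $\Sigma(e_i,e_i)=\sigma^2_{\alpha_i}:=\int x^2\alpha_i(dx)-\big(\int x\,\alpha_i(dx)\big)^2$ and $\Sigma(e_i,e_j)=0$ for $i\ne j$.
   Context: All random elements live on $(\Omega,\mathcal F,\mathbb P)$; $I$ is finite or countable; here $\mathbb X=\mathbb R$. For a filtration $\mathcal G=(\mathcal G_n)_{n\ge0}$ and $j\in I$, $\mathcal G_n^j=\mathcal G_n\vee\sigma(X_{n+1,i}:i\ne j)$. The array (rows $\mathbf X_n^I=(X_{n,i})_{i\in I}$) is partially $\mathcal G$-c.i.d. if it is adapted to $\mathcal G$ and $\mathbb E[f(X_{n+1,j})\mid\mathcal G_n^j]=\mathbb E[f(X_{n+k,j})\mid\mathcal G_n^j]$ a.s. for all $j\in I$, $k\ge1$, $n\ge0$ and bounded measurable $f$; then $\mathbb P[X_{n+1,i}\in\cdot\mid\mathcal G_n]$ converges weakly a.s. to a random probability measure $\alpha_i$ (directing random measure of column $i$). $(e_i)_{i\in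 I}$ is the canonical basis of $\mathbb R^I$ ($\mathbb R^I$ with the product topology). For a (random) symmetric positive semidefinite form $\Sigma$ on $\mathbb R^I$, $\mathcal N(0,\Sigma)$ is the centered Gaussian measure on $\mathbb R^I$ whose finite-dimensional marginal on $\mathbb R^J$ ($J$ finite) is centered Gaussian with covariance matrix $(\Sigma(e_i,e_j))_{i,j\in J}$. A sequence $(Z_n)$ of random elements of a Polish space converges stably with representing random measure $\beta(\cdot;\omega)$ if for every $A\in\mathcal F$ and every bounded continuous $g$, $\mathbb E[\mathbf 1_A g(Z_n)]\to\int_A\int g\,d\beta(\cdot;\omega)\,\mathbb P(d\omega)$. *)

theory Defs
  imports "HOL-Probability.Probability"
begin

definition filtration :: "'a measure \<Rightarrow> (nat \<Rightarrow> 'a measure) \<Rightarrow> bool" where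
  "filtration M G \<longleftrightarrow> (\<forall>n. subalgebra M (G n) \<and> sets (G n) \<subseteq> sets (G (Suc n)))"

definition Gnj :: "'a measure \<Rightarrow> (nat \<Rightarrow> 'a measure) \<Rightarrow> (nat \<Rightarrow> 'i \<Rightarrow> 'a \<Rightarrow> real)
    \<Rightarrow> nat \<Rightarrow> 'i \<Rightarrow> 'a measure" where
  "Gnj M G X n j = sigma (space M)
     (sets (G n) \<union> (\<Union>i\<in>-{j}. {X (Suc n) i -` B \<inter> space M | B. B \<in> sets borel}))"

text \<open>Partially G-c.i.d. array; rows are indexed by n \<ge> 1 (X 0 is irrelevant).\<close>
definition partially_cid :: "'a measure \<Rightarrow> (nat \<Rightarrow> 'a measure) \<Rightarrow> (nat \<Rightarrow> 'i \<Rightarrow> 'a \<Rightarrow> real) \<Rightarrow> bool" where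
  "partially_cid M G X \<longleftrightarrow>
     filtration M G \<and>
     (\<forall>n\<ge>1. \<forall>i. X n i \<in> borel_measurable (G n)) \<and>
     (\<forall>j n k (f::real \<Rightarrow> real). k \<ge> 1 \<longrightarrow> f \<in> borel_measurable borel \<longrightarrow> bounded (range f) \<longrightarrow>
        (AE \<omega> in M. real_cond_exp M (Gnj M G X n j) (\<lambda>x. f (X (Suc n) j x)) \<omega>
                   = real_cond_exp M (Gnj M G X n j) (\<lambda>x. f (X (n + k) j x)) \<omega>))"

definition regular_cond_dist :: "'a measure \<Rightarrow> 'a measure \<Rightarrow> ('a \<Rightarrow> real) \<Rightarrow> ('a \<Rightarrow> real measure) \<Rightarrow> bool" where
  "regular_cond_dist M F Y K \<longleftrightarrow>
     (\<forall>\<omega>\<in>space M. prob_space (K \<omega>) \<and> sets (K \<omega>) = sets borel) \<and>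
     (\<forall>B\<in>sets borel. (\<lambda>\<omega>. measure (K \<omega>) B) \<in> borel_measurable F \<and>
        (\<forall>A\<in>sets F. (\<integral>\<omega>. indicator A \<omega> * measure (K \<omega>) B \<partial>M) = measure M (A \<inter> Y -` B \<inter> space M)))"

definition random_prob_measure :: "'a measure \<Rightarrow> ('a \<Rightarrow> 'b::topological_space measure) \<Rightarrow> bool" where
  "random_prob_measure M \<beta> \<longleftrightarrow>
     (\<forall>\<omega>\<in>space M. prob_space (\<beta> \<omega>) \<and> sets (\<beta> \<omega>) = sets borel) \<and>
     (\<forall>B\<in>sets borel. (\<lambda>\<omega>. emeasure (\<beta> \<omega>) B) \<in> borel_measurable M)"

definition directing_measure :: "'a measure \<Rightarrow> (nat \<Rightarrow> 'a measure) \<Rightarrow> (nat \<Rightarrow> 'i \<Rightarrow> 'a \<Rightarrow> real)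
    \<Rightarrow> 'i \<Rightarrow> ('a \<Rightarrow> real measure) \<Rightarrow> bool" where
  "directing_measure M G X i \<alpha> \<longleftrightarrow> random_prob_measure M \<alpha> \<and>
     (\<exists>K. (\<forall>n. regular_cond_dist M (G n) (X (Suc n) i) (K n)) \<and>
          (AE \<omega> in M. weak_conv_m (\<lambda>n. K n \<omega>) (\<alpha> \<omega>)))"

definition var_measure :: "real measure \<Rightarrow> real" where
  "var_measure \<mu> = (\<integral>x. x\<^sup>2 \<partial>\<mu>) - (\<integral>x. x \<partial>\<mu>)\<^sup>2"

text \<open>Centered Gaussian measure on R^I (product topology) with covariance form \<Sigma>:
  every finite-dimensional marginal is centered Gaussian with covariance matrix
  (\<Sigma> i j), expressed through its characteristic function.\<close>
definition centered_gaussian :: "('i \<Rightarrow> real) measure \<Rightarrow> ('i \<Rightarrow> 'i \<Rightarrow> real) \<Rightarrow> bool" where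
  "centered_gaussian \<mu> \<Sigma> \<longleftrightarrow> prob_space \<mu> \<and> sets \<mu> = sets borel \<and>
     (\<forall>J (t::'i \<Rightarrow> real). finite J \<longrightarrow>
        (CLINT x|\<mu>. cis (\<Sum>j\<in>J. t j * x j))
          = complex_of_real (exp (- (\<Sum>i\<in>J. \<Sum>j\<in>J. t i * t j * \<Sigma> i j) / 2)))"

definition stably_conv :: "'a measure \<Rightarrow> (nat \<Rightarrow> 'a \<Rightarrow> ('i \<Rightarrow> real)) \<Rightarrow> ('a \<Rightarrow> ('i \<Rightarrow> real) measure) \<Rightarrow> bool" where
  "stably_conv M Z \<beta> \<longleftrightarrow> random_prob_measure M \<beta> \<and>
     (\<forall>A\<in>sets M. \<forall>g :: ('i \<Rightarrow> real) \<Rightarrow> real. continuous_on UNIV g \<longrightarrow> bounded (range g) \<longrightarrow>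
        (\<lambda>n. \<integral>\<omega>. indicator A \<omega> * g (Z n \<omega>) \<partial>M)
          \<longlonglongrightarrow> (\<integral>\<omega>. indicator A \<omega> * (\<integral>x. g x \<partial>\<beta> \<omega>) \<partial>M))"

end

theory Submission
  imports Defs
begin

text \<open>
  For a clipped array the increments are bounded, and the cosine of the scaled sum is compared step
  by step with \<open>exp (- W (n - k) / 2n) cos (s + T\<^sub>k)\<close>, where \<open>W\<close> is a \<open>\<G>\<^sub>p\<close>-measurable
  approximation of the limiting variance \<open>V\<close>. The accumulated error is of order \<open>E\<bar>V - W\<bar>\<close>, because the
  asymptotic conditional covariance is diagonal: given \<open>\<G>\<^sub>n\<close> and \<open>X\<^sub>n\<^sub>+\<^sub>1\<^sub>,\<^sub>i\<close>, the entry \<open>X\<^sub>n\<^sub>+\<^sub>1\<^sub>,\<^sub>j\<close> may be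
  replaced by the mean of \<open>\<alpha>\<^sub>j\<close>, which is asymptotically \<open>\<G>\<^sub>n\<close>-measurable. A general event is replaced by its
  conditional probabilities along the filtration, which are Cauchy. Columns are identically
  distributed, so orthogonality of martingale increments makes the truncation error uniform. Finally,
  second moments give tightness on compact boxes of the product space, where Stone-Weierstrass
  reduces continuous test functions to sums of cosines.
\<close>

section \<open>Stable limits of bounded martingale increments\<close>

text \<open>The variance \<open>V\<close> comes from the directing measures, so it need not be
  measurable at any finite time, and a factor built from it cannot be pulled out of a conditional
  expectation. Hence the proxy \<open>W\<close>: the variance under the predictive kernels at a
  fixed time \<open>p\<close>, which is known from then on and tends to \<open>V\<close> almost
  surely. The price is an order of choices: truncation level, then \<open>p\<close>, then
  \<open>n\<close>. The damping exponent counts the increments still to come. Each increment uses up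
  one unit of it, so the comparisons telescope, and all factors stay in [0,1]. Clipping has two
  reasons. Weak convergence of the predictive laws passes to integrals of bounded continuous
  functions only, which excludes the identity and the square; and the cubic Taylor remainder needs
  bounded increments. As in the Cramer-Wold device, a fixed finite linear combination of columns is
  treated as one real martingale. The free phase \<open>s\<close> in the cosine also yields sines,
  so real test functions suffice and their span is closed under products.\<close>

lemma cos_add_Taylor2:
  fixes a x :: real
  shows "\<bar>cos (a + x) - cos a + x * sin a + x\<^sup>2 / 2 * cos a\<bar> \<le> \<bar>x\<bar> ^ 3 / 6"
proof -
  have sm: "(\<Sum>k\<le>2. (\<i> * complex_of_real x) ^ k / fact k) = 1 + \<i> * x - x\<^sup>2 / 2"
    by (simp add: numeral_2_eq_2 power2_eq_square algebra_simps)
  have b: "cmod (iexp x - (1 + \<i> * x - x\<^sup>2 / 2)) \<le> \<bar>x\<bar> ^ 3 / 6"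
    using iexp_approx1[of x 2] unfolding sm by (simp add: fact_numeral)
  \<comment> \<open>The error is the real part of the second order Taylor remainder of exp(ix),
    rotated by \<open>cis a\<close>. The rotation has modulus one, so the constant 1/3! does not
    depend on \<open>a\<close>.\<close>
  have "cos (a + x) - cos a + x * sin a + x\<^sup>2 / 2 * cos a = Re (cis a * (iexp x - (1 + \<i> * x - x\<^sup>2 / 2)))"
    by (simp add: cis_conv_exp[symmetric] cos_add algebra_simps power2_eq_square)
  also have "\<bar>\<dots>\<bar> \<le> cmod (cis a * (iexp x - (1 + \<i> * x - x\<^sup>2 / 2)))"
    by (rule abs_Re_le_cmod)
  also have "\<dots> \<le> \<bar>x\<bar> ^ 3 / 6"
    using b by (simp add: norm_mult)
  finally show ?thesis .
qed

lemma exp_minus_Taylor1: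
  fixes w :: real
  assumes "0 \<le> w"
  shows "\<bar>exp (- w) - 1 + w\<bar> \<le> w\<^sup>2 / 2"
proof -
  \<comment> \<open>The product of the two quadratics is 1 + w^4/4. This turns the lower bound for
    \<open>exp w\<close> into an upper bound for \<open>exp (- w)\<close>.\<close>
  have "1 \<le> (1 - w + w\<^sup>2 / 2) * (1 + w + w\<^sup>2 / 2)"
    using zero_le_power2[of "w\<^sup>2"] by (simp add: algebra_simps power2_eq_square)
  also have "\<dots> \<le> (1 - w + w\<^sup>2 / 2) * exp w"
  proof (rule mult_left_mono[OF exp_lower_Taylor_quadratic[OF assms]])
    have "0 \<le> (1 - w)\<^sup>2 + 1" by (simp add: add_nonneg_nonneg)
    then show "0 \<le> 1 - w + w\<^sup>2 / 2"
      by (simp add: power2_eq_square algebra_simps)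
  qed
  finally have "exp (- w) \<le> 1 - w + w\<^sup>2 / 2"
    by (simp add: exp_minus field_simps)
  moreover have "1 + (- w) \<le> exp (- w)" by (rule exp_ge_add_one_self)
  ultimately show ?thesis by linarith
qed

lemma abs_exp_minus_diff_le:
  fixes a b :: real
  assumes "0 \<le> a" "0 \<le> b"
  shows "\<bar>exp (- a) - exp (- b)\<bar> \<le> \<bar>a - b\<bar>"
proof -
  have "\<bar>exp (- a) - exp (- b)\<bar> \<le> \<bar>a - b\<bar>" if "0 \<le> a" "a \<le> b" for a b :: real
  proof -
    have "exp (- a) - exp (- b) = exp (- a) * (1 - exp (- (b - a)))"
      by (simp add: algebra_simps flip: exp_add)
    also have "\<dots> \<le> 1 * (b - a)"
      using that exp_ge_add_one_self[of "- (b - a)"] by (intro mult_mono) (auto simp del: exp_ge_add_one_self)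
    finally show ?thesis using that by simp
  qed
  from this[of a b] this[of b a] assms show ?thesis by (cases "a \<le> b") auto
qed

lemma abs_cos_diff_le:
  fixes a b :: real
  shows "\<bar>cos a - cos b\<bar> \<le> \<bar>a - b\<bar>"
proof -
  have "\<bar>cos a - cos b\<bar> = 2 * (\<bar>sin ((a + b) / 2)\<bar> * \<bar>sin ((b - a) / 2)\<bar>)"
    by (simp add: cos_diff_cos abs_mult)
  also have "\<dots> \<le> 2 * (1 * \<bar>(b - a) / 2\<bar>)"
    by (intro mult_left_mono mult_mono abs_sin_x_le_abs_x) auto
  finally show ?thesis by auto
qed

section \<open>Integral inequalities on a probability space\<close>

context prob_space
begin

lemma integrable_bounded_real:
  fixes f :: "'a \<Rightarrow> real"
  assumes "f \<in> borel_measurable M" "\<And>\<omega>. \<omega> \<in> space M \<Longrightarrow> \<bar>f \<omega>\<bar> \<le> B"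
  shows "integrable M f"
  by (rule integrable_const_bound[of _ B]) (use assms in auto)

lemma abs_integral_le_integral:
  fixes f g :: "'a \<Rightarrow> real"
  assumes "integrable M g" "\<And>\<omega>. \<omega> \<in> space M \<Longrightarrow> \<bar>f \<omega>\<bar> \<le> g \<omega>"
  shows "\<bar>\<integral>\<omega>. f \<omega> \<partial>M\<bar> \<le> (\<integral>\<omega>. g \<omega> \<partial>M)"
proof (cases "integrable M f")
  case True
  have "\<bar>\<integral>\<omega>. f \<omega> \<partial>M\<bar> \<le> (\<integral>\<omega>. \<bar>f \<omega>\<bar> \<partial>M)" by (rule integral_abs_bound)
  also have "\<dots> \<le> (\<integral>\<omega>. g \<omega> \<partial>M)" using True assms by (intro integral_mono) auto
  finally show ?thesis .
next
  \<comment> \<open>A non-integrable \<open>f\<close> has Bochner integral 0 by default, and 0 obeys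
    the bound because \<open>g\<close> dominates an absolute value. Callers thus owe integrability
    of \<open>g\<close> alone.\<close>
  case False
  have "0 \<le> (\<integral>\<omega>. g \<omega> \<partial>M)"
    by (rule integral_nonneg_AE) (use assms(2) in \<open>force intro: order_trans[OF abs_ge_zero]\<close>)
  then show ?thesis using False by (simp add: not_integrable_integral_eq)
qed

lemma abs_integral_le_const:
  fixes f :: "'a \<Rightarrow> real"
  assumes "\<And>\<omega>. \<omega> \<in> space M \<Longrightarrow> \<bar>f \<omega>\<bar> \<le> B"
  shows "\<bar>\<integral>\<omega>. f \<omega> \<partial>M\<bar> \<le> B"
  using abs_integral_le_integral[of "\<lambda>_. B" f] assms by (simp add: prob_space)

text \<open>Cauchy-Schwarz against the constant 1, read off from the nonnegative variance of the
  absolute value.\<close>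

lemma power2_integral_abs_le:
  fixes f :: "'a \<Rightarrow> real"
  assumes "f \<in> borel_measurable M" "integrable M (\<lambda>\<omega>. (f \<omega>)\<^sup>2)"
  shows "(\<integral>\<omega>. \<bar>f \<omega>\<bar> \<partial>M)\<^sup>2 \<le> (\<integral>\<omega>. (f \<omega>)\<^sup>2 \<partial>M)"
  using variance_eq[of "\<lambda>\<omega>. \<bar>f \<omega>\<bar>"] variance_positive[of "\<lambda>\<omega>. \<bar>f \<omega>\<bar>"]
    integrable_abs[OF square_integrable_imp_integrable[OF assms]] assms(2)
  by simp

text \<open>One replacement step: a small martingale increment \<open>h D\<close> acts under the cosine like the
  damping factor \<open>exp (- h\<^sup>2 W / 2)\<close>.\<close>

lemma cos_increment_bound:
  fixes z T D V W :: "'a \<Rightarrow> real" and B C h \<eta> :: real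
  assumes sub: "subalgebra M F"
    and z: "z \<in> borel_measurable F" "\<And>\<omega>. \<omega> \<in> space M \<Longrightarrow> \<bar>z \<omega>\<bar> \<le> 1"
    and T: "T \<in> borel_measurable F"
    and D: "D \<in> borel_measurable M" "\<And>\<omega>. \<omega> \<in> space M \<Longrightarrow> \<bar>D \<omega>\<bar> \<le> C"
    and mart: "\<And>y. y \<in> borel_measurable F \<Longrightarrow> (\<And>\<omega>. \<omega> \<in> space M \<Longrightarrow> \<bar>y \<omega>\<bar> \<le> 1) \<Longrightarrow> (\<integral>\<omega>. y \<omega> * D \<omega> \<partial>M) = 0"
    and var: "\<And>y. y \<in> borel_measurable F \<Longrightarrow> (\<And>\<omega>. \<omega> \<in> space M \<Longrightarrow> \<bar>y \<omega>\<bar> \<le> 1) \<Longrightarrow>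
        \<bar>\<integral>\<omega>. y \<omega> * ((D \<omega>)\<^sup>2 - V \<omega>) \<partial>M\<bar> \<le> \<eta>"
    and V: "integrable M V"
    and W: "W \<in> borel_measurable M" "\<And>\<omega>. \<omega> \<in> space M \<Longrightarrow> 0 \<le> W \<omega> \<and> W \<omega> \<le> B"
    and h: "0 \<le> h"
  shows "\<bar>(\<integral>\<omega>. z \<omega> * cos (T \<omega> + h * D \<omega>) \<partial>M) - (\<integral>\<omega>. z \<omega> * exp (- (h\<^sup>2 * W \<omega> / 2)) * cos (T \<omega>) \<partial>M)\<bar>
    \<le> h\<^sup>2 / 2 * (\<eta> + (\<integral>\<omega>. \<bar>V \<omega> - W \<omega>\<bar> \<partial>M)) + h ^ 3 * C ^ 3 / 6 + h ^ 4 * B\<^sup>2 / 8"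
proof -
  note mF[measurable (raw)] = measurable_from_subalg[OF sub]
  note [measurable] = D(1) W(1)
  have [measurable]: "z \<in> borel_measurable M" "T \<in> borel_measurable M" "V \<in> borel_measurable M"
    using mF z(1) T V by auto
  let ?ys = "\<lambda>\<omega>. z \<omega> * sin (T \<omega>)" and ?yc = "\<lambda>\<omega>. z \<omega> * cos (T \<omega>)"
  have yb: "\<bar>?ys \<omega>\<bar> \<le> 1" "\<bar>?yc \<omega>\<bar> \<le> 1" if "\<omega> \<in> space M" for \<omega>
    using z(2)[OF that] by (simp_all add: abs_mult mult_le_one)
  have yF: "?ys \<in> borel_measurable F" "?yc \<in> borel_measurable F"
    using z(1) T by simp_all
  have iW: "integrable M W" by (rule integrable_bounded_real[of _ B]) (use W in auto)
  have iD: "integrable M D" by (rule integrable_bounded_real[of _ C]) (use D in auto)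
  have iD2: "integrable M (\<lambda>\<omega>. (D \<omega>)\<^sup>2)"
    by (rule integrable_bounded_real[of _ "C\<^sup>2"]) (use D in \<open>auto simp: abs_le_square_iff[symmetric] intro: power_mono[of "\<bar>D _\<bar>" C 2, simplified]\<close>)
  \<comment> \<open>\<open>?R\<close> is the remainder of the cosine after its second order terms,
    \<open>?r\<close> that of the damping factor after its first order term. They produce the
    summands with \<open>h ^ 3\<close> and \<open>h ^ 4\<close> in the bound.\<close>
  let ?R = "\<lambda>\<omega>. cos (T \<omega> + h * D \<omega>) - cos (T \<omega>) + (h * D \<omega>) * sin (T \<omega>) + (h * D \<omega>)\<^sup>2 / 2 * cos (T \<omega>)"
  let ?r = "\<lambda>\<omega>. exp (- (h\<^sup>2 * W \<omega> / 2)) - 1 + h\<^sup>2 * W \<omega> / 2"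
  have Rb: "\<bar>?R \<omega>\<bar> \<le> h ^ 3 * C ^ 3 / 6" if "\<omega> \<in> space M" for \<omega>
  proof -
    have "\<bar>?R \<omega>\<bar> \<le> \<bar>h * D \<omega>\<bar> ^ 3 / 6" by (rule cos_add_Taylor2)
    also have "\<dots> = h ^ 3 * \<bar>D \<omega>\<bar> ^ 3 / 6" using h by (simp add: abs_mult power_mult_distrib)
    also have "\<dots> \<le> h ^ 3 * C ^ 3 / 6"
      using D(2)[OF that] h by (intro divide_right_mono mult_left_mono power_mono) auto
    finally show ?thesis .
  qed
  have rb: "\<bar>?r \<omega>\<bar> \<le> h ^ 4 * B\<^sup>2 / 8" if "\<omega> \<in> space M" for \<omega>
  proof -
    have "\<bar>?r \<omega>\<bar> \<le> (h\<^sup>2 * W \<omega> / 2)\<^sup>2 / 2"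
      using W(2)[OF that] by (intro exp_minus_Taylor1) auto
    also have "\<dots> = h ^ 4 * (W \<omega>)\<^sup>2 / 8" by (simp add: power_mult_distrib power_divide)
    also have "\<dots> \<le> h ^ 4 * B\<^sup>2 / 8"
      using W(2)[OF that] h by (intro divide_right_mono mult_left_mono power_mono) auto
    finally show ?thesis .
  qed
  have iY: "integrable M (\<lambda>\<omega>. y \<omega> * f \<omega>)"
    if "y \<in> borel_measurable M" "\<And>\<omega>. \<omega> \<in> space M \<Longrightarrow> \<bar>y \<omega>\<bar> \<le> 1" "integrable M f" for y f :: "'a \<Rightarrow> real"
    by (rule Bochner_Integration.integrable_bound[OF that(3)])
       (use that in \<open>auto simp: abs_mult intro!: mult_left_le_one_le\<close>)
  have i1: "integrable M (\<lambda>\<omega>. ?ys \<omega> * D \<omega>)" "integrable M (\<lambda>\<omega>. ?yc \<omega> * ((D \<omega>)\<^sup>2 - V \<omega>))"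
      "integrable M (\<lambda>\<omega>. ?yc \<omega> * (V \<omega> - W \<omega>))"
    using iD iD2 V iW yb by (auto intro!: iY)
  have i2: "integrable M (\<lambda>\<omega>. z \<omega> * ?R \<omega>)" "integrable M (\<lambda>\<omega>. ?yc \<omega> * ?r \<omega>)"
    by (intro iY z(2) yb(2) integrable_bounded_real[OF _ Rb] integrable_bounded_real[OF _ rb]; measurable)+
  have i3: "integrable M (\<lambda>\<omega>. z \<omega> * cos (T \<omega> + h * D \<omega>))"
    by (rule iY) (use z(2) in \<open>auto intro!: integrable_bounded_real[where B=1]\<close>)
  have i4: "integrable M (\<lambda>\<omega>. z \<omega> * exp (- (h\<^sup>2 * W \<omega> / 2)) * cos (T \<omega>))"
    by (rule integrable_bounded_real[where B=1])
       (use z(2) W(2) in \<open>auto simp: abs_mult intro!: mult_le_one mult_nonneg_nonneg\<close>)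
  have "(\<integral>\<omega>. z \<omega> * cos (T \<omega> + h * D \<omega>) \<partial>M) - (\<integral>\<omega>. z \<omega> * exp (- (h\<^sup>2 * W \<omega> / 2)) * cos (T \<omega>) \<partial>M)
     = (\<integral>\<omega>. z \<omega> * cos (T \<omega> + h * D \<omega>) - z \<omega> * exp (- (h\<^sup>2 * W \<omega> / 2)) * cos (T \<omega>) \<partial>M)"
    using i3 i4 by simp
  \<comment> \<open>The remaining terms of order \<open>h\<^sup>2\<close> are those of
    \<open>D\<^sup>2\<close> and of \<open>W\<close>. Their difference is split at \<open>V\<close>:
    the test functions in \<open>var\<close> see \<open>D\<^sup>2\<close> and \<open>V\<close> as
    almost equal, and \<open>V\<close> is compared with \<open>W\<close> in L1. The term linear in
    \<open>h\<close> is killed by \<open>mart\<close>.\<close>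
  also have "\<dots> = (\<integral>\<omega>. z \<omega> * ?R \<omega> - ?yc \<omega> * ?r \<omega> - h * (?ys \<omega> * D \<omega>)
      - h\<^sup>2 / 2 * (?yc \<omega> * ((D \<omega>)\<^sup>2 - V \<omega>)) - h\<^sup>2 / 2 * (?yc \<omega> * (V \<omega> - W \<omega>)) \<partial>M)"
    by (intro Bochner_Integration.integral_cong refl) (simp add: algebra_simps power2_eq_square)
  also have "\<dots> = (\<integral>\<omega>. z \<omega> * ?R \<omega> \<partial>M) - (\<integral>\<omega>. ?yc \<omega> * ?r \<omega> \<partial>M) - h * (\<integral>\<omega>. ?ys \<omega> * D \<omega> \<partial>M)
      - h\<^sup>2 / 2 * (\<integral>\<omega>. ?yc \<omega> * ((D \<omega>)\<^sup>2 - V \<omega>) \<partial>M) - h\<^sup>2 / 2 * (\<integral>\<omega>. ?yc \<omega> * (V \<omega> - W \<omega>) \<partial>M)"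
    using i1 i2 by (simp only: Bochner_Integration.integral_diff Bochner_Integration.integrable_diff integrable_mult_right integral_mult_right_zero)
  finally have eq: "(\<integral>\<omega>. z \<omega> * cos (T \<omega> + h * D \<omega>) \<partial>M) - (\<integral>\<omega>. z \<omega> * exp (- (h\<^sup>2 * W \<omega> / 2)) * cos (T \<omega>) \<partial>M)
     = (\<integral>\<omega>. z \<omega> * ?R \<omega> \<partial>M) - (\<integral>\<omega>. ?yc \<omega> * ?r \<omega> \<partial>M) - h * (\<integral>\<omega>. ?ys \<omega> * D \<omega> \<partial>M)
      - h\<^sup>2 / 2 * (\<integral>\<omega>. ?yc \<omega> * ((D \<omega>)\<^sup>2 - V \<omega>) \<partial>M) - h\<^sup>2 / 2 * (\<integral>\<omega>. ?yc \<omega> * (V \<omega> - W \<omega>) \<partial>M)" .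
  have b1: "\<bar>\<integral>\<omega>. z \<omega> * ?R \<omega> \<partial>M\<bar> \<le> h ^ 3 * C ^ 3 / 6"
  proof (rule abs_integral_le_const)
    fix \<omega> assume "\<omega> \<in> space M"
    from mult_mono[OF z(2)[OF this] Rb[OF this]] show "\<bar>z \<omega> * ?R \<omega>\<bar> \<le> h ^ 3 * C ^ 3 / 6"
      by (simp add: abs_mult)
  qed
  have b2: "\<bar>\<integral>\<omega>. ?yc \<omega> * ?r \<omega> \<partial>M\<bar> \<le> h ^ 4 * B\<^sup>2 / 8"
  proof (rule abs_integral_le_const)
    fix \<omega> assume "\<omega> \<in> space M"
    from mult_mono[OF yb(2)[OF this] rb[OF this]] show "\<bar>?yc \<omega> * ?r \<omega>\<bar> \<le> h ^ 4 * B\<^sup>2 / 8"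
      by (simp add: abs_mult)
  qed
  have b3: "(\<integral>\<omega>. ?ys \<omega> * D \<omega> \<partial>M) = 0" by (rule mart[OF yF(1) yb(1)])
  have b4: "\<bar>h\<^sup>2 / 2 * (\<integral>\<omega>. ?yc \<omega> * ((D \<omega>)\<^sup>2 - V \<omega>) \<partial>M)\<bar> \<le> h\<^sup>2 / 2 * \<eta>"
    unfolding abs_mult using var[OF yF(2) yb(2)] by (intro mult_mono) auto
  have "\<bar>\<integral>\<omega>. ?yc \<omega> * (V \<omega> - W \<omega>) \<partial>M\<bar> \<le> (\<integral>\<omega>. \<bar>V \<omega> - W \<omega>\<bar> \<partial>M)"
  proof (rule abs_integral_le_integral)
    fix \<omega> assume "\<omega> \<in> space M"
    from mult_right_mono[OF yb(2)[OF this] abs_ge_zero[of "V \<omega> - W \<omega>"]]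
    show "\<bar>?yc \<omega> * (V \<omega> - W \<omega>)\<bar> \<le> \<bar>V \<omega> - W \<omega>\<bar>" by (simp add: abs_mult)
  qed (use V iW in auto)
  then have b5: "\<bar>h\<^sup>2 / 2 * (\<integral>\<omega>. ?yc \<omega> * (V \<omega> - W \<omega>) \<partial>M)\<bar> \<le> h\<^sup>2 / 2 * (\<integral>\<omega>. \<bar>V \<omega> - W \<omega>\<bar> \<partial>M)"
    unfolding abs_mult by (intro mult_mono) auto
  show ?thesis
    unfolding eq b3 distrib_left[of "h\<^sup>2 / 2" \<eta>] using b1 b2 b4 b5 by linarith
qed

end

section \<open>Filtrations and conditional probabilities along them\<close>

locale filtered_prob_space = prob_space M for M :: "'a measure" +
  fixes G :: "nat \<Rightarrow> 'a measure"
  assumes filtration: "filtration M G"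
begin

lemma subalg: "subalgebra M (G n)"
  using filtration by (simp add: filtration_def)

lemma space_G [simp]: "space (G n) = space M"
  using subalg[of n] by (simp add: subalgebra_def)

lemma sets_G_mono: "m \<le> n \<Longrightarrow> sets (G m) \<subseteq> sets (G n)"
  using filtration by (auto simp: filtration_def intro!: lift_Suc_mono_le[of "\<lambda>n. sets (G n)" m n, THEN subsetD])

lemma subalg_mono: "m \<le> n \<Longrightarrow> subalgebra (G n) (G m)"
  using sets_G_mono by (auto simp: subalgebra_def)

lemma measurable_G_mono: "f \<in> measurable (G m) N \<Longrightarrow> m \<le> n \<Longrightarrow> f \<in> measurable (G n) N"
  by (rule measurable_from_subalg[OF subalg_mono])

lemma measurable_G_M: "f \<in> measurable (G m) N \<Longrightarrow> f \<in> measurable M N"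
  by (rule measurable_from_subalg[OF subalg])

lemma sigma_finite_subalgebra_prob:
  "subalgebra M F \<Longrightarrow> sigma_finite_subalgebra M F"
  by (intro finite_measure_subalgebra_is_sigma_finite finite_measure_subalgebra.intro
      finite_measure_subalgebra_axioms.intro) unfold_locales

lemma sigma_finite_G: "sigma_finite_subalgebra M (G n)"
  by (rule sigma_finite_subalgebra_prob[OF subalg])

text \<open>The conditional probabilities of an event along the filtration are Cauchy in \<open>L\<^sup>1\<close>: their
  second moments increase to a limit, and by orthogonality the second moment of an increment
  is the increment of the second moments.\<close>

lemma cond_prob_Cauchy:
  fixes e :: real
  assumes A: "A \<in> sets M" and e: "0 < e"
  obtains \<phi> :: "nat \<Rightarrow> 'a \<Rightarrow> real" and m where
    "\<And>n. \<phi> n \<in> borel_measurable (G n)" "\<And>n \<omega>. \<bar>\<phi> n \<omega>\<bar> \<le> 1"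
    "\<And>n f. f \<in> borel_measurable (G n) \<Longrightarrow> integrable M f \<Longrightarrow>
       (\<integral>\<omega>. indicator A \<omega> * f \<omega> \<partial>M) = (\<integral>\<omega>. \<phi> n \<omega> * f \<omega> \<partial>M)"
    "\<And>n. m \<le> n \<Longrightarrow> (\<integral>\<omega>. \<bar>\<phi> n \<omega> - \<phi> m \<omega>\<bar> \<partial>M) \<le> e"
proof -
  \<comment> \<open>\<open>real_cond_exp\<close> lies in [0,1] only almost everywhere. Cutting it
    off gives a version with this bound at every point, still measurable at time
    \<open>n\<close>.\<close>
  define \<phi> where "\<phi> n \<omega> = max 0 (min (1::real) (real_cond_exp M (G n) (indicator A) \<omega>))" for n \<omega>
  have meas: "\<phi> n \<in> borel_measurable (G n)" for n
    unfolding \<phi>_def by measurable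
  note [measurable] = measurable_G_M[OF meas]
  have bd: "\<bar>\<phi> n \<omega>\<bar> \<le> 1" for n \<omega> by (simp add: \<phi>_def)
  have iA: "integrable M (indicator A :: 'a \<Rightarrow> real)"
    by (rule integrable_bounded_real[where B=1]) (use A in \<open>auto simp: indicator_def\<close>)
  have ae: "AE \<omega> in M. \<phi> n \<omega> = real_cond_exp M (G n) (indicator A) \<omega>" for n
  proof -
    interpret sigma_finite_subalgebra M "G n" by (rule sigma_finite_G)
    have "AE \<omega> in M. 0 \<le> real_cond_exp M (G n) (indicator A) \<omega>"
      using iA by (intro real_cond_exp_pos) auto
    moreover have "AE \<omega> in M. real_cond_exp M (G n) (indicator A) \<omega> \<le> 1"
      using iA by (intro real_cond_exp_le_c) (auto simp: indicator_def)
    ultimately show ?thesis by eventually_elim (simp add: \<phi>_def)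
  qed
  have proj: "(\<integral>\<omega>. indicator A \<omega> * f \<omega> \<partial>M) = (\<integral>\<omega>. \<phi> n \<omega> * f \<omega> \<partial>M)"
    if f: "f \<in> borel_measurable (G n)" "integrable M f" for f n
  proof -
    interpret sigma_finite_subalgebra M "G n" by (rule sigma_finite_G)
    note [measurable] = measurable_G_M[OF f(1)]
    have int: "integrable M (\<lambda>\<omega>. f \<omega> * indicator A \<omega>)"
      by (rule Bochner_Integration.integrable_bound[OF f(2)]) (use A in \<open>auto simp: indicator_def\<close>)
    have "(\<integral>\<omega>. indicator A \<omega> * f \<omega> \<partial>M) = (\<integral>\<omega>. f \<omega> * indicator A \<omega> \<partial>M)" by (simp add: mult.commute)
    also have "\<dots> = (\<integral>\<omega>. f \<omega> * real_cond_exp M (G n) (indicator A) \<omega> \<partial>M)"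
      using real_cond_exp_intg(2)[OF int f(1)] A by simp
    also have "\<dots> = (\<integral>\<omega>. \<phi> n \<omega> * f \<omega> \<partial>M)"
      by (rule integral_cong_AE) (use ae[of n] in \<open>auto simp: mult.commute\<close>)
    finally show ?thesis .
  qed
  have int: "integrable M (\<lambda>\<omega>. \<phi> n \<omega> * \<phi> m \<omega>)" for n m
    by (rule integrable_bounded_real[where B=1]) (auto simp: abs_mult bd mult_le_one)
  have int1: "integrable M (\<phi> n)" for n
    by (rule integrable_bounded_real[where B=1]) (auto simp: bd)
  define a where "a n = (\<integral>\<omega>. \<phi> n \<omega> * \<phi> n \<omega> \<partial>M)" for n
  have incr: "(\<integral>\<omega>. (\<phi> n \<omega> - \<phi> m \<omega>)\<^sup>2 \<partial>M) = a n - a m" if "m \<le> n" for m n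
  proof -
    \<comment> \<open>Testing the event with \<open>\<phi> m\<close> may be done at time
      \<open>n\<close> or at time \<open>m\<close>. Equating the two results shows that the
      increment is orthogonal to \<open>\<phi> m\<close>.\<close>
    have cross: "(\<integral>\<omega>. \<phi> n \<omega> * \<phi> m \<omega> \<partial>M) = a m"
      using proj[OF measurable_G_mono[OF meas that] int1] proj[OF meas[of m] int1] by (simp add: a_def)
    have "(\<integral>\<omega>. (\<phi> n \<omega> - \<phi> m \<omega>)\<^sup>2 \<partial>M) = (\<integral>\<omega>. \<phi> n \<omega> * \<phi> n \<omega> - 2 * (\<phi> n \<omega> * \<phi> m \<omega>) + \<phi> m \<omega> * \<phi> m \<omega> \<partial>M)"
      by (intro Bochner_Integration.integral_cong) (auto simp: power2_eq_square algebra_simps)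
    also have "\<dots> = a n - 2 * a m + a m"
      using int by (simp add: cross flip: a_def)
    finally show ?thesis by simp
  qed
  have sq_nonneg: "0 \<le> (\<integral>\<omega>. (\<phi> n \<omega> - \<phi> m \<omega>)\<^sup>2 \<partial>M)" for m n by simp
  have "incseq a"
  proof (rule incseq_SucI)
    show "a n \<le> a (Suc n)" for n using incr[of n "Suc n"] sq_nonneg[of "Suc n" n] by simp
  qed
  moreover have "\<bar>a n\<bar> \<le> 1" for n
    unfolding a_def by (rule abs_integral_le_const) (simp only: abs_mult bd mult_le_one abs_ge_zero)
  ultimately have "Cauchy a"
    by (intro LIMSEQ_imp_Cauchy[of a "SUP i. a i"] LIMSEQ_incseq_SUP bdd_aboveI[of _ 1]) (auto simp: abs_le_iff)
  \<comment> \<open>The tolerance is squared because the L1 norm is bounded by the square root of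
    the second moment.\<close>
  then obtain m where m: "\<And>n k. n \<ge> m \<Longrightarrow> k \<ge> m \<Longrightarrow> \<bar>a n - a k\<bar> < e\<^sup>2"
    using metric_CauchyD[of a "e\<^sup>2"] e by (auto simp: dist_real_def)
  have "(\<integral>\<omega>. \<bar>\<phi> n \<omega> - \<phi> m \<omega>\<bar> \<partial>M) \<le> e" if "m \<le> n" for n
  proof -
    have sq_int: "integrable M (\<lambda>\<omega>. (\<phi> n \<omega> - \<phi> m \<omega>)\<^sup>2)"
      unfolding power2_diff using int[of n n] int[of m m] int[of n m]
      by (auto simp: power2_eq_square mult.assoc intro!: Bochner_Integration.integrable_diff Bochner_Integration.integrable_add integrable_mult_right)
    have "(\<integral>\<omega>. \<bar>\<phi> n \<omega> - \<phi> m \<omega>\<bar> \<partial>M)\<^sup>2 \<le> (\<integral>\<omega>. \<bar>\<phi> n \<omega> - \<phi> m \<omega>\<bar>\<^sup>2 \<partial>M)"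
      using power2_integral_abs_le[of "\<lambda>\<omega>. \<phi> n \<omega> - \<phi> m \<omega>", OF _ sq_int] by simp
    also have "\<dots> = a n - a m" using incr[OF that] by simp
    also have "\<dots> \<le> e\<^sup>2" using m[of n m] that by simp
    finally show ?thesis by (rule power2_le_imp_le) (rule less_imp_le[OF e])
  qed
  from that[OF meas bd proj this] show ?thesis .
qed

end

section \<open>Damped cosines along a bounded martingale\<close>

context filtered_prob_space
begin

text \<open>\<open>Q k\<close> interpolates between the two integrals: at \<open>k = n\<close> the
  damping has gone, at \<open>k = p\<close> the partial sum is empty and only the damped
  \<open>cos s\<close> is left. Every step from \<open>p\<close> to \<open>n\<close> costs the bound
  of \<open>cos_increment_bound\<close> with \<open>h = 1 / sqrt n\<close>, which adds up to
  \<open>\<eta> / 2\<close>, half the L1 distance of \<open>V\<close> and \<open>W\<close>, and the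
  terms with \<open>C ^ 3\<close> and \<open>B\<^sup>2\<close>. The rest are boundary costs.
  Dropping the first \<open>p\<close> increments costs \<open>p * C / sqrt n\<close>, as the cosine
  is 1-Lipschitz. Completing the exponent \<open>W (n - p) / (2 n)\<close> to \<open>V / 2\<close>
  costs \<open>p * B / (2 n)\<close> and the other half of the L1 distance.\<close>

lemma cos_martingale_damping:
  fixes D :: "nat \<Rightarrow> 'a \<Rightarrow> real" and V W \<phi> :: "'a \<Rightarrow> real" and B C \<eta> s :: real
  assumes D: "\<And>k. 1 \<le> k \<Longrightarrow> D k \<in> borel_measurable (G k)"
      "\<And>k \<omega>. 1 \<le> k \<Longrightarrow> \<omega> \<in> space M \<Longrightarrow> \<bar>D k \<omega>\<bar> \<le> C"
    and mart: "\<And>k y. 1 \<le> k \<Longrightarrow> y \<in> borel_measurable (G (k - 1)) \<Longrightarrow> (\<And>\<omega>. \<omega> \<in> space M \<Longrightarrow> \<bar>y \<omega>\<bar> \<le> 1) \<Longrightarrow>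
        (\<integral>\<omega>. y \<omega> * D k \<omega> \<partial>M) = 0"
    and var: "\<And>k y. p < k \<Longrightarrow> y \<in> borel_measurable (G (k - 1)) \<Longrightarrow> (\<And>\<omega>. \<omega> \<in> space M \<Longrightarrow> \<bar>y \<omega>\<bar> \<le> 1) \<Longrightarrow>
        \<bar>\<integral>\<omega>. y \<omega> * ((D k \<omega>)\<^sup>2 - V \<omega>) \<partial>M\<bar> \<le> \<eta>"
    and V: "integrable M V" "\<And>\<omega>. \<omega> \<in> space M \<Longrightarrow> 0 \<le> V \<omega>"
    and W: "W \<in> borel_measurable (G p)" "\<And>\<omega>. \<omega> \<in> space M \<Longrightarrow> 0 \<le> W \<omega> \<and> W \<omega> \<le> B"
    and \<phi>: "\<phi> \<in> borel_measurable (G p)" "\<And>\<omega>. \<bar>\<phi> \<omega>\<bar> \<le> 1"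
    and n: "p \<le> n" "0 < n"
    and \<eta>: "0 \<le> \<eta>"
  shows "\<bar>(\<integral>\<omega>. \<phi> \<omega> * cos (s + (\<Sum>k=1..n. D k \<omega>) / sqrt n) \<partial>M) - (\<integral>\<omega>. \<phi> \<omega> * (exp (- V \<omega> / 2) * cos s) \<partial>M)\<bar>
    \<le> \<eta> / 2 + (\<integral>\<omega>. \<bar>V \<omega> - W \<omega>\<bar> \<partial>M) + (C ^ 3 / 6 + p * C) / sqrt n + (B\<^sup>2 / 8 + p * B / 2) / n"
proof -
  note DM[measurable (raw)] = D(1)
  \<comment> \<open>The sum starts after \<open>p\<close>: from there on \<open>W\<close> and
    \<open>\<phi>\<close> are known, so the weight \<open>z (Suc k)\<close> is an admissible test
    function at time \<open>k\<close>.\<close>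
  define T where "T k \<omega> = s + (\<Sum>l\<in>{p<..k}. D l \<omega>) / sqrt n" for k \<omega>
  define z where "z k \<omega> = \<phi> \<omega> * exp (- (W \<omega> * real (n - k) / (2 * n)))" for k \<omega>
  define Q where "Q k = (\<integral>\<omega>. z k \<omega> * cos (T k \<omega>) \<partial>M)" for k
  define I where "I = (\<integral>\<omega>. \<bar>V \<omega> - W \<omega>\<bar> \<partial>M)"
  define h where "h = 1 / sqrt n"
  have h2: "h\<^sup>2 = 1 / n" and h3: "h ^ 3 = 1 / (n * sqrt n)" and h4: "h ^ 4 = 1 / (n * n)"
    using n by (auto simp: h_def power_divide power3_eq_cube power4_eq_xxxx)
  have C0: "0 \<le> C" using D(2)[of 1] not_empty by (force intro: order_trans[OF abs_ge_zero])
  have B0: "0 \<le> B" using W(2) not_empty by force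
  have T_meas: "T k \<in> borel_measurable (G k)" for k
    unfolding T_def
    by (intro borel_measurable_add borel_measurable_const borel_measurable_divide borel_measurable_sum)
       (auto intro!: measurable_G_mono[OF D(1)])
  have z_meas: "z k \<in> borel_measurable (G j)" if "p \<le> j" for k j
  proof -
    note [measurable] = measurable_G_mono[OF W(1) that] measurable_G_mono[OF \<phi>(1) that]
    show ?thesis unfolding z_def by measurable
  qed
  note [measurable] = measurable_G_M[OF T_meas] measurable_G_M[OF z_meas[OF order.refl]]
    measurable_G_M[OF W(1)] measurable_G_M[OF \<phi>(1)]
  have VM[measurable]: "V \<in> borel_measurable M" using V(1) by simp
  have SM[measurable]: "(\<lambda>\<omega>. \<Sum>k=1..n. D k \<omega>) \<in> borel_measurable M"
    using measurable_G_M[OF D(1)] by (intro borel_measurable_sum) auto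
  have zb: "\<bar>z k \<omega>\<bar> \<le> 1" if "\<omega> \<in> space M" for k \<omega>
    unfolding z_def abs_mult using \<phi>(2) W(2)[OF that] by (intro mult_le_one) auto
  have iW: "integrable M W" by (rule integrable_bounded_real[of _ B]) (use W(2) in auto)
  have step: "\<bar>Q (Suc k) - Q k\<bar> \<le> (\<eta> + I) / (2 * n) + C ^ 3 / 6 / (n * sqrt n) + B\<^sup>2 / 8 / (n * n)"
    if k: "p \<le> k" "k < n" for k
  proof -
    have "\<bar>(\<integral>\<omega>. z (Suc k) \<omega> * cos (T k \<omega> + h * D (Suc k) \<omega>) \<partial>M) - (\<integral>\<omega>. z (Suc k) \<omega> * exp (- (h\<^sup>2 * W \<omega> / 2)) * cos (T k \<omega>) \<partial>M)\<bar>
      \<le> h\<^sup>2 / 2 * (\<eta> + (\<integral>\<omega>. \<bar>V \<omega> - W \<omega>\<bar> \<partial>M)) + h ^ 3 * C ^ 3 / 6 + h ^ 4 * B\<^sup>2 / 8"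
    proof (rule cos_increment_bound[OF subalg[of k]])
      show "z (Suc k) \<in> borel_measurable (G k)" using z_meas k by simp
      show "T k \<in> borel_measurable (G k)" by (rule T_meas)
      show "D (Suc k) \<in> borel_measurable M" using measurable_G_M[OF D(1)] by simp
    qed (use zb D(2) mart[of "Suc k"] var[of "Suc k"] k V W h_def in auto)
    moreover have "T k \<omega> + h * D (Suc k) \<omega> = T (Suc k) \<omega>" for \<omega>
    proof -
      have "{p<..Suc k} = insert (Suc k) {p<..k}" using k by auto
      then show ?thesis by (simp add: T_def h_def add_divide_distrib)
    qed
    \<comment> \<open>The damping \<open>h\<^sup>2 W / 2\<close> that replaces the increment
      restores exactly the unit that separates the exponents of \<open>z (Suc k)\<close> and
      \<open>z k\<close>. This is what makes the sum telescope.\<close>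
    moreover have "z (Suc k) \<omega> * exp (- (h\<^sup>2 * W \<omega> / 2)) = z k \<omega>" for \<omega>
    proof -
      have "real (n - k) = real (n - Suc k) + 1" using k by (simp add: of_nat_diff)
      then show ?thesis
        by (simp add: z_def h2 mult.assoc exp_add[symmetric] field_simps) 
    qed
    ultimately show ?thesis unfolding Q_def h2 h3 h4 I_def by (simp add: field_simps)
  qed
  define \<delta> where "\<delta> = (\<eta> + I) / (2 * n) + C ^ 3 / 6 / (n * sqrt n) + B\<^sup>2 / 8 / (n * n)"
  have I0: "0 \<le> I" unfolding I_def by simp
  have \<delta>0: "0 \<le> \<delta>" unfolding \<delta>_def using \<eta> I0 C0 by (intro add_nonneg_nonneg divide_nonneg_nonneg) auto
  have tele: "\<bar>Q k - Q p\<bar> \<le> real (k - p) * \<delta>" if "p \<le> k" "k \<le> n" for k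
    using that
  proof (induction k rule: dec_induct)
    case (step k)
    then have "\<bar>Q (Suc k) - Q p\<bar> \<le> \<delta> + real (k - p) * \<delta>"
      using step(3) \<open>\<And>k. p \<le> k \<Longrightarrow> k < n \<Longrightarrow> \<bar>Q (Suc k) - Q k\<bar> \<le> _\<close>[of k] unfolding \<delta>_def[symmetric] by simp
    also have "\<dots> = real (Suc k - p) * \<delta>"
      using step by (simp add: Suc_diff_le algebra_simps)
    finally show ?case .
  qed simp
  have "real (n - p) * \<delta> \<le> n * \<delta>" using \<delta>0 by (intro mult_right_mono) auto
  also have "\<dots> = (\<eta> + I) / 2 + C ^ 3 / 6 / sqrt n + B\<^sup>2 / 8 / n"
    using n unfolding \<delta>_def by (simp add: field_simps)
  finally have e1: "\<bar>Q n - Q p\<bar> \<le> (\<eta> + I) / 2 + C ^ 3 / 6 / sqrt n + B\<^sup>2 / 8 / n"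
    using tele[OF n(1) order.refl] by linarith
  have e2: "\<bar>(\<integral>\<omega>. \<phi> \<omega> * cos (s + (\<Sum>k=1..n. D k \<omega>) / sqrt n) \<partial>M) - Q n\<bar> \<le> p * C / sqrt n"
  proof -
    have i1: "integrable M (\<lambda>\<omega>. \<phi> \<omega> * cos (s + (\<Sum>k=1..n. D k \<omega>) / sqrt n))" "integrable M (\<lambda>\<omega>. z n \<omega> * cos (T n \<omega>))"
      by (rule integrable_bounded_real[where B=1]; use \<phi>(2) zb in \<open>auto simp: abs_mult mult_le_one simp del: One_nat_def\<close>)+
    have "\<bar>(\<integral>\<omega>. \<phi> \<omega> * cos (s + (\<Sum>k=1..n. D k \<omega>) / sqrt n) - z n \<omega> * cos (T n \<omega>) \<partial>M)\<bar> \<le> p * C / sqrt n"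
    proof (rule abs_integral_le_const)
      fix \<omega> assume \<omega>: "\<omega> \<in> space M"
      have "{1..n} = {1..p} \<union> {p<..n}" "{1..p} \<inter> {p<..n} = {}" using n by auto
      then have "(\<Sum>k=1..n. D k \<omega>) = (\<Sum>k=1..p. D k \<omega>) + (\<Sum>k\<in>{p<..n}. D k \<omega>)"
        by (simp add: sum.union_disjoint del: One_nat_def)
      moreover have "\<bar>\<Sum>k=1..p. D k \<omega>\<bar> \<le> p * C"
        using D(2)[OF _ \<omega>] by (intro order_trans[OF sum_abs] order_trans[OF sum_bounded_above[where K=C]]) auto
      ultimately have "\<bar>(s + (\<Sum>k=1..n. D k \<omega>) / sqrt n) - T n \<omega>\<bar> \<le> p * C / sqrt n"
        by (simp add: T_def add_divide_distrib divide_right_mono)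
      then have "\<bar>cos (s + (\<Sum>k=1..n. D k \<omega>) / sqrt n) - cos (T n \<omega>)\<bar> \<le> p * C / sqrt n"
        using abs_cos_diff_le order_trans by blast
      from mult_mono[OF \<phi>(2)[of \<omega>] this]
      show "\<bar>\<phi> \<omega> * cos (s + (\<Sum>k=1..n. D k \<omega>) / sqrt n) - z n \<omega> * cos (T n \<omega>)\<bar> \<le> p * C / sqrt n"
        by (simp add: z_def abs_mult[symmetric] right_diff_distrib)
    qed
    then show ?thesis using i1 by (simp add: Q_def)
  qed
  have e3: "\<bar>Q p - (\<integral>\<omega>. \<phi> \<omega> * (exp (- V \<omega> / 2) * cos s) \<partial>M)\<bar> \<le> I / 2 + p * B / 2 / n"
  proof -
    have i1: "integrable M (\<lambda>\<omega>. z p \<omega> * cos (T p \<omega>))" "integrable M (\<lambda>\<omega>. \<phi> \<omega> * (exp (- V \<omega> / 2) * cos s))"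
      by (rule integrable_bounded_real[where B=1]; use \<phi>(2) zb V(2) in \<open>auto simp: abs_mult mult_le_one\<close>)+
    have "\<bar>(\<integral>\<omega>. z p \<omega> * cos (T p \<omega>) - \<phi> \<omega> * (exp (- V \<omega> / 2) * cos s) \<partial>M)\<bar>
       \<le> (\<integral>\<omega>. \<bar>V \<omega> - W \<omega>\<bar> / 2 + p * B / 2 / n \<partial>M)"
    proof (rule abs_integral_le_integral)
      fix \<omega> assume \<omega>: "\<omega> \<in> space M"
      have tri: "\<bar>a / 2 - b - c / 2\<bar> \<le> \<bar>c - a\<bar> / 2 + \<bar>b\<bar>" for a b c :: real by (simp add: abs_if field_simps)
      have eq: "W \<omega> * real (n - p) / (2 * n) = W \<omega> / 2 - W \<omega> * p / (2 * n)"
        using n by (simp add: of_nat_diff field_simps)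
      have "\<bar>exp (- (W \<omega> * real (n - p) / (2 * n))) - exp (- (V \<omega> / 2))\<bar> \<le> \<bar>W \<omega> * real (n - p) / (2 * n) - V \<omega> / 2\<bar>"
        using W(2)[OF \<omega>] V(2)[OF \<omega>] by (intro abs_exp_minus_diff_le) auto
      also have "\<dots> \<le> \<bar>V \<omega> - W \<omega>\<bar> / 2 + \<bar>W \<omega> * p / (2 * n)\<bar>" unfolding eq by (rule tri)
      also have "\<bar>W \<omega> * p / (2 * n)\<bar> \<le> B * p / (2 * n)"
        using W(2)[OF \<omega>] by (simp add: abs_mult divide_right_mono mult_right_mono)
      finally have b: "\<bar>exp (- (W \<omega> * real (n - p) / (2 * n))) - exp (- (V \<omega> / 2))\<bar> \<le> \<bar>V \<omega> - W \<omega>\<bar> / 2 + p * B / 2 / n"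
        by (simp add: field_simps)
      have "\<bar>\<phi> \<omega> * cos s\<bar> \<le> 1" using \<phi>(2) by (simp add: abs_mult mult_le_one)
      from mult_mono[OF this b] 
      show "\<bar>z p \<omega> * cos (T p \<omega>) - \<phi> \<omega> * (exp (- V \<omega> / 2) * cos s)\<bar> \<le> \<bar>V \<omega> - W \<omega>\<bar> / 2 + p * B / 2 / n"
        by (simp add: z_def T_def abs_mult[symmetric] algebra_simps)
    qed (use V iW in auto)
    also have "\<dots> = I / 2 + p * B / 2 / n" unfolding I_def using V iW by (simp add: prob_space)
    finally show ?thesis using i1 by (simp add: Q_def)
  qed
  have "\<bar>(\<integral>\<omega>. \<phi> \<omega> * cos (s + (\<Sum>k=1..n. D k \<omega>) / sqrt n) \<partial>M) - (\<integral>\<omega>. \<phi> \<omega> * (exp (- V \<omega> / 2) * cos s) \<partial>M)\<bar>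
    \<le> p * C / sqrt n + ((\<eta> + I) / 2 + C ^ 3 / 6 / sqrt n + B\<^sup>2 / 8 / n) + (I / 2 + p * B / 2 / n)"
    using e1 e2 e3 by linarith
  also have "\<dots> = \<eta> / 2 + I + (C ^ 3 / 6 + p * C) / sqrt n + (B\<^sup>2 / 8 + p * B / 2) / n"
    by (simp add: add_divide_distrib)
  finally show ?thesis unfolding I_def .
qed

text \<open>With \<open>p\<close> fixed, the error terms containing \<open>C\<close>,
  \<open>B\<close> and \<open>p\<close> vanish as \<open>n\<close> grows. What remains is governed
  by \<open>\<eta>\<close> beyond \<open>p\<close>, the L1 distance of \<open>V\<close> and
  \<open>W p\<close>, and the oscillation of the conditional probabilities of \<open>A\<close> after
  \<open>p\<close>; all three are made small by choosing \<open>p\<close> first.\<close>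

lemma stable_cos_bounded_martingale:
  fixes D W :: "nat \<Rightarrow> 'a \<Rightarrow> real" and V :: "'a \<Rightarrow> real" and \<eta> :: "nat \<Rightarrow> real"
  assumes D: "\<And>k. 1 \<le> k \<Longrightarrow> D k \<in> borel_measurable (G k)"
      "\<And>k \<omega>. 1 \<le> k \<Longrightarrow> \<omega> \<in> space M \<Longrightarrow> \<bar>D k \<omega>\<bar> \<le> C"
    and mart: "\<And>k y. 1 \<le> k \<Longrightarrow> y \<in> borel_measurable (G (k - 1)) \<Longrightarrow> (\<And>\<omega>. \<omega> \<in> space M \<Longrightarrow> \<bar>y \<omega>\<bar> \<le> 1) \<Longrightarrow>
        (\<integral>\<omega>. y \<omega> * D k \<omega> \<partial>M) = 0"
    and var: "\<And>k y. 1 \<le> k \<Longrightarrow> y \<in> borel_measurable (G (k - 1)) \<Longrightarrow> (\<And>\<omega>. \<omega> \<in> space M \<Longrightarrow> \<bar>y \<omega>\<bar> \<le> 1) \<Longrightarrow>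
        \<bar>\<integral>\<omega>. y \<omega> * ((D k \<omega>)\<^sup>2 - V \<omega>) \<partial>M\<bar> \<le> \<eta> k"
    and \<eta>: "\<eta> \<longlonglongrightarrow> 0"
    and V: "integrable M V" "\<And>\<omega>. \<omega> \<in> space M \<Longrightarrow> 0 \<le> V \<omega>"
    and W: "\<And>p. W p \<in> borel_measurable (G p)" "\<And>p \<omega>. \<omega> \<in> space M \<Longrightarrow> 0 \<le> W p \<omega> \<and> W p \<omega> \<le> B"
    and conv: "(\<lambda>p. \<integral>\<omega>. \<bar>V \<omega> - W p \<omega>\<bar> \<partial>M) \<longlonglongrightarrow> 0"
    and A: "A \<in> sets M"
  shows "(\<lambda>n. \<integral>\<omega>. indicator A \<omega> * cos (s + (\<Sum>k=1..n. D k \<omega>) / sqrt n) \<partial>M)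
    \<longlonglongrightarrow> (\<integral>\<omega>. indicator A \<omega> * (exp (- V \<omega> / 2) * cos s) \<partial>M)"
proof (rule LIMSEQ_I)
  fix e :: real assume e: "0 < e"
  \<comment> \<open>The errors below total less than 8.5 \<open>d\<close>: less than 2.5
    \<open>d\<close> from the damping bound, 2 \<open>d\<close> from replacing the event for the
    cosine, and 4 \<open>d\<close> from replacing it for the limit.\<close>
  define d where "d = e / 16"
  have d: "0 < d" using e by (simp add: d_def)
  obtain \<phi> m where \<phi>: "\<And>n. \<phi> n \<in> borel_measurable (G n)" "\<And>n \<omega>. \<bar>\<phi> n \<omega>\<bar> \<le> 1"
    "\<And>n f. f \<in> borel_measurable (G n) \<Longrightarrow> integrable M f \<Longrightarrow>
       (\<integral>\<omega>. indicator A \<omega> * f \<omega> \<partial>M) = (\<integral>\<omega>. \<phi> n \<omega> * f \<omega> \<partial>M)"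
    "\<And>n. m \<le> n \<Longrightarrow> (\<integral>\<omega>. \<bar>\<phi> n \<omega> - \<phi> m \<omega>\<bar> \<partial>M) \<le> d"
    using cond_prob_Cauchy[OF A d] by blast
  note [measurable] = measurable_G_M[OF \<phi>(1)] measurable_G_M[OF W(1)] A
  have VM[measurable]: "V \<in> borel_measurable M" using V(1) by simp
  have i\<phi>: "integrable M (\<phi> n)" for n
    by (rule integrable_bounded_real[where B=1]) (auto simp: \<phi>(2))
  have iW: "integrable M (W p)" for p by (rule integrable_bounded_real[of _ B]) (use W(2) in auto)
  have iV: "integrable M (\<lambda>\<omega>. \<bar>V \<omega> - W p \<omega>\<bar>)" for p using V iW by auto
  obtain p where p: "m \<le> p" "\<And>k. p \<le> k \<Longrightarrow> \<eta> k < d" "(\<integral>\<omega>. \<bar>V \<omega> - W p \<omega>\<bar> \<partial>M) < d"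
  proof -
    have "eventually (\<lambda>p. m \<le> p \<and> \<eta> p < d \<and> (\<integral>\<omega>. \<bar>V \<omega> - W p \<omega>\<bar> \<partial>M) < d) sequentially"
      using order_tendstoD(2)[OF \<eta> d] order_tendstoD(2)[OF conv d] eventually_ge_at_top[of m]
      by eventually_elim auto
    then show ?thesis using that unfolding eventually_sequentially by (metis order.refl)
  qed
  \<comment> \<open>Replacing the event by its conditional probability at time \<open>p\<close> costs at most \<open>2 d\<close>.\<close>
  have repl: "\<bar>(\<integral>\<omega>. indicator A \<omega> * f \<omega> \<partial>M) - (\<integral>\<omega>. \<phi> p \<omega> * f \<omega> \<partial>M)\<bar> \<le> 2 * d"
    if n: "p \<le> n" and f: "f \<in> borel_measurable (G n)" "\<And>\<omega>. \<omega> \<in> space M \<Longrightarrow> \<bar>f \<omega>\<bar> \<le> 1" for f n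
  proof -
    note [measurable] = measurable_G_M[OF f(1)]
    have if': "integrable M f" by (rule integrable_bounded_real[where B=1]) (use f in auto)
    have i: "integrable M (\<lambda>\<omega>. \<phi> k \<omega> * f \<omega>)" for k
      by (rule integrable_bounded_real[where B=1]) (use f \<phi>(2) in \<open>auto simp: abs_mult mult_le_one\<close>)
    have "\<bar>\<integral>\<omega>. \<phi> n \<omega> * f \<omega> - \<phi> p \<omega> * f \<omega> \<partial>M\<bar> \<le> (\<integral>\<omega>. \<bar>\<phi> n \<omega> - \<phi> m \<omega>\<bar> + \<bar>\<phi> p \<omega> - \<phi> m \<omega>\<bar> \<partial>M)"
    proof (rule abs_integral_le_integral)
      fix \<omega> assume "\<omega> \<in> space M"
      from mult_left_mono[OF f(2)[OF this], of "\<bar>\<phi> n \<omega> - \<phi> p \<omega>\<bar>"]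
      show "\<bar>\<phi> n \<omega> * f \<omega> - \<phi> p \<omega> * f \<omega>\<bar> \<le> \<bar>\<phi> n \<omega> - \<phi> m \<omega>\<bar> + \<bar>\<phi> p \<omega> - \<phi> m \<omega>\<bar>"
        by (simp add: abs_mult[symmetric] left_diff_distrib)
    qed (use i\<phi> in auto)
    also have "\<dots> \<le> d + d"
      using i\<phi> \<phi>(4)[of n] \<phi>(4)[of p] n p(1) by simp
    finally show ?thesis using i \<phi>(3)[OF f(1) if'] by simp
  qed
  \<comment> \<open>\<open>repl\<close> asks for a function known at some time \<open>n\<close>,
    which the limit factor need not be. The detour through \<open>W p\<close> costs \<open>d\<close>
    on the way out, \<open>2 * d\<close> for the replacement and \<open>d\<close> on the way
    back.\<close>
  have replV: "\<bar>(\<integral>\<omega>. indicator A \<omega> * (exp (- V \<omega> / 2) * cos s) \<partial>M) - (\<integral>\<omega>. \<phi> p \<omega> * (exp (- V \<omega> / 2) * cos s) \<partial>M)\<bar> \<le> 4 * d"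
  proof -
    let ?v = "\<lambda>\<omega>. exp (- V \<omega> / 2) * cos s" and ?w = "\<lambda>\<omega>. exp (- W p \<omega> / 2) * cos s"
    have w: "\<bar>(\<integral>\<omega>. indicator A \<omega> * ?w \<omega> \<partial>M) - (\<integral>\<omega>. \<phi> p \<omega> * ?w \<omega> \<partial>M)\<bar> \<le> 2 * d"
      by (rule repl[of p]) (use W in \<open>auto simp: abs_mult mult_le_one\<close>)
    have diff: "\<bar>(\<integral>\<omega>. y \<omega> * ?v \<omega> \<partial>M) - (\<integral>\<omega>. y \<omega> * ?w \<omega> \<partial>M)\<bar> \<le> d"
      if y[measurable]: "y \<in> borel_measurable M" and yb: "\<And>\<omega>. \<omega> \<in> space M \<Longrightarrow> \<bar>y \<omega>\<bar> \<le> 1" for y :: "'a \<Rightarrow> real"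
    proof -
      have i: "integrable M (\<lambda>\<omega>. y \<omega> * ?v \<omega>)" "integrable M (\<lambda>\<omega>. y \<omega> * ?w \<omega>)"
        by (rule integrable_bounded_real[where B=1]; use yb V(2) W(2) in \<open>auto simp: abs_mult mult_le_one\<close>)+
      have "\<bar>\<integral>\<omega>. y \<omega> * ?v \<omega> - y \<omega> * ?w \<omega> \<partial>M\<bar> \<le> (\<integral>\<omega>. \<bar>V \<omega> - W p \<omega>\<bar> \<partial>M)"
      proof (rule abs_integral_le_integral[OF iV])
        fix \<omega> assume \<omega>: "\<omega> \<in> space M"
        have "\<bar>exp (- (V \<omega> / 2)) - exp (- (W p \<omega> / 2))\<bar> \<le> \<bar>V \<omega> - W p \<omega>\<bar>"
          using abs_exp_minus_diff_le[of "V \<omega> / 2" "W p \<omega> / 2"] V(2)[OF \<omega>] W(2)[OF \<omega>] by auto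
        moreover have "\<bar>y \<omega> * cos s\<bar> \<le> 1" using yb[OF \<omega>] by (simp add: abs_mult mult_le_one)
        ultimately have "\<bar>y \<omega> * cos s\<bar> * \<bar>exp (- (V \<omega> / 2)) - exp (- (W p \<omega> / 2))\<bar> \<le> 1 * \<bar>V \<omega> - W p \<omega>\<bar>"
          by (intro mult_mono) auto
        then show "\<bar>y \<omega> * ?v \<omega> - y \<omega> * ?w \<omega>\<bar> \<le> \<bar>V \<omega> - W p \<omega>\<bar>"
          by (simp add: abs_mult[symmetric] algebra_simps)
      qed
      then show ?thesis using i p(3) by simp
    qed
    show ?thesis
      using w diff[of "indicator A"] diff[of "\<phi> p"] \<phi>(2) by (auto simp: indicator_def)
  qed
  have "(\<lambda>n. (C ^ 3 / 6 + p * C) / sqrt n + (B\<^sup>2 / 8 + p * B / 2) / n) \<longlonglongrightarrow> 0"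
    by (intro tendsto_add_zero tendsto_divide_0[OF tendsto_const] filterlim_real_sequentially
        filterlim_at_top_imp_at_infinity filterlim_compose[OF sqrt_at_top])
  from order_tendstoD(2)[OF this d] obtain N where
    N: "\<And>n::nat. N \<le> n \<Longrightarrow> (C ^ 3 / 6 + p * C) / sqrt n + (B\<^sup>2 / 8 + p * B / 2) / n < d"
    unfolding eventually_sequentially by blast
  show "\<exists>no. \<forall>n\<ge>no. norm ((\<integral>\<omega>. indicator A \<omega> * cos (s + (\<Sum>k=1..n. D k \<omega>) / sqrt n) \<partial>M)
     - (\<integral>\<omega>. indicator A \<omega> * (exp (- V \<omega> / 2) * cos s) \<partial>M)) < e"
  proof (intro exI allI impI)
    fix n assume "Suc (max N p) \<le> n"
    then have n: "N \<le> n" "p \<le> n" "0 < n" by auto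
    have "\<bar>(\<integral>\<omega>. \<phi> p \<omega> * cos (s + (\<Sum>k=1..n. D k \<omega>) / sqrt n) \<partial>M) - (\<integral>\<omega>. \<phi> p \<omega> * (exp (- V \<omega> / 2) * cos s) \<partial>M)\<bar>
    \<le> d / 2 + (\<integral>\<omega>. \<bar>V \<omega> - W p \<omega>\<bar> \<partial>M) + (C ^ 3 / 6 + p * C) / sqrt n + (B\<^sup>2 / 8 + p * B / 2) / n"
    proof (rule cos_martingale_damping[OF D mart _ V W \<phi>(1,2) n(2,3)])
      fix k and y :: "'a \<Rightarrow> real"
      assume "p < k" "y \<in> borel_measurable (G (k - 1))" "\<And>\<omega>. \<omega> \<in> space M \<Longrightarrow> \<bar>y \<omega>\<bar> \<le> 1"
      then show "\<bar>\<integral>\<omega>. y \<omega> * ((D k \<omega>)\<^sup>2 - V \<omega>) \<partial>M\<bar> \<le> d"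
        using var[of k y] p(2)[of k] by force
    qed (use d in auto)
    moreover have "\<bar>(\<integral>\<omega>. indicator A \<omega> * cos (s + (\<Sum>k=1..n. D k \<omega>) / sqrt n) \<partial>M) - (\<integral>\<omega>. \<phi> p \<omega> * cos (s + (\<Sum>k=1..n. D k \<omega>) / sqrt n) \<partial>M)\<bar> \<le> 2 * d"
    proof (rule repl[OF n(2)])
      have [measurable]: "(\<lambda>\<omega>. \<Sum>k=1..n. D k \<omega>) \<in> borel_measurable (G n)"
        by (intro borel_measurable_sum) (auto intro!: measurable_G_mono[OF D(1)])
      show "(\<lambda>\<omega>. cos (s + (\<Sum>k=1..n. D k \<omega>) / sqrt n)) \<in> borel_measurable (G n)" by measurable
    qed auto
    ultimately show "norm ((\<integral>\<omega>. indicator A \<omega> * cos (s + (\<Sum>k=1..n. D k \<omega>) / sqrt n) \<partial>M)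
     - (\<integral>\<omega>. indicator A \<omega> * (exp (- V \<omega> / 2) * cos s) \<partial>M)) < e"
      using replV p(3) N[OF n(1)] d unfolding d_def real_norm_def by linarith
  qed
qed

end

section \<open>Partially conditionally identically distributed arrays\<close>

lemma subprob_kernel_measurable:
  assumes "\<And>\<omega>. \<omega> \<in> space N \<Longrightarrow> prob_space (\<kappa> \<omega>) \<and> sets (\<kappa> \<omega>) = sets borel"
    and "\<And>B. B \<in> sets borel \<Longrightarrow> (\<lambda>\<omega>. emeasure (\<kappa> \<omega>) B) \<in> borel_measurable N"
  shows "\<kappa> \<in> measurable N (subprob_algebra borel)"
  using assms by (intro measurable_subprob_algebra) (auto intro: prob_space_imp_subprob_space)

lemma real_distributionI:
  assumes "prob_space N" "sets N = sets borel"
  shows "real_distribution N"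
proof -
  interpret prob_space N by fact
  show ?thesis
    using assms(2) sets_eq_imp_space_eq[OF assms(2)] by unfold_locales auto
qed

context filtered_prob_space
begin

text \<open>Both sides are additive, positively homogeneous and continuous along increasing
  sequences in \<open>g\<close>, so the defining identity for Borel sets extends by the standard
  induction over nonnegative Borel functions.\<close>

lemma regular_cond_dist_nn_integral:
  assumes sub: "subalgebra M F" and K: "regular_cond_dist M F Y \<kappa>"
    and Y: "Y \<in> borel_measurable M" and A: "A \<in> sets F" and g: "g \<in> borel_measurable borel"
  shows "(\<integral>\<^sup>+\<omega>. indicator A \<omega> * g (Y \<omega>) \<partial>M) = (\<integral>\<^sup>+\<omega>. indicator A \<omega> * (\<integral>\<^sup>+x. g x \<partial>\<kappa> \<omega>) \<partial>M)"
proof -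
  have kp: "prob_space (\<kappa> \<omega>)" "sets (\<kappa> \<omega>) = sets borel" if "\<omega> \<in> space M" for \<omega>
    using K that by (auto simp: regular_cond_dist_def)
  have em: "emeasure (\<kappa> \<omega>) B = ennreal (measure (\<kappa> \<omega>) B)" if "\<omega> \<in> space M" for \<omega> B
    by (rule finite_measure.emeasure_eq_measure) (rule prob_space.finite_measure[OF kp(1)[OF that]])
  have km: "(\<lambda>\<omega>. measure (\<kappa> \<omega>) B) \<in> borel_measurable M" if "B \<in> sets borel" for B
    by (rule measurable_from_subalg[OF sub]) (use K that in \<open>simp add: regular_cond_dist_def\<close>)
  have [measurable]: "\<kappa> \<in> measurable M (subprob_algebra borel)"
  proof (rule subprob_kernel_measurable)
    fix B :: "real set" assume "B \<in> sets borel"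
    from km[OF this] show "(\<lambda>\<omega>. emeasure (\<kappa> \<omega>) B) \<in> borel_measurable M"
      by (subst measurable_cong[OF em]) auto
  qed (use kp in auto)
  have AM[measurable]: "A \<in> sets M" using A sub by (auto simp: subalgebra_def)
  note Y[measurable]
  show ?thesis
    using g
  proof (induction rule: borel_measurable_induct)
    case (cong f g)
    have "(\<integral>\<^sup>+x. f x \<partial>\<kappa> \<omega>) = (\<integral>\<^sup>+x. g x \<partial>\<kappa> \<omega>)" for \<omega>
      using cong by (intro nn_integral_cong) auto
    then show ?case using cong by simp
  next
    case (set B)
    then have [measurable]: "B \<in> sets borel" .
    have bd: "indicator A \<omega> * measure (\<kappa> \<omega>) B \<le> 1" if "\<omega> \<in> space M" for \<omega>
      using prob_space.prob_le_1[OF kp(1)[OF that], of B] by (auto simp: indicator_def)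
    have "(\<integral>\<^sup>+\<omega>. indicator A \<omega> * indicator B (Y \<omega>) \<partial>M) = (\<integral>\<^sup>+\<omega>. indicator (A \<inter> Y -` B \<inter> space M) \<omega> \<partial>M)"
      by (intro nn_integral_cong) (auto simp: indicator_def)
    also have "\<dots> = ennreal (measure M (A \<inter> Y -` B \<inter> space M))"
      by (simp add: emeasure_eq_measure measurable_sets Int_assoc)
    also have "measure M (A \<inter> Y -` B \<inter> space M) = (\<integral>\<omega>. indicator A \<omega> * measure (\<kappa> \<omega>) B \<partial>M)"
      using K set A by (auto simp: regular_cond_dist_def)
    also have "ennreal \<dots> = (\<integral>\<^sup>+\<omega>. ennreal (indicator A \<omega> * measure (\<kappa> \<omega>) B) \<partial>M)"
      by (intro nn_integral_eq_integral[symmetric] integrable_bounded_real[where B=1]) (use bd km[OF set] in auto)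
    also have "\<dots> = (\<integral>\<^sup>+\<omega>. indicator A \<omega> * (\<integral>\<^sup>+x. indicator B x \<partial>\<kappa> \<omega>) \<partial>M)"
      by (intro nn_integral_cong) (simp add: em kp set ennreal_mult ennreal_indicator)
    finally show ?case .
  next
    case (mult u c)
    have "(\<integral>\<^sup>+\<omega>. indicator A \<omega> * (\<integral>\<^sup>+x. c * u x \<partial>\<kappa> \<omega>) \<partial>M) = (\<integral>\<^sup>+\<omega>. c * (indicator A \<omega> * (\<integral>\<^sup>+x. u x \<partial>\<kappa> \<omega>)) \<partial>M)"
    proof (intro nn_integral_cong)
      fix \<omega> assume "\<omega> \<in> space M"
      then have "u \<in> borel_measurable (\<kappa> \<omega>)" using mult kp by (simp cong: measurable_cong_sets)
      then show "indicator A \<omega> * (\<integral>\<^sup>+x. c * u x \<partial>\<kappa> \<omega>) = c * (indicator A \<omega> * (\<integral>\<^sup>+x. u x \<partial>\<kappa> \<omega>))"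
        by (simp add: nn_integral_cmult mult_ac)
    qed
    moreover have "(\<integral>\<^sup>+\<omega>. indicator A \<omega> * (c * u (Y \<omega>)) \<partial>M) = (\<integral>\<^sup>+\<omega>. c * (indicator A \<omega> * u (Y \<omega>)) \<partial>M)"
      by (simp add: mult_ac)
    ultimately show ?case using mult by (simp add: nn_integral_cmult)
  next
    case (add u v)
    have "(\<integral>\<^sup>+\<omega>. indicator A \<omega> * (\<integral>\<^sup>+x. v x + u x \<partial>\<kappa> \<omega>) \<partial>M)
      = (\<integral>\<^sup>+\<omega>. indicator A \<omega> * (\<integral>\<^sup>+x. v x \<partial>\<kappa> \<omega>) + indicator A \<omega> * (\<integral>\<^sup>+x. u x \<partial>\<kappa> \<omega>) \<partial>M)"
    proof (intro nn_integral_cong)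
      fix \<omega> assume "\<omega> \<in> space M"
      then have "u \<in> borel_measurable (\<kappa> \<omega>)" "v \<in> borel_measurable (\<kappa> \<omega>)"
        using add kp by (simp_all cong: measurable_cong_sets)
      then show "indicator A \<omega> * (\<integral>\<^sup>+x. v x + u x \<partial>\<kappa> \<omega>) = indicator A \<omega> * (\<integral>\<^sup>+x. v x \<partial>\<kappa> \<omega>) + indicator A \<omega> * (\<integral>\<^sup>+x. u x \<partial>\<kappa> \<omega>)"
        by (simp add: nn_integral_add distrib_left)
    qed
    moreover have "(\<integral>\<^sup>+\<omega>. indicator A \<omega> * (v (Y \<omega>) + u (Y \<omega>)) \<partial>M) = (\<integral>\<^sup>+\<omega>. indicator A \<omega> * v (Y \<omega>) + indicator A \<omega> * u (Y \<omega>) \<partial>M)"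
      by (simp add: distrib_left)
    ultimately show ?case using add by (simp add: nn_integral_add)
  next
    case (seq U)
    have [measurable]: "U i \<in> borel_measurable borel" for i using seq by simp
    have inc: "incseq (\<lambda>i. indicator A \<omega> * U i (Y \<omega>))" for \<omega>
      using seq by (auto simp: incseq_def le_fun_def intro!: mult_left_mono)
    have "(\<integral>\<^sup>+\<omega>. indicator A \<omega> * (\<Squnion>i. U i) (Y \<omega>) \<partial>M) = (\<integral>\<^sup>+\<omega>. (SUP i. indicator A \<omega> * U i (Y \<omega>)) \<partial>M)"
      by (simp add: SUP_mult_left_ennreal image_comp)
    also have "\<dots> = (SUP i. \<integral>\<^sup>+\<omega>. indicator A \<omega> * U i (Y \<omega>) \<partial>M)"
      by (rule nn_integral_monotone_convergence_SUP)
         (use seq in \<open>auto simp: incseq_def le_fun_def intro!: mult_left_mono\<close>)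
    also have "\<dots> = (SUP i. \<integral>\<^sup>+\<omega>. indicator A \<omega> * (\<integral>\<^sup>+x. U i x \<partial>\<kappa> \<omega>) \<partial>M)"
      using seq by simp
    also have "\<dots> = (\<integral>\<^sup>+\<omega>. (SUP i. indicator A \<omega> * (\<integral>\<^sup>+x. U i x \<partial>\<kappa> \<omega>)) \<partial>M)"
      by (rule nn_integral_monotone_convergence_SUP[symmetric])
         (use seq in \<open>auto simp: incseq_def le_fun_def intro!: mult_left_mono nn_integral_mono\<close>)
    also have "\<dots> = (\<integral>\<^sup>+\<omega>. indicator A \<omega> * (\<integral>\<^sup>+x. (\<Squnion>i. U i) x \<partial>\<kappa> \<omega>) \<partial>M)"
    proof (intro nn_integral_cong)
      fix \<omega> assume "\<omega> \<in> space M"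
      then have "U i \<in> borel_measurable (\<kappa> \<omega>)" for i using seq kp by (simp cong: measurable_cong_sets)
      then have "(\<integral>\<^sup>+x. (SUP i. U i x) \<partial>\<kappa> \<omega>) = (SUP i. \<integral>\<^sup>+x. U i x \<partial>\<kappa> \<omega>)"
        using seq by (intro nn_integral_monotone_convergence_SUP) auto
      then show "(SUP i. indicator A \<omega> * (\<integral>\<^sup>+x. U i x \<partial>\<kappa> \<omega>)) = indicator A \<omega> * (\<integral>\<^sup>+x. (\<Squnion>i. U i) x \<partial>\<kappa> \<omega>)"
        by (simp add: SUP_mult_left_ennreal image_comp)
    qed
    finally show ?case .
  qed
qed

lemma regular_cond_dist_integral:
  fixes f :: "real \<Rightarrow> real"
  assumes sub: "subalgebra M F" and K: "regular_cond_dist M F Y \<kappa>"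
    and Y: "Y \<in> borel_measurable M" and f: "f \<in> borel_measurable borel" "\<And>x. \<bar>f x\<bar> \<le> b"
  shows "(\<lambda>\<omega>. \<integral>x. f x \<partial>\<kappa> \<omega>) \<in> borel_measurable F"
    and "\<And>\<omega>. \<omega> \<in> space M \<Longrightarrow> \<bar>\<integral>x. f x \<partial>\<kappa> \<omega>\<bar> \<le> b"
    and "AE \<omega> in M. real_cond_exp M F (\<lambda>\<omega>. f (Y \<omega>)) \<omega> = (\<integral>x. f x \<partial>\<kappa> \<omega>)"
    and "\<And>z c. z \<in> borel_measurable F \<Longrightarrow> (\<And>\<omega>. \<omega> \<in> space M \<Longrightarrow> \<bar>z \<omega>\<bar> \<le> c) \<Longrightarrow>
      (\<integral>\<omega>. z \<omega> * f (Y \<omega>) \<partial>M) = (\<integral>\<omega>. z \<omega> * (\<integral>x. f x \<partial>\<kappa> \<omega>) \<partial>M)"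
proof -
  have kp: "prob_space (\<kappa> \<omega>)" "sets (\<kappa> \<omega>) = sets borel" if "\<omega> \<in> space M" for \<omega>
    using K that by (auto simp: regular_cond_dist_def)
  have spF: "space F = space M" using sub by (simp add: subalgebra_def)
  have em: "emeasure (\<kappa> \<omega>) B = ennreal (measure (\<kappa> \<omega>) B)" if "\<omega> \<in> space M" for \<omega> B
    by (rule finite_measure.emeasure_eq_measure) (rule prob_space.finite_measure[OF kp(1)[OF that]])
  have \<kappa>[measurable]: "\<kappa> \<in> measurable F (subprob_algebra borel)"
  proof (rule subprob_kernel_measurable)
    fix B :: "real set" assume "B \<in> sets borel"
    then have "(\<lambda>\<omega>. measure (\<kappa> \<omega>) B) \<in> borel_measurable F"
      using K by (auto simp: regular_cond_dist_def)
    then show "(\<lambda>\<omega>. emeasure (\<kappa> \<omega>) B) \<in> borel_measurable F"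
      using em spF by (subst measurable_cong[of F _ "\<lambda>\<omega>. ennreal (measure (\<kappa> \<omega>) B)"]) auto
  qed (use kp spF in auto)
  note [measurable] = f(1) Y
  show mF: "(\<lambda>\<omega>. \<integral>x. f x \<partial>\<kappa> \<omega>) \<in> borel_measurable F"
    using measurable_compose[OF \<kappa> integral_measurable_subprob_algebra[OF f(1)]] .
  then have mM[measurable]: "(\<lambda>\<omega>. \<integral>x. f x \<partial>\<kappa> \<omega>) \<in> borel_measurable M"
    by (rule measurable_from_subalg[OF sub])
  have b0: "0 \<le> b" using f(2)[of 0] by linarith
  have fk: "f \<in> borel_measurable (\<kappa> \<omega>)" if "\<omega> \<in> space M" for \<omega>
    using kp[OF that] f(1) by (simp cong: measurable_cong_sets)
  show bd: "\<bar>\<integral>x. f x \<partial>\<kappa> \<omega>\<bar> \<le> b" if "\<omega> \<in> space M" for \<omega>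
    using prob_space.abs_integral_le_const[OF kp(1)[OF that], of f b] f(2) by simp
  have ik: "integrable (\<kappa> \<omega>) f" if "\<omega> \<in> space M" for \<omega>
    using prob_space.integrable_bounded_real[OF kp(1)[OF that] fk[OF that], of b] f(2) by simp
  show ae: "AE \<omega> in M. real_cond_exp M F (\<lambda>\<omega>. f (Y \<omega>)) \<omega> = (\<integral>x. f x \<partial>\<kappa> \<omega>)"
  proof -
    interpret sigma_finite_subalgebra M F by (rule sigma_finite_subalgebra_prob[OF sub])
    show ?thesis
    proof (rule real_cond_exp_charact)
      fix A assume A: "A \<in> sets F"
      then have [measurable]: "A \<in> sets M" using sub by (auto simp: subalgebra_def)
      have ind: "integrable M (\<lambda>\<omega>. indicator A \<omega> * h \<omega>)" if "integrable M h" for h :: "'a \<Rightarrow> real"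
        by (rule Bochner_Integration.integrable_bound[OF that]) (use that in \<open>auto simp: indicator_def\<close>)
      have iY: "integrable M (\<lambda>\<omega>. f (Y \<omega>))" "integrable M (\<lambda>\<omega>. \<integral>x. f x \<partial>\<kappa> \<omega>)"
        by (rule integrable_bounded_real[where B=b]; use f(2) bd in auto)+
      have i: "integrable M (\<lambda>\<omega>. indicator A \<omega> * (f (Y \<omega>) + b))"
          "integrable M (\<lambda>\<omega>. indicator A \<omega> * ((\<integral>x. f x \<partial>\<kappa> \<omega>) + b))"
          "integrable M (\<lambda>\<omega>. indicator A \<omega> * f (Y \<omega>))"
          "integrable M (\<lambda>\<omega>. indicator A \<omega> * (\<integral>x. f x \<partial>\<kappa> \<omega>))"
          "integrable M (\<lambda>\<omega>. indicator A \<omega> * b)"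
        by (intro ind Bochner_Integration.integrable_add iY integrable_const)+
      \<comment> \<open>Adding \<open>b\<close> makes the integrand nonnegative, which puts it
        within reach of \<open>regular_cond_dist_nn_integral\<close>. The constant contributes
        equally to both sides because each kernel has mass one.\<close>
      have nn: "0 \<le> f x + b" for x using f(2)[of x] by linarith
      have nnk: "0 \<le> (\<integral>x. f x \<partial>\<kappa> \<omega>) + b" if "\<omega> \<in> space M" for \<omega> using bd[OF that] by linarith
      have "ennreal (\<integral>\<omega>. indicator A \<omega> * (f (Y \<omega>) + b) \<partial>M) = (\<integral>\<^sup>+\<omega>. indicator A \<omega> * ennreal (f (Y \<omega>) + b) \<partial>M)"
        using nn_integral_eq_integral[OF i(1)] nn
        by (simp add: ennreal_mult ennreal_indicator mult_nonneg_nonneg)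
      also have "\<dots> = (\<integral>\<^sup>+\<omega>. indicator A \<omega> * (\<integral>\<^sup>+x. ennreal (f x + b) \<partial>\<kappa> \<omega>) \<partial>M)"
        by (rule regular_cond_dist_nn_integral[OF sub K Y A]) measurable
      also have "\<dots> = (\<integral>\<^sup>+\<omega>. ennreal (indicator A \<omega> * ((\<integral>x. f x \<partial>\<kappa> \<omega>) + b)) \<partial>M)"
      proof (intro nn_integral_cong)
        fix \<omega> assume \<omega>: "\<omega> \<in> space M"
        interpret \<kappa>: prob_space "\<kappa> \<omega>" by (rule kp(1)[OF \<omega>])
        have "(\<integral>\<^sup>+x. ennreal (f x + b) \<partial>\<kappa> \<omega>) = ennreal (\<integral>x. f x + b \<partial>\<kappa> \<omega>)"
          using ik[OF \<omega>] nn by (intro nn_integral_eq_integral) auto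
        also have "(\<integral>x. f x + b \<partial>\<kappa> \<omega>) = (\<integral>x. f x \<partial>\<kappa> \<omega>) + b"
          using ik[OF \<omega>] by (simp add: \<kappa>.prob_space)
        finally show "indicator A \<omega> * (\<integral>\<^sup>+x. ennreal (f x + b) \<partial>\<kappa> \<omega>) = ennreal (indicator A \<omega> * ((\<integral>x. f x \<partial>\<kappa> \<omega>) + b))"
          using nnk[OF \<omega>] by (simp add: ennreal_mult ennreal_indicator)
      qed
      also have "\<dots> = ennreal (\<integral>\<omega>. indicator A \<omega> * ((\<integral>x. f x \<partial>\<kappa> \<omega>) + b) \<partial>M)"
        using nn_integral_eq_integral[OF i(2)] nnk by simp
      finally have "(\<integral>\<omega>. indicator A \<omega> * (f (Y \<omega>) + b) \<partial>M) = (\<integral>\<omega>. indicator A \<omega> * ((\<integral>x. f x \<partial>\<kappa> \<omega>) + b) \<partial>M)"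
        by (subst (asm) ennreal_inj) (auto intro!: integral_nonneg_AE simp: nn nnk)
      then show "(\<integral>\<omega>\<in>A. f (Y \<omega>) \<partial>M) = (\<integral>\<omega>\<in>A. (\<integral>x. f x \<partial>\<kappa> \<omega>) \<partial>M)"
        using i by (simp add: set_lebesgue_integral_def distrib_left)
    qed (use f bd mF in \<open>auto intro!: integrable_bounded_real[where B=b]\<close>)
  qed
  fix z c assume z: "z \<in> borel_measurable F" "\<And>\<omega>. \<omega> \<in> space M \<Longrightarrow> \<bar>z \<omega>\<bar> \<le> (c::real)"
  interpret sigma_finite_subalgebra M F by (rule sigma_finite_subalgebra_prob[OF sub])
  have [measurable]: "z \<in> borel_measurable M" by (rule measurable_from_subalg[OF sub z(1)])
  have "integrable M (\<lambda>\<omega>. z \<omega> * f (Y \<omega>))"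
    by (rule integrable_bounded_real[where B="c * b"])
       (use z(2) f(2) in \<open>auto simp: abs_mult intro!: mult_mono' \<close>)
  from real_cond_exp_intg(2)[OF this z(1)]
  have "(\<integral>\<omega>. z \<omega> * f (Y \<omega>) \<partial>M) = (\<integral>\<omega>. z \<omega> * real_cond_exp M F (\<lambda>\<omega>. f (Y \<omega>)) \<omega> \<partial>M)" by simp
  also have "\<dots> = (\<integral>\<omega>. z \<omega> * (\<integral>x. f x \<partial>\<kappa> \<omega>) \<partial>M)"
    by (rule integral_cong_AE) (use ae in auto)
  finally show "(\<integral>\<omega>. z \<omega> * f (Y \<omega>) \<partial>M) = (\<integral>\<omega>. z \<omega> * (\<integral>x. f x \<partial>\<kappa> \<omega>) \<partial>M)" .
qed

end

text \<open>\<open>directing_measure\<close> only asserts that predictive kernels exist. Making them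
  a parameter fixes one version, so that the everywhere bounded increments and the weak convergence
  speak of the same kernels.\<close>

locale cid_array = filtered_prob_space M G for M :: "'a measure" and G :: "nat \<Rightarrow> 'a measure" +
  fixes X :: "nat \<Rightarrow> 'i::countable \<Rightarrow> 'a \<Rightarrow> real"
    and \<alpha> :: "'i \<Rightarrow> 'a \<Rightarrow> real measure" and K :: "'i \<Rightarrow> nat \<Rightarrow> 'a \<Rightarrow> real measure"
  assumes cid: "partially_cid M G X"
    and square_integrable: "\<And>n i. 1 \<le> n \<Longrightarrow> integrable M (\<lambda>\<omega>. (X n i \<omega>)\<^sup>2)"
    and rpm: "\<And>i. random_prob_measure M (\<alpha> i)"
    and K: "\<And>i n. regular_cond_dist M (G n) (X (Suc n) i) (K i n)"
    and K_conv: "\<And>i. AE \<omega> in M. weak_conv_m (\<lambda>n. K i n \<omega>) (\<alpha> i \<omega>)"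
begin

lemma X_G: "1 \<le> n \<Longrightarrow> X n i \<in> borel_measurable (G n)"
  using cid by (simp add: partially_cid_def)

lemma cid_AE:
  fixes f :: "real \<Rightarrow> real"
  assumes "1 \<le> k" "f \<in> borel_measurable borel" "bounded (range f)"
  shows "AE \<omega> in M. real_cond_exp M (Gnj M G X n j) (\<lambda>x. f (X (Suc n) j x)) \<omega>
                   = real_cond_exp M (Gnj M G X n j) (\<lambda>x. f (X (n + k) j x)) \<omega>"
  using cid assms unfolding partially_cid_def by blast

lemma X_M: "1 \<le> n \<Longrightarrow> X n i \<in> borel_measurable M"
  using measurable_G_M[OF X_G] .

lemma X_integrable: "1 \<le> n \<Longrightarrow> integrable M (X n i)"
  using square_integrable_imp_integrable[OF X_M square_integrable] .

lemma alpha_prob: "\<omega> \<in> space M \<Longrightarrow> prob_space (\<alpha> i \<omega>)"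
  and alpha_sets: "\<omega> \<in> space M \<Longrightarrow> sets (\<alpha> i \<omega>) = sets borel"
  using rpm by (auto simp: random_prob_measure_def)

lemma alpha_kernel: "\<alpha> i \<in> measurable M (subprob_algebra borel)"
  using rpm[of i] by (intro subprob_kernel_measurable) (auto simp: random_prob_measure_def)

lemma alpha_integral_measurable:
  fixes f :: "real \<Rightarrow> real"
  shows "f \<in> borel_measurable borel \<Longrightarrow> (\<lambda>\<omega>. \<integral>x. f x \<partial>\<alpha> i \<omega>) \<in> borel_measurable M"
  using measurable_compose[OF alpha_kernel integral_measurable_subprob_algebra] .

lemma alpha_integral_bound:
  fixes f :: "real \<Rightarrow> real"
  assumes "\<And>x. \<bar>f x\<bar> \<le> b" "\<omega> \<in> space M"
  shows "\<bar>\<integral>x. f x \<partial>\<alpha> i \<omega>\<bar> \<le> b"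
  using prob_space.abs_integral_le_const[OF alpha_prob[OF assms(2)], where f=f and B=b] assms(1) by simp

lemma Gnj_sets: "sets (Gnj M G X n j) = sigma_sets (space M)
   (sets (G n) \<union> (\<Union>i\<in>-{j}. {X (Suc n) i -` B \<inter> space M | B. B \<in> sets borel}))"
  unfolding Gnj_def using sets.sets_into_space[of _ "G n"] by (intro sets_measure_of) auto

lemma space_Gnj [simp]: "space (Gnj M G X n j) = space M"
  unfolding Gnj_def using sets.sets_into_space[of _ "G n"] by (intro space_measure_of) auto

lemma sets_Gnj_le: "sets (Gnj M G X n j) \<subseteq> sets (G (Suc n))"
proof -
  have "sigma_sets (space (G (Suc n))) (sets (G n) \<union> (\<Union>i\<in>-{j}. {X (Suc n) i -` B \<inter> space M | B. B \<in> sets borel}))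
      \<subseteq> sets (G (Suc n))"
    using sets_G_mono[of n "Suc n"] measurable_sets[OF X_G[of "Suc n"]]
    by (intro sets.sigma_sets_subset) auto
  then show ?thesis by (simp add: Gnj_sets)
qed

lemma subalg_Gnj: "subalgebra M (Gnj M G X n j)"
  using sets_Gnj_le subalg[of "Suc n"] by (force simp: subalgebra_def)

text \<open>What the other columns of row \<open>n + 1\<close> reveal is known at time
  \<open>n + 1\<close>. A test function of this kind can therefore be integrated against the
  predictive kernels of all later times.\<close>

lemma subalg_Gnj_G: "Suc n \<le> m \<Longrightarrow> subalgebra (G m) (Gnj M G X n j)"
  using sets_Gnj_le sets_G_mono[of "Suc n" m] by (force simp: subalgebra_def)

lemma subalg_G_Gnj: "subalgebra (Gnj M G X n j) (G n)"
  by (auto simp: subalgebra_def Gnj_sets)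

lemma X_Gnj:
  assumes "i \<noteq> j"
  shows "X (Suc n) i \<in> borel_measurable (Gnj M G X n j)"
proof (rule measurableI)
  fix B :: "real set" assume "B \<in> sets borel"
  then have "X (Suc n) i -` B \<inter> space M \<in> sets (Gnj M G X n j)"
    unfolding Gnj_sets using assms by (intro sigma_sets.Basic) auto
  then show "X (Suc n) i -` B \<inter> space (Gnj M G X n j) \<in> sets (Gnj M G X n j)" by simp
qed simp

text \<open>Weak convergence controls bounded continuous integrands. These two hypotheses on
  \<open>f\<close> recur until truncation extends the result to the identity function.\<close>

lemma K_integral_tendsto:
  fixes f :: "real \<Rightarrow> real"
  assumes f: "\<And>x. isCont f x" "\<And>x. \<bar>f x\<bar> \<le> b"
  shows "AE \<omega> in M. (\<lambda>n. \<integral>x. f x \<partial>K i n \<omega>) \<longlonglongrightarrow> (\<integral>x. f x \<partial>\<alpha> i \<omega>)"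
  using K_conv[of i] AE_space
proof eventually_elim
  case (elim \<omega>)
  have "real_distribution (K i n \<omega>)" for n
    using K[of n i] elim by (intro real_distributionI) (auto simp: regular_cond_dist_def)
  moreover have "real_distribution (\<alpha> i \<omega>)"
    using elim by (intro real_distributionI alpha_prob alpha_sets)
  ultimately show ?case
    using elim f by (intro weak_conv_imp_integral_bdd_continuous_conv) auto
qed

lemma borel_measurable_isCont: "(\<And>x. isCont f x) \<Longrightarrow> f \<in> borel_measurable borel"
  for f :: "real \<Rightarrow> real"
  by (intro borel_measurable_continuous_onI continuous_at_imp_continuous_on) auto

lemma X_Suc_M: "X (Suc n) i \<in> borel_measurable M"
  by (rule X_M) simp

lemmas K_integral = regular_cond_dist_integral[OF subalg K X_Suc_M]

text \<open>This distance between the asymptotic and the predictive mean is the only error in the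
  conditional covariances; it becomes the vanishing sequence \<open>\<eta>\<close> of the martingale
  argument.\<close>

lemma K_integral_L1:
  fixes f :: "real \<Rightarrow> real"
  assumes f: "\<And>x. isCont f x" "\<And>x. \<bar>f x\<bar> \<le> b"
  shows "(\<lambda>n. \<integral>\<omega>. \<bar>(\<integral>x. f x \<partial>\<alpha> i \<omega>) - (\<integral>x. f x \<partial>K i n \<omega>)\<bar> \<partial>M) \<longlonglongrightarrow> 0"
proof -
  note fm = borel_measurable_isCont[OF f(1)]
  have [measurable]: "(\<lambda>\<omega>. \<integral>x. f x \<partial>K i n \<omega>) \<in> borel_measurable M" for n
    by (rule measurable_G_M[OF K_integral(1)[OF fm f(2)]])
  have [measurable]: "(\<lambda>\<omega>. \<integral>x. f x \<partial>\<alpha> i \<omega>) \<in> borel_measurable M"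
    by (rule alpha_integral_measurable[OF fm])
  have "(\<lambda>n. \<integral>\<omega>. \<bar>(\<integral>x. f x \<partial>\<alpha> i \<omega>) - (\<integral>x. f x \<partial>K i n \<omega>)\<bar> \<partial>M) \<longlonglongrightarrow> (\<integral>\<omega>. 0 \<partial>M)"
  proof (rule integral_dominated_convergence[where w="\<lambda>_. 2 * b"])
    show "AE \<omega> in M. (\<lambda>n. \<bar>(\<integral>x. f x \<partial>\<alpha> i \<omega>) - (\<integral>x. f x \<partial>K i n \<omega>)\<bar>) \<longlonglongrightarrow> 0"
      using K_integral_tendsto[where i=i, OF f]
    proof eventually_elim
      case (elim \<omega>)
      from tendsto_rabs[OF tendsto_diff[OF tendsto_const[of "\<integral>x. f x \<partial>\<alpha> i \<omega>"] elim]] show ?case by simp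
    qed
    show "AE \<omega> in M. norm \<bar>(\<integral>x. f x \<partial>\<alpha> i \<omega>) - (\<integral>x. f x \<partial>K i n \<omega>)\<bar> \<le> 2 * b" for n
    proof (rule AE_I2)
      fix \<omega> assume \<omega>: "\<omega> \<in> space M"
      show "norm \<bar>(\<integral>x. f x \<partial>\<alpha> i \<omega>) - (\<integral>x. f x \<partial>K i n \<omega>)\<bar> \<le> 2 * b"
        using alpha_integral_bound[where f=f and i=i, OF f(2) \<omega>] K_integral(2)[where n=n and i=i, OF fm f(2) \<omega>] by simp
    qed
  qed simp_all
  then show ?thesis by simp
qed

text \<open>Conditionally on \<open>\<G>\<^sub>n\<close> and the other columns of row \<open>n + 1\<close>, the entry \<open>X\<^sub>n\<^sub>+\<^sub>1\<^sub>,\<^sub>j\<close> has the same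
  law as a far away entry of its column, which is asymptotically distributed as \<open>\<alpha>\<^sub>j\<close>.\<close>

lemma cid_integral:
  fixes f :: "real \<Rightarrow> real"
  assumes f: "\<And>x. isCont f x" "\<And>x. \<bar>f x\<bar> \<le> b"
    and z: "z \<in> borel_measurable (Gnj M G X n j)" "\<And>\<omega>. \<omega> \<in> space M \<Longrightarrow> \<bar>z \<omega>\<bar> \<le> c"
  shows "(\<integral>\<omega>. z \<omega> * f (X (Suc n) j \<omega>) \<partial>M) = (\<integral>\<omega>. z \<omega> * (\<integral>x. f x \<partial>\<alpha> j \<omega>) \<partial>M)"
proof -
  note fm[measurable] = borel_measurable_isCont[OF f(1)]
  interpret sigma_finite_subalgebra M "Gnj M G X n j"
    by (rule sigma_finite_subalgebra_prob[OF subalg_Gnj])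
  have zM[measurable]: "z \<in> borel_measurable M" by (rule measurable_from_subalg[OF subalg_Gnj z(1)])
  have c0: "0 \<le> c" using z(2) not_empty by (force intro: order_trans[OF abs_ge_zero])
  have b0: "0 \<le> b" using f(2)[of 0] by linarith
  have zf: "\<bar>z \<omega> * f y\<bar> \<le> c * b" if "\<omega> \<in> space M" for \<omega> y
    unfolding abs_mult using z(2)[OF that] f(2)[of y] c0 by (intro mult_mono) auto
  \<comment> \<open>The shift \<open>2 + m\<close> places the far entry strictly after row
    \<open>n + 1\<close>, so \<open>z\<close> is known at time \<open>Suc n + m\<close> and the
    kernel of that time may be inserted under \<open>z\<close>.\<close>
  have "(\<integral>\<omega>. z \<omega> * f (X (Suc n) j \<omega>) \<partial>M) = (\<integral>\<omega>. z \<omega> * (\<integral>x. f x \<partial>K j (Suc n + m) \<omega>) \<partial>M)" for m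
  proof -
    note [measurable] = X_M
    have X1[measurable]: "X (Suc n) j \<in> borel_measurable M" "X (n + (2 + m)) j \<in> borel_measurable M"
      by (intro X_M; simp)+
    have i: "integrable M (\<lambda>\<omega>. z \<omega> * f (X (Suc n) j \<omega>))" "integrable M (\<lambda>\<omega>. z \<omega> * f (X (n + (2 + m)) j \<omega>))"
      by (rule integrable_bounded_real[where B="c * b"]; use zf in simp)+
    have "bounded (range f)" using f(2) by (auto simp: bounded_iff)
    from cid_AE[where n=n and j=j and k="2 + m", OF _ fm this] have ae: "AE \<omega> in M. real_cond_exp M (Gnj M G X n j) (\<lambda>x. f (X (Suc n) j x)) \<omega>
                   = real_cond_exp M (Gnj M G X n j) (\<lambda>x. f (X (n + (2 + m)) j x)) \<omega>"
      by simp
    have "(\<integral>\<omega>. z \<omega> * f (X (Suc n) j \<omega>) \<partial>M) = (\<integral>\<omega>. z \<omega> * real_cond_exp M (Gnj M G X n j) (\<lambda>x. f (X (Suc n) j x)) \<omega> \<partial>M)"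
      using real_cond_exp_intg(2)[OF i(1) z(1)] by simp
    also have "\<dots> = (\<integral>\<omega>. z \<omega> * real_cond_exp M (Gnj M G X n j) (\<lambda>x. f (X (n + (2 + m)) j x)) \<omega> \<partial>M)"
    proof (rule integral_cong_AE)
      show "AE \<omega> in M. z \<omega> * real_cond_exp M (Gnj M G X n j) (\<lambda>x. f (X (Suc n) j x)) \<omega>
                   = z \<omega> * real_cond_exp M (Gnj M G X n j) (\<lambda>x. f (X (n + (2 + m)) j x)) \<omega>"
        using ae by eventually_elim simp
    qed (use borel_measurable_cond_exp[THEN measurable_from_subalg[OF subalg_Gnj]] in auto)
    also have "\<dots> = (\<integral>\<omega>. z \<omega> * f (X (n + (2 + m)) j \<omega>) \<partial>M)"
      using real_cond_exp_intg(2)[OF i(2) z(1)] by simp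
    also have "\<dots> = (\<integral>\<omega>. z \<omega> * f (X (Suc (Suc n + m)) j \<omega>) \<partial>M)" by simp
    also have "\<dots> = (\<integral>\<omega>. z \<omega> * (\<integral>x. f x \<partial>K j (Suc n + m) \<omega>) \<partial>M)"
      by (rule K_integral(4)[OF fm f(2) _ z(2)])
         (use measurable_from_subalg[OF subalg_Gnj_G z(1)] in auto)
    finally show ?thesis .
  qed
  moreover have "(\<lambda>m. \<integral>\<omega>. z \<omega> * (\<integral>x. f x \<partial>K j (Suc n + m) \<omega>) \<partial>M) \<longlonglongrightarrow> (\<integral>\<omega>. z \<omega> * (\<integral>x. f x \<partial>\<alpha> j \<omega>) \<partial>M)"
  proof (rule integral_dominated_convergence[where w="\<lambda>_. c * b"])
    show "(\<lambda>\<omega>. z \<omega> * (\<integral>x. f x \<partial>\<alpha> j \<omega>)) \<in> borel_measurable M"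
      using alpha_integral_measurable[OF fm] by simp
    show "(\<lambda>\<omega>. z \<omega> * (\<integral>x. f x \<partial>K j (Suc n + m) \<omega>)) \<in> borel_measurable M" for m
      using measurable_G_M[OF K_integral(1)[OF fm f(2)]] by simp
    show "AE \<omega> in M. norm (z \<omega> * (\<integral>x. f x \<partial>K j (Suc n + m) \<omega>)) \<le> c * b" for m
    proof (rule AE_I2)
      fix \<omega> assume \<omega>: "\<omega> \<in> space M"
      show "norm (z \<omega> * (\<integral>x. f x \<partial>K j (Suc n + m) \<omega>)) \<le> c * b"
        unfolding real_norm_def abs_mult
        using z(2)[OF \<omega>] K_integral(2)[OF fm f(2) \<omega>, of j "Suc n + m"] c0 by (intro mult_mono) auto
    qed
    show "AE \<omega> in M. (\<lambda>m. z \<omega> * (\<integral>x. f x \<partial>K j (Suc n + m) \<omega>)) \<longlonglongrightarrow> z \<omega> * (\<integral>x. f x \<partial>\<alpha> j \<omega>)"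
      using K_integral_tendsto[where i=j, OF f]
    proof eventually_elim
      case (elim \<omega>)
      have "(\<lambda>m. \<integral>x. f x \<partial>K j (m + Suc n) \<omega>) \<longlonglongrightarrow> (\<integral>x. f x \<partial>\<alpha> j \<omega>)"
        using LIMSEQ_ignore_initial_segment[OF elim] .
      then show ?case by (intro tendsto_mult tendsto_const) (simp add: add.commute)
    qed
  qed simp
  \<comment> \<open>The left side does not depend on \<open>m\<close>, so as a constant sequence it
    equals the limit of the right side.\<close>
  ultimately show ?thesis by (simp add: LIMSEQ_const_iff)
qed

text \<open>Taking total expectations in the c.i.d. identity at time 0, applied to indicator
  functions, removes the conditioning.\<close>

lemma identically_distributed:
  assumes "1 \<le> n"
  shows "distr M borel (X n j) = distr M borel (X 1 j)"
proof (rule measure_eqI)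
  fix B assume "B \<in> sets (distr M borel (X n j))"
  then have B[measurable]: "B \<in> sets borel" by simp
  note [measurable] = X_M[OF assms] X_M[of 1, simplified]
  interpret sigma_finite_subalgebra M "Gnj M G X 0 j"
    by (rule sigma_finite_subalgebra_prob[OF subalg_Gnj])
  let ?f = "indicator B :: real \<Rightarrow> real"
  have "bounded (range ?f)" by (auto simp: bounded_iff indicator_def intro!: exI[of _ 1])
  from cid_AE[where n=0 and j=j, OF assms _ this] have ae: "AE \<omega> in M. real_cond_exp M (Gnj M G X 0 j) (\<lambda>x. ?f (X (Suc 0) j x)) \<omega>
                   = real_cond_exp M (Gnj M G X 0 j) (\<lambda>x. ?f (X (0 + n) j x)) \<omega>"
    by simp
  have i: "integrable M (\<lambda>\<omega>. ?f (X (Suc 0) j \<omega>))" "integrable M (\<lambda>\<omega>. ?f (X n j \<omega>))"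
    by (rule integrable_bounded_real[where B=1]; simp add: indicator_def)+
  have "(\<integral>\<omega>. ?f (X (Suc 0) j \<omega>) \<partial>M) = (\<integral>\<omega>. ?f (X n j \<omega>) \<partial>M)"
    unfolding real_cond_exp_int(2)[OF i(1), symmetric] real_cond_exp_int(2)[OF i(2), symmetric]
    using ae by (intro integral_cong_AE) (auto simp: borel_measurable_cond_exp[THEN measurable_from_subalg[OF subalg_Gnj]])
  moreover have "(\<integral>\<omega>. ?f (Y \<omega>) \<partial>M) = measure (distr M borel Y) B" if [measurable]: "Y \<in> borel_measurable M" for Y
    using integral_distr[of Y M borel ?f] by simp
  ultimately have "measure (distr M borel (X n j)) B = measure (distr M borel (X 1 j)) B" by simp
  moreover have "finite_measure (distr M borel Y)" if "Y \<in> borel_measurable M" for Y :: "'a \<Rightarrow> real"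
    using prob_space_distr[OF that] by (rule prob_space.finite_measure)
  ultimately show "emeasure (distr M borel (X n j)) B = emeasure (distr M borel (X 1 j)) B"
    using X_M[OF assms, of j] X_M[of 1 j] by (simp add: finite_measure.emeasure_eq_measure)
qed simp

lemma integral_X_eq:
  fixes h :: "real \<Rightarrow> real"
  assumes "1 \<le> n" and [measurable]: "h \<in> borel_measurable borel"
  shows "(\<integral>\<omega>. h (X n j \<omega>) \<partial>M) = (\<integral>\<omega>. h (X 1 j \<omega>) \<partial>M)"
proof -
  have "(\<integral>x. h x \<partial>distr M borel (X n j)) = (\<integral>\<omega>. h (X n j \<omega>) \<partial>M)"
    using X_M[OF assms(1)] by (intro integral_distr) auto
  moreover have "(\<integral>x. h x \<partial>distr M borel (X 1 j)) = (\<integral>\<omega>. h (X 1 j \<omega>) \<partial>M)"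
    using X_M[of 1] by (intro integral_distr) auto
  ultimately show ?thesis using identically_distributed[OF assms(1), of j] by simp
qed

end

lemma (in prob_space) integrable_mult_bounded:
  fixes y h :: "'a \<Rightarrow> real"
  assumes "y \<in> borel_measurable M" "h \<in> borel_measurable M"
    and y: "\<And>\<omega>. \<omega> \<in> space M \<Longrightarrow> \<bar>y \<omega>\<bar> \<le> c" and h: "\<And>\<omega>. \<omega> \<in> space M \<Longrightarrow> \<bar>h \<omega>\<bar> \<le> d"
  shows "integrable M (\<lambda>\<omega>. y \<omega> * h \<omega>)"
proof (rule integrable_bounded_real)
  fix \<omega> assume \<omega>: "\<omega> \<in> space M"
  have "0 \<le> c" using y[OF \<omega>] by linarith
  then show "\<bar>y \<omega> * h \<omega>\<bar> \<le> c * d"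
    unfolding abs_mult using y[OF \<omega>] h[OF \<omega>] by (intro mult_mono) auto
qed (use assms in simp)

text \<open>Meant for the random measures \<open>\<alpha> j \<omega>\<close> and
  \<open>K j p \<omega>\<close>: it makes the asymptotic variance and its finite-time proxies
  nonnegative and uniformly bounded.\<close>

lemma (in prob_space) bounded_variance:
  fixes h :: "'a \<Rightarrow> real"
  assumes h: "h \<in> borel_measurable M" "\<And>\<omega>. \<omega> \<in> space M \<Longrightarrow> \<bar>h \<omega>\<bar> \<le> c"
  shows "0 \<le> (\<integral>\<omega>. (h \<omega>)\<^sup>2 \<partial>M) - (\<integral>\<omega>. h \<omega> \<partial>M)\<^sup>2"
    and "(\<integral>\<omega>. (h \<omega>)\<^sup>2 \<partial>M) - (\<integral>\<omega>. h \<omega> \<partial>M)\<^sup>2 \<le> c\<^sup>2"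
proof -
  have sq: "(h \<omega>)\<^sup>2 \<le> c\<^sup>2" if "\<omega> \<in> space M" for \<omega>
    using power_mono[OF h(2)[OF that], of 2] by simp
  have i: "integrable M h" "integrable M (\<lambda>\<omega>. (h \<omega>)\<^sup>2)"
    using integrable_bounded_real[OF h] integrable_bounded_real[of "\<lambda>\<omega>. (h \<omega>)\<^sup>2" "c\<^sup>2"] h sq by auto
  show "0 \<le> (\<integral>\<omega>. (h \<omega>)\<^sup>2 \<partial>M) - (\<integral>\<omega>. h \<omega> \<partial>M)\<^sup>2"
    using variance_eq[OF i] variance_positive[of h] by simp
  have "(\<integral>\<omega>. (h \<omega>)\<^sup>2 \<partial>M) \<le> c\<^sup>2"
    using abs_integral_le_const[of "\<lambda>\<omega>. (h \<omega>)\<^sup>2" "c\<^sup>2"] sq by simp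
  then show "(\<integral>\<omega>. (h \<omega>)\<^sup>2 \<partial>M) - (\<integral>\<omega>. h \<omega> \<partial>M)\<^sup>2 \<le> c\<^sup>2"
    using zero_le_power2[of "\<integral>\<omega>. h \<omega> \<partial>M"] by linarith
qed

section \<open>Centred bounded entries and their conditional covariances\<close>

context cid_array
begin

text \<open>The argument \<open>f\<close> serves two arrays at once: the identity gives the summands
  of the theorem, \<open>clip c\<close> those of the truncated array.\<close>

definition resid :: "(real \<Rightarrow> real) \<Rightarrow> nat \<Rightarrow> 'i \<Rightarrow> 'a \<Rightarrow> real" where
  "resid f k j \<omega> = f (X k j \<omega>) - real_cond_exp M (G (k - 1)) (\<lambda>\<omega>. f (X k j \<omega>)) \<omega>"

text \<open>A version of \<^term>\<open>resid\<close> that is bounded everywhere, not only almost everywhere.\<close>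

definition kresid :: "(real \<Rightarrow> real) \<Rightarrow> nat \<Rightarrow> 'i \<Rightarrow> 'a \<Rightarrow> real" where
  "kresid f k j \<omega> = f (X k j \<omega>) - (\<integral>x. f x \<partial>K j (k - 1) \<omega>)"

text \<open>For \<open>f\<close> the identity this becomes
  \<open>var_measure (\<alpha> j \<omega>)\<close>.\<close>

definition avar :: "(real \<Rightarrow> real) \<Rightarrow> 'i \<Rightarrow> 'a \<Rightarrow> real" where
  "avar f j \<omega> = (\<integral>x. (f x)\<^sup>2 \<partial>\<alpha> j \<omega>) - (\<integral>x. f x \<partial>\<alpha> j \<omega>)\<^sup>2"

lemma resid_G: "1 \<le> k \<Longrightarrow> f \<in> borel_measurable borel \<Longrightarrow> resid f k j \<in> borel_measurable (G k)"
proof -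
  assume k: "1 \<le> k" and [measurable]: "f \<in> borel_measurable borel"
  have [measurable]: "real_cond_exp M (G (k - 1)) (\<lambda>\<omega>. f (X k j \<omega>)) \<in> borel_measurable (G k)"
    by (rule measurable_G_mono[where m="k - 1"]) auto
  note [measurable] = X_G[OF k]
  show ?thesis unfolding resid_def[abs_def] by measurable
qed

context
  fixes f :: "real \<Rightarrow> real" and b :: real
  assumes f: "\<And>x. isCont f x" "\<And>x. \<bar>f x\<bar> \<le> b"
begin

lemma f_measurable: "f \<in> borel_measurable borel"
  by (rule borel_measurable_isCont[OF f(1)])

lemma b_nonneg: "0 \<le> b" using f(2)[of 0] by linarith

lemma f_square: "isCont (\<lambda>x. (f x)\<^sup>2) x" "\<bar>(f x)\<^sup>2\<bar> \<le> b\<^sup>2"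
  using f by (auto intro!: continuous_intros power_mono[of "\<bar>f x\<bar>" b 2, simplified])

lemma kresid_G: "1 \<le> k \<Longrightarrow> kresid f k j \<in> borel_measurable (G k)"
proof -
  assume k: "1 \<le> k"
  have [measurable]: "(\<lambda>\<omega>. \<integral>x. f x \<partial>K j (k - 1) \<omega>) \<in> borel_measurable (G k)"
    by (rule measurable_G_mono[OF K_integral(1)[OF f_measurable f(2)]]) simp
  note [measurable] = f_measurable X_G[OF k]
  show ?thesis unfolding kresid_def[abs_def] by measurable
qed

lemma kresid_bound: "\<omega> \<in> space M \<Longrightarrow> \<bar>kresid f k j \<omega>\<bar> \<le> 2 * b"
  using f(2)[of "X k j \<omega>"] K_integral(2)[OF f_measurable f(2), of \<omega> j "k - 1"] unfolding kresid_def by linarith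

text \<open>The bound \<open>c\<close> is left free because the covariance estimate also tests with
  \<open>y\<close> times a predictive mean, which is bounded by \<open>b\<close> and not by
  1.\<close>

lemma kresid_mart:
  assumes k: "1 \<le> k" and y: "y \<in> borel_measurable (G (k - 1))" "\<And>\<omega>. \<omega> \<in> space M \<Longrightarrow> \<bar>y \<omega>\<bar> \<le> c"
  shows "(\<integral>\<omega>. y \<omega> * kresid f k j \<omega> \<partial>M) = 0"
proof -
  note [measurable] = f_measurable measurable_G_M[OF y(1)] X_M[OF k]
  have [measurable]: "(\<lambda>\<omega>. \<integral>x. f x \<partial>K j (k - 1) \<omega>) \<in> borel_measurable M"
    by (rule measurable_G_M[OF K_integral(1)[OF f_measurable f(2)]])
  have "integrable M (\<lambda>\<omega>. y \<omega> * f (X k j \<omega>))" "integrable M (\<lambda>\<omega>. y \<omega> * (\<integral>x. f x \<partial>K j (k - 1) \<omega>))"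
    by (rule integrable_mult_bounded[where c=c and d=b];
        use y(2) f(2) K_integral(2)[OF f_measurable f(2)] in \<open>simp del: One_nat_def\<close>)+
  moreover have "(\<integral>\<omega>. y \<omega> * f (X k j \<omega>) \<partial>M) = (\<integral>\<omega>. y \<omega> * (\<integral>x. f x \<partial>K j (k - 1) \<omega>) \<partial>M)"
    using K_integral(4)[OF f_measurable f(2) y, where i=j] k by simp
  ultimately show ?thesis by (simp add: kresid_def right_diff_distrib)
qed

text \<open>Let \<open>m\<close> and \<open>p\<close> be the means of \<open>f\<close> under
  \<open>\<alpha> j\<close> and \<open>K j (k - 1)\<close>. On the diagonal the second moments agree
  under every test function of time \<open>k - 1\<close>, so the error is that of
  \<open>m\<^sup>2 - p\<^sup>2\<close>, and |m + p| is at most \<open>2 * b\<close>. Off the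
  diagonal the error is \<open>m - p\<close> times the weighted residual of column \<open>i\<close>,
  again at most \<open>2 * b\<close>. One bound thus serves both cases, and it tends to 0 by
  \<open>K_integral_L1\<close>.\<close>

lemma kresid_covariance:
  assumes k: "1 \<le> k" and y: "y \<in> borel_measurable (G (k - 1))" "\<And>\<omega>. \<omega> \<in> space M \<Longrightarrow> \<bar>y \<omega>\<bar> \<le> 1"
  shows "\<bar>\<integral>\<omega>. y \<omega> * (kresid f k i \<omega> * kresid f k j \<omega> - (if i = j then avar f j \<omega> else 0)) \<partial>M\<bar>
    \<le> 2 * b * (\<integral>\<omega>. \<bar>(\<integral>x. f x \<partial>\<alpha> j \<omega>) - (\<integral>x. f x \<partial>K j (k - 1) \<omega>)\<bar> \<partial>M)"
proof -
  define m where "m \<omega> = (\<integral>x. f x \<partial>\<alpha> j \<omega>)" for \<omega>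
  define q where "q \<omega> = (\<integral>x. (f x)\<^sup>2 \<partial>\<alpha> j \<omega>)" for \<omega>
  define p where "p \<omega> = (\<integral>x. f x \<partial>K j (k - 1) \<omega>)" for \<omega>
  have pG: "p \<in> borel_measurable (G (k - 1))"
    unfolding p_def by (rule K_integral(1)[OF f_measurable f(2)])
  note [measurable] = f_measurable measurable_G_M[OF y(1)] X_M[OF k] measurable_G_M[OF kresid_G[OF k]] measurable_G_M[OF pG]
  have mM[measurable]: "m \<in> borel_measurable M" "q \<in> borel_measurable M"
    unfolding m_def q_def by (intro alpha_integral_measurable; measurable)+
  have pb: "\<bar>p \<omega>\<bar> \<le> b" and mb: "\<bar>m \<omega>\<bar> \<le> b" and qb: "\<bar>q \<omega>\<bar> \<le> b\<^sup>2" if "\<omega> \<in> space M" for \<omega>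
    unfolding p_def m_def q_def
    using K_integral(2)[OF f_measurable f(2) that] alpha_integral_bound[OF f(2) that]
      alpha_integral_bound[where f="\<lambda>x. (f x)\<^sup>2", OF f_square(2) that] by auto
  have im: "integrable M m" "integrable M p"
    by (rule integrable_bounded_real[where B=b]; use mb pb in simp)+
  then have L: "integrable M (\<lambda>\<omega>. 2 * b * \<bar>m \<omega> - p \<omega>\<bar>)" by auto
  have iY: "integrable M (\<lambda>\<omega>. y \<omega> * h \<omega>)"
    if "h \<in> borel_measurable M" "\<And>\<omega>. \<omega> \<in> space M \<Longrightarrow> \<bar>h \<omega>\<bar> \<le> c" for h :: "'a \<Rightarrow> real" and c
    by (rule integrable_mult_bounded[OF _ that(1) y(2) that(2)]) auto
  have "\<bar>\<integral>\<omega>. y \<omega> * (kresid f k i \<omega> * kresid f k j \<omega> - (if i = j then avar f j \<omega> else 0)) \<partial>M\<bar>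
    \<le> (\<integral>\<omega>. 2 * b * \<bar>m \<omega> - p \<omega>\<bar> \<partial>M)"
  proof (cases "i = j")
    case False
    \<comment> \<open>Integrating out the \<open>j\<close>-th entry first, given the \<open>i\<close>-th, replaces it by its asymptotic mean.\<close>
    let ?z = "\<lambda>\<omega>. y \<omega> * kresid f k i \<omega>"
    obtain n where kn: "k = Suc n" using k by (cases k) auto
    have zb: "\<bar>?z \<omega>\<bar> \<le> 2 * b" if "\<omega> \<in> space M" for \<omega>
      using mult_mono[OF y(2)[OF that] kresid_bound[OF that, of k i]] by (simp add: abs_mult)
    have zG: "?z \<in> borel_measurable (Gnj M G X n j)"
    proof -
      note [measurable] = X_Gnj[OF False, of n]
      have [measurable]: "y \<in> borel_measurable (Gnj M G X n j)"
        using measurable_from_subalg[OF subalg_G_Gnj] y(1) kn by simp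
      have [measurable]: "(\<lambda>\<omega>. \<integral>x. f x \<partial>K i n \<omega>) \<in> borel_measurable (Gnj M G X n j)"
        by (rule measurable_from_subalg[OF subalg_G_Gnj K_integral(1)[OF f_measurable f(2)]])
      show ?thesis unfolding kresid_def kn by simp
    qed
    have iz: "integrable M (\<lambda>\<omega>. ?z \<omega> * f (X k j \<omega>))" "integrable M (\<lambda>\<omega>. ?z \<omega> * p \<omega>)" "integrable M (\<lambda>\<omega>. ?z \<omega> * m \<omega>)"
      by (rule integrable_mult_bounded[where c="2 * b" and d=b]; use zb f(2) pb mb in simp)+
    \<comment> \<open>The predictive mean of column \<open>j\<close> is known at time
      \<open>k - 1\<close>, so it joins the test function and the residual of column
      \<open>i\<close> integrates to zero against it.\<close>
    have "(\<integral>\<omega>. y \<omega> * p \<omega> * kresid f k i \<omega> \<partial>M) = 0"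
    proof (rule kresid_mart[OF k])
      show "(\<lambda>\<omega>. y \<omega> * p \<omega>) \<in> borel_measurable (G (k - 1))" using y(1) pG by simp
      show "\<bar>y \<omega> * p \<omega>\<bar> \<le> 1 * b" if "\<omega> \<in> space M" for \<omega>
        unfolding abs_mult using y(2) pb that by (intro mult_mono) auto
    qed
    then have zp: "(\<integral>\<omega>. ?z \<omega> * p \<omega> \<partial>M) = 0" by (simp add: mult_ac)
    have zm: "(\<integral>\<omega>. ?z \<omega> * f (X k j \<omega>) \<partial>M) = (\<integral>\<omega>. ?z \<omega> * m \<omega> \<partial>M)"
      unfolding m_def kn by (rule cid_integral[OF f]) (use zG zb kn in auto)
    have "(\<integral>\<omega>. y \<omega> * (kresid f k i \<omega> * kresid f k j \<omega> - (if i = j then avar f j \<omega> else 0)) \<partial>M)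
       = (\<integral>\<omega>. ?z \<omega> * f (X k j \<omega>) - ?z \<omega> * p \<omega> \<partial>M)"
      using False by (simp add: kresid_def[of f k j] p_def algebra_simps)
    also have "\<dots> = (\<integral>\<omega>. ?z \<omega> * m \<omega> - ?z \<omega> * p \<omega> \<partial>M)" using iz zm by simp
    also have "\<bar>\<dots>\<bar> \<le> (\<integral>\<omega>. 2 * b * \<bar>m \<omega> - p \<omega>\<bar> \<partial>M)"
    proof (rule abs_integral_le_integral[OF L])
      fix \<omega> assume "\<omega> \<in> space M"
      from mult_right_mono[OF zb[OF this], of "\<bar>m \<omega> - p \<omega>\<bar>"]
      show "\<bar>?z \<omega> * m \<omega> - ?z \<omega> * p \<omega>\<bar> \<le> 2 * b * \<bar>m \<omega> - p \<omega>\<bar>"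
        by (simp add: abs_mult[symmetric] right_diff_distrib)
    qed
    finally show ?thesis .
  next
    case True
    obtain n where kn: "k = Suc n" using k by (cases k) auto
    have i1: "integrable M (\<lambda>\<omega>. y \<omega> * (f (X k j \<omega>))\<^sup>2)" "integrable M (\<lambda>\<omega>. y \<omega> * q \<omega>)"
      "integrable M (\<lambda>\<omega>. y \<omega> * p \<omega> * kresid f k j \<omega>)" 
      "integrable M (\<lambda>\<omega>. y \<omega> * (p \<omega>)\<^sup>2)" "integrable M (\<lambda>\<omega>. y \<omega> * (m \<omega>)\<^sup>2)"
      "integrable M (\<lambda>\<omega>. y \<omega> * ((m \<omega>)\<^sup>2 - (p \<omega>)\<^sup>2))"
    proof -
      show "integrable M (\<lambda>\<omega>. y \<omega> * (f (X k j \<omega>))\<^sup>2)" by (rule iY[of _ "b\<^sup>2"]) (use f_square in auto)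
      show "integrable M (\<lambda>\<omega>. y \<omega> * q \<omega>)" by (rule iY[of _ "b\<^sup>2"]) (use qb in auto)
      show p2: "integrable M (\<lambda>\<omega>. y \<omega> * (p \<omega>)\<^sup>2)"
        by (rule iY[of _ "b\<^sup>2"]) (use pb power_mono[OF pb, of _ 2] in auto)
      show m2: "integrable M (\<lambda>\<omega>. y \<omega> * (m \<omega>)\<^sup>2)"
        by (rule iY[of _ "b\<^sup>2"]) (use mb power_mono[OF mb, of _ 2] in auto)
      show "integrable M (\<lambda>\<omega>. y \<omega> * ((m \<omega>)\<^sup>2 - (p \<omega>)\<^sup>2))"
        using Bochner_Integration.integrable_diff[OF m2 p2] by (simp add: right_diff_distrib)
      show "integrable M (\<lambda>\<omega>. y \<omega> * p \<omega> * kresid f k j \<omega>)"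
        unfolding mult.assoc
      proof (rule iY[of _ "b * (2 * b)"])
        show "\<bar>p \<omega> * kresid f k j \<omega>\<bar> \<le> b * (2 * b)" if "\<omega> \<in> space M" for \<omega>
          unfolding abs_mult using pb kresid_bound that b_nonneg by (intro mult_mono) auto
      qed measurable
    qed
    have zp: "(\<integral>\<omega>. y \<omega> * p \<omega> * kresid f k j \<omega> \<partial>M) = 0"
    proof (rule kresid_mart[OF k])
      show "(\<lambda>\<omega>. y \<omega> * p \<omega>) \<in> borel_measurable (G (k - 1))" using y(1) pG by simp
      show "\<bar>y \<omega> * p \<omega>\<bar> \<le> 1 * b" if "\<omega> \<in> space M" for \<omega>
        unfolding abs_mult using y(2) pb that by (intro mult_mono) auto
    qed
    have zq: "(\<integral>\<omega>. y \<omega> * (f (X k j \<omega>))\<^sup>2 \<partial>M) = (\<integral>\<omega>. y \<omega> * q \<omega> \<partial>M)"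
      unfolding q_def kn
      by (rule cid_integral[where f="\<lambda>x. (f x)\<^sup>2", OF f_square _ y(2)])
         (use y(1) kn measurable_from_subalg[OF subalg_G_Gnj] in auto)
    \<comment> \<open>With r = f - p for the residual, r^2 = f^2 - 2 p r - p^2. This form isolates
      the martingale term, which \<open>zp\<close> removes, and leaves f^2 to be matched with
      \<open>q\<close>.\<close>
    have "(\<integral>\<omega>. y \<omega> * (kresid f k i \<omega> * kresid f k j \<omega> - (if i = j then avar f j \<omega> else 0)) \<partial>M)
       = (\<integral>\<omega>. y \<omega> * (f (X k j \<omega>))\<^sup>2 - y \<omega> * q \<omega> - 2 * (y \<omega> * p \<omega> * kresid f k j \<omega>) + y \<omega> * ((m \<omega>)\<^sup>2 - (p \<omega>)\<^sup>2) \<partial>M)"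
      using True
      by (intro Bochner_Integration.integral_cong refl)
         (simp add: kresid_def p_def avar_def m_def q_def algebra_simps power2_eq_square)
    also have "\<dots> = (\<integral>\<omega>. y \<omega> * ((m \<omega>)\<^sup>2 - (p \<omega>)\<^sup>2) \<partial>M)"
      using i1 by (simp add: zp zq)
    also have "\<bar>\<dots>\<bar> \<le> (\<integral>\<omega>. 2 * b * \<bar>m \<omega> - p \<omega>\<bar> \<partial>M)"
    proof (rule abs_integral_le_integral[OF L])
      fix \<omega> assume \<omega>: "\<omega> \<in> space M"
      have "\<bar>m \<omega> + p \<omega>\<bar> \<le> 2 * b" using mb[OF \<omega>] pb[OF \<omega>] by linarith
      with y(2)[OF \<omega>] have "\<bar>y \<omega>\<bar> * (\<bar>m \<omega> + p \<omega>\<bar> * \<bar>m \<omega> - p \<omega>\<bar>) \<le> 1 * (2 * b * \<bar>m \<omega> - p \<omega>\<bar>)"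
        by (intro mult_mono) auto
      then show "\<bar>y \<omega> * ((m \<omega>)\<^sup>2 - (p \<omega>)\<^sup>2)\<bar> \<le> 2 * b * \<bar>m \<omega> - p \<omega>\<bar>"
        by (simp add: abs_mult[symmetric] power2_eq_square algebra_simps)
    qed
    finally show ?thesis .
  qed
  then show ?thesis unfolding m_def p_def using im by (simp add: m_def p_def)
qed

lemma avar_measurable: "avar f j \<in> borel_measurable M"
  using f_measurable unfolding avar_def[abs_def] by (intro borel_measurable_diff borel_measurable_power alpha_integral_measurable; measurable)

lemma avar_bounds:
  assumes "\<omega> \<in> space M"
  shows "0 \<le> avar f j \<omega>" "avar f j \<omega> \<le> b\<^sup>2"
  unfolding avar_def
  using prob_space.bounded_variance[OF alpha_prob[OF assms], where h=f and c=b] alpha_sets[OF assms] f_measurable f(2)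
  by (simp_all cong: measurable_cong_sets)

lemma kvar_bounds:
  assumes "\<omega> \<in> space M"
  shows "0 \<le> (\<integral>x. (f x)\<^sup>2 \<partial>K j p \<omega>) - (\<integral>x. f x \<partial>K j p \<omega>)\<^sup>2"
    "(\<integral>x. (f x)\<^sup>2 \<partial>K j p \<omega>) - (\<integral>x. f x \<partial>K j p \<omega>)\<^sup>2 \<le> b\<^sup>2"
  using prob_space.bounded_variance[of "K j p \<omega>" f b] K[of p j] f_measurable f(2) assms
  by (simp_all add: regular_cond_dist_def cong: measurable_cong_sets)

lemma resid_eq_kresid:
  assumes "1 \<le> k"
  shows "AE \<omega> in M. resid f k j \<omega> = kresid f k j \<omega>"
proof -
  obtain n where "k = Suc n" using assms by (cases k) auto
  then show ?thesis
    using K_integral(3)[OF f_measurable f(2), where n=n and i=j] by (auto simp: resid_def kresid_def)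
qed

text \<open>A fixed linear combination of columns has bounded martingale increments. Its conditional
  second moment expands into covariances of pairs of columns; the mixed ones disappear
  asymptotically, which leaves the weighted sum \<open>V\<close> of the variances. Replacing each
  \<open>\<alpha> j\<close> by \<open>K j p\<close> in \<open>V\<close> yields the proxy
  \<open>W p\<close>, which is known at time \<open>p\<close>, obeys the same bounds and converges
  by weak convergence applied to \<open>f\<close> and to its square.\<close>

lemma stable_cos_bounded_array:
  assumes J: "finite J" and A: "A \<in> sets M"
  shows "(\<lambda>n. \<integral>\<omega>. indicator A \<omega> * cos (s + (\<Sum>k=1..n. \<Sum>j\<in>J. t j * resid f k j \<omega>) / sqrt n) \<partial>M)
    \<longlonglongrightarrow> (\<integral>\<omega>. indicator A \<omega> * (exp (- (\<Sum>j\<in>J. (t j)\<^sup>2 * avar f j \<omega>) / 2) * cos s) \<partial>M)"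
proof -
  note [measurable] = f_measurable avar_measurable
  define D where "D k \<omega> = (\<Sum>j\<in>J. t j * kresid f k j \<omega>)" for k \<omega>
  define V where "V \<omega> = (\<Sum>j\<in>J. (t j)\<^sup>2 * avar f j \<omega>)" for \<omega>
  define w where "w j p \<omega> = (\<integral>x. (f x)\<^sup>2 \<partial>K j p \<omega>) - (\<integral>x. f x \<partial>K j p \<omega>)\<^sup>2" for j p \<omega>
  define W where "W p \<omega> = (\<Sum>j\<in>J. (t j)\<^sup>2 * w j p \<omega>)" for p \<omega>
  define \<epsilon> where "\<epsilon> j k = (\<integral>\<omega>. \<bar>(\<integral>x. f x \<partial>\<alpha> j \<omega>) - (\<integral>x. f x \<partial>K j (k - 1) \<omega>)\<bar> \<partial>M)" for j and k :: nat
  define \<eta> where "\<eta> k = (\<Sum>i\<in>J. \<Sum>j\<in>J. \<bar>t i * t j\<bar> * (2 * b * \<epsilon> j k))" for k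
  let ?B = "\<Sum>j\<in>J. (t j)\<^sup>2 * b\<^sup>2"
  have kM[measurable]: "kresid f k j \<in> borel_measurable M" if "1 \<le> k" for k j
    by (rule measurable_G_M[OF kresid_G[OF that]])
  have VM[measurable]: "V \<in> borel_measurable M" unfolding V_def[abs_def] by measurable
  have Vb: "0 \<le> V \<omega>" "V \<omega> \<le> ?B" if "\<omega> \<in> space M" for \<omega>
    unfolding V_def using avar_bounds[OF that] by (auto intro!: sum_nonneg sum_mono mult_left_mono)
  have wG: "w j p \<in> borel_measurable (G p)" for j p
    unfolding w_def[abs_def]
    using K_integral(1)[OF f_measurable f(2), where n=p and i=j] K_integral(1)[where f="\<lambda>x. (f x)\<^sup>2", OF _ f_square(2), where n=p and i=j]
    by simp
  have WG: "W p \<in> borel_measurable (G p)" for p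
    unfolding W_def[abs_def] using wG by simp
  have Wb: "0 \<le> W p \<omega> \<and> W p \<omega> \<le> ?B" if "\<omega> \<in> space M" for p \<omega>
    unfolding W_def w_def using kvar_bounds[OF that] by (auto intro!: sum_nonneg sum_mono mult_left_mono)
  have lim: "(\<lambda>n. \<integral>\<omega>. indicator A \<omega> * cos (s + (\<Sum>k=1..n. D k \<omega>) / sqrt n) \<partial>M)
    \<longlonglongrightarrow> (\<integral>\<omega>. indicator A \<omega> * (exp (- V \<omega> / 2) * cos s) \<partial>M)"
  proof (rule stable_cos_bounded_martingale[where W=W and \<eta>=\<eta> and B="?B" and C="\<Sum>j\<in>J. \<bar>t j\<bar> * (2 * b)"])
    fix k :: nat assume k: "1 \<le> k"
    show "D k \<in> borel_measurable (G k)" unfolding D_def[abs_def] using kresid_G[OF k] by simp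
    show "\<bar>D k \<omega>\<bar> \<le> (\<Sum>j\<in>J. \<bar>t j\<bar> * (2 * b))" if "\<omega> \<in> space M" for \<omega>
      unfolding D_def using kresid_bound[OF that]
      by (intro order_trans[OF sum_abs] sum_mono) (simp add: abs_mult mult_left_mono)
    fix y :: "'a \<Rightarrow> real"
    assume y: "y \<in> borel_measurable (G (k - 1))" "\<And>\<omega>. \<omega> \<in> space M \<Longrightarrow> \<bar>y \<omega>\<bar> \<le> 1"
    have yM[measurable]: "y \<in> borel_measurable M" by (rule measurable_G_M[OF y(1)])
    note [measurable] = kM[OF k]
    have iy: "integrable M (\<lambda>\<omega>. y \<omega> * kresid f k j \<omega>)" for j
      by (rule integrable_mult_bounded[where c=1 and d="2 * b"]) (use y kresid_bound in auto)
    have "(\<integral>\<omega>. y \<omega> * D k \<omega> \<partial>M) = (\<integral>\<omega>. (\<Sum>j\<in>J. t j * (y \<omega> * kresid f k j \<omega>)) \<partial>M)"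
      unfolding D_def by (simp add: sum_distrib_left mult_ac)
    also have "\<dots> = (\<Sum>j\<in>J. t j * (\<integral>\<omega>. y \<omega> * kresid f k j \<omega> \<partial>M))"
      using iy by simp
    also have "\<dots> = 0" using kresid_mart[OF k y] by simp
    finally show "(\<integral>\<omega>. y \<omega> * D k \<omega> \<partial>M) = 0" .
    let ?c = "\<lambda>i j \<omega>. y \<omega> * (kresid f k i \<omega> * kresid f k j \<omega> - (if i = j then avar f j \<omega> else 0))"
    have ic: "integrable M (?c i j)" for i j
    proof (rule integrable_mult_bounded[where c=1 and d="2 * b * (2 * b) + b\<^sup>2"])
      fix \<omega> assume \<omega>: "\<omega> \<in> space M"
      have "\<bar>kresid f k i \<omega> * kresid f k j \<omega>\<bar> \<le> 2 * b * (2 * b)"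
        unfolding abs_mult using kresid_bound[OF \<omega>] b_nonneg by (intro mult_mono) auto
      moreover have "\<bar>if i = j then avar f j \<omega> else 0\<bar> \<le> b\<^sup>2" using avar_bounds[OF \<omega>, of j] by auto
      ultimately show "\<bar>kresid f k i \<omega> * kresid f k j \<omega> - (if i = j then avar f j \<omega> else 0)\<bar> \<le> 2 * b * (2 * b) + b\<^sup>2"
        by linarith
    qed (use y in auto)
    have "y \<omega> * ((D k \<omega>)\<^sup>2 - V \<omega>) = (\<Sum>i\<in>J. \<Sum>j\<in>J. t i * t j * ?c i j \<omega>)" for \<omega>
    proof -
      have "V \<omega> = (\<Sum>i\<in>J. \<Sum>j\<in>J. t i * t j * (if i = j then avar f j \<omega> else 0))"
        unfolding V_def using J by (intro sum.cong) (auto simp: power2_eq_square if_distrib[of "(*) _"] cong: if_cong)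
      moreover have "(D k \<omega>)\<^sup>2 = (\<Sum>i\<in>J. \<Sum>j\<in>J. t i * t j * (kresid f k i \<omega> * kresid f k j \<omega>))"
        unfolding D_def power2_eq_square sum_product by (simp add: mult_ac)
      ultimately show ?thesis
        by (simp only: sum_subtractf[symmetric] sum_distrib_left) (simp add: algebra_simps)
    qed
    then have "(\<integral>\<omega>. y \<omega> * ((D k \<omega>)\<^sup>2 - V \<omega>) \<partial>M) = (\<Sum>i\<in>J. \<Sum>j\<in>J. t i * t j * (\<integral>\<omega>. ?c i j \<omega> \<partial>M))"
      using ic by (simp only: integral_mult_right_zero Bochner_Integration.integral_sum integrable_mult_right
          Bochner_Integration.integrable_sum)
    also have "\<bar>\<dots>\<bar> \<le> \<eta> k"
      unfolding \<eta>_def \<epsilon>_def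
      by (intro order_trans[OF sum_abs] sum_mono)
         (simp only: abs_mult[of "t _ * t _"], intro mult_left_mono kresid_covariance[OF k y] abs_ge_zero)
    finally show "\<bar>\<integral>\<omega>. y \<omega> * ((D k \<omega>)\<^sup>2 - V \<omega>) \<partial>M\<bar> \<le> \<eta> k" .
  next
    have "(\<lambda>k. \<epsilon> j (k + 1)) \<longlonglongrightarrow> 0" for j
      unfolding \<epsilon>_def using K_integral_L1[where i=j, OF f] by simp
    then have "\<epsilon> j \<longlonglongrightarrow> 0" for j by (rule LIMSEQ_offset)
    then show "\<eta> \<longlonglongrightarrow> 0"
      unfolding \<eta>_def[abs_def] by (intro tendsto_null_sum tendsto_mult_right_zero)
  next
    show "integrable M V" by (rule integrable_bounded_real[where B="?B"]) (use Vb in auto)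
    show "0 \<le> V \<omega>" if "\<omega> \<in> space M" for \<omega> using Vb[OF that] by simp
    show "W p \<in> borel_measurable (G p)" for p by (rule WG)
    show "0 \<le> W p \<omega> \<and> W p \<omega> \<le> ?B" if "\<omega> \<in> space M" for p \<omega> by (rule Wb[OF that])
    have "(\<lambda>p. \<integral>\<omega>. \<bar>V \<omega> - W p \<omega>\<bar> \<partial>M) \<longlonglongrightarrow> (\<integral>\<omega>. 0 \<partial>M)"
    proof (rule integral_dominated_convergence[where w="\<lambda>_. ?B + ?B"])
      have "AE \<omega> in M. \<forall>j\<in>J. (\<lambda>p. w j p \<omega>) \<longlonglongrightarrow> avar f j \<omega>"
      proof (rule AE_finite_allI[OF J])
        fix j
        show "AE \<omega> in M. (\<lambda>p. w j p \<omega>) \<longlonglongrightarrow> avar f j \<omega>"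
          using K_integral_tendsto[where i=j, OF f] K_integral_tendsto[where i=j and f="\<lambda>x. (f x)\<^sup>2", OF f_square]
          unfolding w_def avar_def by eventually_elim (intro tendsto_intros)
      qed
      then show "AE \<omega> in M. (\<lambda>p. \<bar>V \<omega> - W p \<omega>\<bar>) \<longlonglongrightarrow> 0"
      proof eventually_elim
        case (elim \<omega>)
        then have "(\<lambda>p. W p \<omega>) \<longlonglongrightarrow> V \<omega>"
          unfolding W_def V_def by (intro tendsto_sum tendsto_mult tendsto_const) auto
        from tendsto_rabs[OF tendsto_diff[OF tendsto_const[of "V \<omega>"] this]] show ?case by simp
      qed
      show "AE \<omega> in M. norm \<bar>V \<omega> - W p \<omega>\<bar> \<le> ?B + ?B" for p
      proof (rule AE_I2)
        fix \<omega> assume "\<omega> \<in> space M"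
        from Vb[OF this] Wb[OF this, of p] show "norm \<bar>V \<omega> - W p \<omega>\<bar> \<le> ?B + ?B"
          unfolding real_norm_def abs_abs abs_le_iff by linarith
      qed
    qed (use measurable_G_M[OF WG] in auto)
    then show "(\<lambda>p. \<integral>\<omega>. \<bar>V \<omega> - W p \<omega>\<bar> \<partial>M) \<longlonglongrightarrow> 0" by simp
  qed (rule A)
  \<comment> \<open>The martingale argument needs increments bounded at every point, so it ran with
    the kernel version; the two versions differ on a null set, since only finitely many entries
    enter for each \<open>n\<close>.\<close>
  have eq: "(\<integral>\<omega>. indicator A \<omega> * cos (s + (\<Sum>k=1..n. \<Sum>j\<in>J. t j * resid f k j \<omega>) / sqrt n) \<partial>M)
     = (\<integral>\<omega>. indicator A \<omega> * cos (s + (\<Sum>k=1..n. D k \<omega>) / sqrt n) \<partial>M)" for n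
  proof (rule integral_cong_AE)
    have rM: "resid f k j \<in> borel_measurable M" if "k \<in> {1..n}" for k j
      using measurable_G_M[OF resid_G[OF _ f_measurable]] that by auto
    have [measurable]: "(\<lambda>\<omega>. \<Sum>k=1..n. \<Sum>j\<in>J. t j * resid f k j \<omega>) \<in> borel_measurable M"
      using rM by (intro borel_measurable_sum borel_measurable_times borel_measurable_const)
    have [measurable]: "(\<lambda>\<omega>. \<Sum>k=1..n. D k \<omega>) \<in> borel_measurable M"
      unfolding D_def using kM by (intro borel_measurable_sum borel_measurable_times borel_measurable_const) auto
    note [measurable] = A
    show "(\<lambda>\<omega>. indicator A \<omega> * cos (s + (\<Sum>k=1..n. \<Sum>j\<in>J. t j * resid f k j \<omega>) / sqrt n)) \<in> borel_measurable M"
      "(\<lambda>\<omega>. indicator A \<omega> * cos (s + (\<Sum>k=1..n. D k \<omega>) / sqrt n)) \<in> borel_measurable M"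
      by measurable
    have "AE \<omega> in M. \<forall>k\<in>{1..n}. \<forall>j\<in>J. resid f k j \<omega> = kresid f k j \<omega>"
      using resid_eq_kresid J by (intro AE_finite_allI) auto
    then show "AE \<omega> in M. indicator A \<omega> * cos (s + (\<Sum>k=1..n. \<Sum>j\<in>J. t j * resid f k j \<omega>) / sqrt n)
      = indicator A \<omega> * cos (s + (\<Sum>k=1..n. D k \<omega>) / sqrt n)"
      unfolding D_def by eventually_elim simp
  qed
  show ?thesis using lim unfolding eq V_def .
qed

end

end

section \<open>Truncation\<close>

lemma (in prob_space) integrable_mult_square:
  fixes f g :: "'a \<Rightarrow> real"
  assumes [measurable]: "f \<in> borel_measurable M" "g \<in> borel_measurable M"
    and sq: "integrable M (\<lambda>\<omega>. (f \<omega>)\<^sup>2)" "integrable M (\<lambda>\<omega>. (g \<omega>)\<^sup>2)"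
  shows "integrable M (\<lambda>\<omega>. f \<omega> * g \<omega>)"
proof (rule Bochner_Integration.integrable_bound[OF Bochner_Integration.integrable_add[OF sq]])
  have "2 * (\<bar>a\<bar> * \<bar>b\<bar>) \<le> a\<^sup>2 + b\<^sup>2" for a b :: real
    using sum_squares_bound[of "\<bar>a\<bar>" "\<bar>b\<bar>"] by simp
  moreover have "0 \<le> \<bar>a\<bar> * \<bar>b\<bar>" for a b :: real by simp
  ultimately have "\<bar>a\<bar> * \<bar>b\<bar> \<le> a\<^sup>2 + b\<^sup>2" for a b :: real by (smt (verit))
  then show "AE \<omega> in M. norm (f \<omega> * g \<omega>) \<le> norm ((f \<omega>)\<^sup>2 + (g \<omega>)\<^sup>2)"
    by (simp add: abs_mult)
qed simp

section \<open>Second moments of martingale sums\<close>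

context filtered_prob_space
begin

text \<open>\<open>P\<close> is orthogonal to the centred increment, and centring is an L2
  projection: it lowers the second moment of \<open>Y\<close> by that of its conditional
  expectation.\<close>

lemma martingale_increment_L2:
  assumes P: "P \<in> borel_measurable (G m)" "integrable M (\<lambda>\<omega>. (P \<omega>)\<^sup>2)"
    and Y: "Y \<in> borel_measurable M" "integrable M (\<lambda>\<omega>. (Y \<omega>)\<^sup>2)"
  shows "integrable M (\<lambda>\<omega>. (P \<omega> + (Y \<omega> - real_cond_exp M (G m) Y \<omega>))\<^sup>2)"
    and "(\<integral>\<omega>. (P \<omega> + (Y \<omega> - real_cond_exp M (G m) Y \<omega>))\<^sup>2 \<partial>M) \<le> (\<integral>\<omega>. (P \<omega>)\<^sup>2 \<partial>M) + (\<integral>\<omega>. (Y \<omega>)\<^sup>2 \<partial>M)"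
proof -
  interpret sigma_finite_subalgebra M "G m" by (rule sigma_finite_G)
  let ?c = "real_cond_exp M (G m) Y"
  note [measurable] = measurable_G_M[OF P(1)] measurable_G_M[OF borel_measurable_cond_exp[of M "G m" Y]] Y(1)
  have iY: "integrable M Y" by (rule square_integrable_imp_integrable[OF Y])
  \<comment> \<open>Conditional Jensen for the square.\<close>
  have c2: "integrable M (\<lambda>\<omega>. (?c \<omega>)\<^sup>2)"
    by (rule integrable_convex_cond_exp[where I=UNIV and q="\<lambda>x. x\<^sup>2", OF iY])
       (use Y convex_power2 in auto)
  note i = P(2) Y(2) c2 integrable_mult_square[OF _ _ P(2) Y(2)] integrable_mult_square[OF _ _ P(2) c2]
    integrable_mult_square[OF _ _ c2 Y(2)]
  have PY: "(\<integral>\<omega>. P \<omega> * ?c \<omega> \<partial>M) = (\<integral>\<omega>. P \<omega> * Y \<omega> \<partial>M)"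
    using i(4) P(1) by (intro real_cond_exp_intg(2)) auto
  have cY: "(\<integral>\<omega>. ?c \<omega> * Y \<omega> \<partial>M) = (\<integral>\<omega>. (?c \<omega>)\<^sup>2 \<partial>M)"
    using i(6) by (simp add: real_cond_exp_intg(2)[symmetric] power2_eq_square)
  have eq: "(\<lambda>\<omega>. (P \<omega> + (Y \<omega> - ?c \<omega>))\<^sup>2) =
     (\<lambda>\<omega>. (P \<omega>)\<^sup>2 + (Y \<omega>)\<^sup>2 + (?c \<omega>)\<^sup>2 + 2 * (P \<omega> * Y \<omega>) - 2 * (P \<omega> * ?c \<omega>) - 2 * (?c \<omega> * Y \<omega>))"
    by (simp add: power2_eq_square algebra_simps)
  show "integrable M (\<lambda>\<omega>. (P \<omega> + (Y \<omega> - ?c \<omega>))\<^sup>2)"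
    unfolding eq using i by auto
  have "(\<integral>\<omega>. (P \<omega> + (Y \<omega> - ?c \<omega>))\<^sup>2 \<partial>M) = (\<integral>\<omega>. (P \<omega>)\<^sup>2 \<partial>M) + (\<integral>\<omega>. (Y \<omega>)\<^sup>2 \<partial>M) - (\<integral>\<omega>. (?c \<omega>)\<^sup>2 \<partial>M)"
    unfolding eq using i by (simp add: PY cY)
  also have "\<dots> \<le> (\<integral>\<omega>. (P \<omega>)\<^sup>2 \<partial>M) + (\<integral>\<omega>. (Y \<omega>)\<^sup>2 \<partial>M)" by simp
  finally show "(\<integral>\<omega>. (P \<omega> + (Y \<omega> - ?c \<omega>))\<^sup>2 \<partial>M) \<le> (\<integral>\<omega>. (P \<omega>)\<^sup>2 \<partial>M) + (\<integral>\<omega>. (Y \<omega>)\<^sup>2 \<partial>M)" .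
qed

lemma martingale_sum_L2:
  assumes Y: "\<And>k. 1 \<le> k \<Longrightarrow> Y k \<in> borel_measurable (G k)" "\<And>k. 1 \<le> k \<Longrightarrow> integrable M (\<lambda>\<omega>. (Y k \<omega>)\<^sup>2)"
  shows "integrable M (\<lambda>\<omega>. (\<Sum>k=1..n. Y k \<omega> - real_cond_exp M (G (k - 1)) (Y k) \<omega>)\<^sup>2)
    \<and> (\<integral>\<omega>. (\<Sum>k=1..n. Y k \<omega> - real_cond_exp M (G (k - 1)) (Y k) \<omega>)\<^sup>2 \<partial>M) \<le> (\<Sum>k=1..n. \<integral>\<omega>. (Y k \<omega>)\<^sup>2 \<partial>M)"
proof (induction n)
  case (Suc n)
  let ?P = "\<lambda>n \<omega>. \<Sum>k=1..n. Y k \<omega> - real_cond_exp M (G (k - 1)) (Y k) \<omega>"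
  have PG: "?P n \<in> borel_measurable (G n)"
  proof (intro borel_measurable_sum borel_measurable_diff)
    fix k assume "k \<in> {1..n}"
    then show "Y k \<in> borel_measurable (G n)" "real_cond_exp M (G (k - 1)) (Y k) \<in> borel_measurable (G n)"
      using measurable_G_mono[OF Y(1), of k n] measurable_G_mono[OF borel_measurable_cond_exp[of M "G (k - 1)" "Y k"], of n] by auto
  qed
  have eq: "?P (Suc n) \<omega> = ?P n \<omega> + (Y (Suc n) \<omega> - real_cond_exp M (G n) (Y (Suc n)) \<omega>)" for \<omega> by simp
  have YM: "Y (Suc n) \<in> borel_measurable M" by (rule measurable_G_M[OF Y(1)]) simp
  from martingale_increment_L2[OF PG conjunct1[OF Suc] YM Y(2)] Suc
  show ?case unfolding eq by (auto simp del: One_nat_def)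
qed simp

end

text \<open>Truncation by projecting onto the interval [-c, c], rather than by setting large values
  to 0, keeps the function continuous, as weak convergence demands. It is also 1-Lipschitz and its
  absolute value increases with \<open>c\<close>.\<close>

definition clip :: "real \<Rightarrow> real \<Rightarrow> real" where
  "clip c x = max (- c) (min c x)"

lemma isCont_clip: "isCont (clip c) x"
  unfolding clip_def[abs_def] by (intro continuous_intros)

lemma abs_clip_le: "0 \<le> c \<Longrightarrow> \<bar>clip c x\<bar> \<le> c"
  by (auto simp: clip_def abs_le_iff max_def min_def)

lemma abs_clip_le_abs: "0 \<le> c \<Longrightarrow> \<bar>clip c x\<bar> \<le> \<bar>x\<bar>"
  by (auto simp: clip_def abs_if max_def min_def)

lemma clip_diff_le: "0 \<le> c \<Longrightarrow> \<bar>x - clip c x\<bar> \<le> \<bar>x\<bar>"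
  by (auto simp: clip_def abs_if max_def min_def)

lemma clip_power2_le: "0 \<le> c \<Longrightarrow> (clip c x)\<^sup>2 \<le> x\<^sup>2"
  by (simp add: abs_clip_le_abs flip: abs_le_square_iff)

lemma clip_power2_mono: "0 \<le> c \<Longrightarrow> c \<le> d \<Longrightarrow> (clip c x)\<^sup>2 \<le> (clip d x)\<^sup>2"
  unfolding abs_le_square_iff[symmetric] by (auto simp: clip_def abs_if max_def min_def)

lemma clip_eventually: "\<forall>\<^sub>F m in sequentially. clip (real m) x = x"
proof -
  obtain N :: nat where "\<bar>x\<bar> \<le> N" using real_arch_simple by blast
  then show ?thesis
    unfolding eventually_sequentially by (intro exI[of _ N]) (auto simp: clip_def)
qed

lemma clip_tendsto: "(\<lambda>m. clip (real m) x) \<longlonglongrightarrow> x"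
  by (rule tendsto_eventually[OF clip_eventually])

lemma borel_measurable_clip [measurable]: "clip c \<in> borel_measurable borel"
  unfolding clip_def[abs_def] by measurable

section \<open>Removing the truncation\<close>

context cid_array
begin

text \<open>A Fatou argument. For each clipping level the expected integral under
  \<open>\<alpha> j\<close> equals the expectation for the first row, which is at most the second
  moment there; monotone convergence then releases the clipping.\<close>

lemma alpha_second_moment:
  shows "AE \<omega> in M. integrable (\<alpha> j \<omega>) (\<lambda>x. x\<^sup>2)"
    and "(\<integral>\<^sup>+\<omega>. (\<integral>\<^sup>+x. ennreal (x\<^sup>2) \<partial>\<alpha> j \<omega>) \<partial>M) \<le> ennreal (\<integral>\<omega>. (X 1 j \<omega>)\<^sup>2 \<partial>M)"
proof -
  note [measurable] = alpha_kernel[of j] X_M[of 1, simplified]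
  have SUPclip: "ennreal (x\<^sup>2) = (SUP m. ennreal ((clip (real m) x)\<^sup>2))" for x
  proof (rule LIMSEQ_unique[OF _ LIMSEQ_SUP])
    show "(\<lambda>m. ennreal ((clip (real m) x)\<^sup>2)) \<longlonglongrightarrow> ennreal (x\<^sup>2)"
      by (rule tendsto_eventually) (use clip_eventually[of x] in \<open>eventually_elim, simp\<close>)
    show "incseq (\<lambda>m. ennreal ((clip (real m) x)\<^sup>2))"
      by (intro incseq_SucI ennreal_leI clip_power2_mono) auto
  qed
  have inc: "incseq (\<lambda>m x. ennreal ((clip (real m) x)\<^sup>2))"
    by (auto simp: incseq_def le_fun_def intro!: ennreal_leI clip_power2_mono)
  have inner: "(\<integral>\<^sup>+x. ennreal (x\<^sup>2) \<partial>\<alpha> j \<omega>) = (SUP m. \<integral>\<^sup>+x. ennreal ((clip (real m) x)\<^sup>2) \<partial>\<alpha> j \<omega>)"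
    if "\<omega> \<in> space M" for \<omega>
    by (subst nn_integral_cong[OF SUPclip], rule nn_integral_monotone_convergence_SUP[OF inc])
       (simp cong: measurable_cong_sets add: alpha_sets[OF that])
  have "(\<integral>\<^sup>+\<omega>. (\<integral>\<^sup>+x. ennreal (x\<^sup>2) \<partial>\<alpha> j \<omega>) \<partial>M)
    = (\<integral>\<^sup>+\<omega>. (SUP m. \<integral>\<^sup>+x. ennreal ((clip (real m) x)\<^sup>2) \<partial>\<alpha> j \<omega>) \<partial>M)"
    by (intro nn_integral_cong inner)
  also have "\<dots> = (SUP m. \<integral>\<^sup>+\<omega>. (\<integral>\<^sup>+x. ennreal ((clip (real m) x)\<^sup>2) \<partial>\<alpha> j \<omega>) \<partial>M)"
    by (rule nn_integral_monotone_convergence_SUP)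
       (use inc in \<open>auto simp: incseq_def le_fun_def intro!: nn_integral_mono\<close>)
  also have "\<dots> \<le> ennreal (\<integral>\<omega>. (X 1 j \<omega>)\<^sup>2 \<partial>M)"
  proof (rule SUP_least)
    fix m :: nat
    let ?h = "\<lambda>x. (clip (real m) x)\<^sup>2"
    have hc: "isCont ?h x" "\<bar>?h x\<bar> \<le> (real m)\<^sup>2" for x
      using isCont_clip abs_clip_le[of "real m" x] power_mono[of "\<bar>clip (real m) x\<bar>" "real m" 2]
      by (auto intro!: continuous_intros)
    have "(\<integral>\<^sup>+\<omega>. (\<integral>\<^sup>+x. ennreal (?h x) \<partial>\<alpha> j \<omega>) \<partial>M) = (\<integral>\<^sup>+\<omega>. ennreal (\<integral>x. ?h x \<partial>\<alpha> j \<omega>) \<partial>M)"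
    proof (intro nn_integral_cong nn_integral_eq_integral)
      fix \<omega> assume \<omega>: "\<omega> \<in> space M"
      show "integrable (\<alpha> j \<omega>) ?h"
        by (rule prob_space.integrable_bounded_real[OF alpha_prob[OF \<omega>], OF _ hc(2)])
           (simp cong: measurable_cong_sets add: alpha_sets[OF \<omega>])
    qed simp
    also have "\<dots> = ennreal (\<integral>\<omega>. (\<integral>x. ?h x \<partial>\<alpha> j \<omega>) \<partial>M)"
      by (intro nn_integral_eq_integral integrable_bounded_real[where B="(real m)\<^sup>2"] alpha_integral_measurable
          alpha_integral_bound[OF hc(2)]) auto
    \<comment> \<open>The constant test function 1 at time 0 turns \<open>cid_integral\<close> into
      an identity of total expectations.\<close>
    also have "(\<integral>\<omega>. (\<integral>x. ?h x \<partial>\<alpha> j \<omega>) \<partial>M) = (\<integral>\<omega>. ?h (X 1 j \<omega>) \<partial>M)"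
      using cid_integral[OF hc, of "\<lambda>_. 1" 0 j 1] by simp
    also have "ennreal \<dots> \<le> ennreal (\<integral>\<omega>. (X 1 j \<omega>)\<^sup>2 \<partial>M)"
      by (intro ennreal_leI integral_mono_AE' square_integrable) (auto simp: clip_power2_le)
    finally show "(\<integral>\<^sup>+\<omega>. (\<integral>\<^sup>+x. ennreal (?h x) \<partial>\<alpha> j \<omega>) \<partial>M) \<le> ennreal (\<integral>\<omega>. (X 1 j \<omega>)\<^sup>2 \<partial>M)" .
  qed
  finally show le: "(\<integral>\<^sup>+\<omega>. (\<integral>\<^sup>+x. ennreal (x\<^sup>2) \<partial>\<alpha> j \<omega>) \<partial>M) \<le> ennreal (\<integral>\<omega>. (X 1 j \<omega>)\<^sup>2 \<partial>M)" .
  have "AE \<omega> in M. (\<integral>\<^sup>+x. ennreal (x\<^sup>2) \<partial>\<alpha> j \<omega>) \<noteq> \<infinity>"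
    by (rule nn_integral_PInf_AE) (use le in \<open>auto simp: top_unique\<close>)
  then show "AE \<omega> in M. integrable (\<alpha> j \<omega>) (\<lambda>x. x\<^sup>2)"
    using AE_space
  proof eventually_elim
    case (elim \<omega>)
    then show ?case
      by (intro integrableI_bounded) (auto simp: top.not_eq_extremum cong: measurable_cong_sets simp: alpha_sets)
  qed
qed

text \<open>Dominated convergence under \<open>\<alpha> j \<omega>\<close>, with dominating
  functions \<open>x\<^sup>2\<close> and |x|. Nonnegativity also holds only almost everywhere: where
  the second moment is infinite, its Bochner integral defaults to 0 and \<open>var_measure\<close>
  can be negative.\<close>

lemma avar_clip_tendsto:
  "AE \<omega> in M. 0 \<le> var_measure (\<alpha> j \<omega>) \<and> (\<lambda>m. avar (clip (real m)) j \<omega>) \<longlonglongrightarrow> var_measure (\<alpha> j \<omega>)"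
  using alpha_second_moment(1)[of j] AE_space
proof eventually_elim
  case (elim \<omega>)
  interpret \<alpha>: prob_space "\<alpha> j \<omega>" by (rule alpha_prob[OF elim(2)])
  have [measurable_cong]: "sets (\<alpha> j \<omega>) = sets borel" by (rule alpha_sets[OF elim(2)])
  have i: "integrable (\<alpha> j \<omega>) (\<lambda>x. x)" by (rule \<alpha>.square_integrable_imp_integrable[OF _ elim(1)]) measurable
  have "(\<lambda>m. \<integral>x. (clip (real m) x)\<^sup>2 \<partial>\<alpha> j \<omega>) \<longlonglongrightarrow> (\<integral>x. x\<^sup>2 \<partial>\<alpha> j \<omega>)"
    by (rule integral_dominated_convergence[where w="\<lambda>x. x\<^sup>2"])
       (use elim in \<open>simp_all add: tendsto_power clip_tendsto clip_power2_le\<close>)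
  moreover have "(\<lambda>m. \<integral>x. clip (real m) x \<partial>\<alpha> j \<omega>) \<longlonglongrightarrow> (\<integral>x. x \<partial>\<alpha> j \<omega>)"
  proof (rule integral_dominated_convergence[where w="\<lambda>x. \<bar>x\<bar>"])
    show "(\<lambda>x. x) \<in> borel_measurable (\<alpha> j \<omega>)" "clip (real m) \<in> borel_measurable (\<alpha> j \<omega>)" for m
      by measurable
    show "integrable (\<alpha> j \<omega>) abs" by (rule integrable_abs[OF i])
  qed (simp_all add: clip_tendsto abs_clip_le_abs)
  moreover have "0 \<le> var_measure (\<alpha> j \<omega>)"
    unfolding var_measure_def using \<alpha>.variance_eq[OF i elim(1)] \<alpha>.variance_positive[of "\<lambda>x. x"] by simp
  ultimately show ?case unfolding avar_def var_measure_def by (auto intro!: tendsto_intros)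
qed

text \<open>Identical distribution makes the truncation error uniform in \<open>n\<close>, and orthogonality of
  martingale increments makes it survive the \<open>sqrt n\<close> scaling.\<close>

lemma truncation_error:
  assumes J: "finite J" and A: "A \<in> sets M" and c: "0 \<le> c" and n: "1 \<le> n"
  shows "\<bar>(\<integral>\<omega>. indicator A \<omega> * cos (s + (\<Sum>k=1..n. \<Sum>j\<in>J. t j * resid (\<lambda>x. x) k j \<omega>) / sqrt n) \<partial>M)
     - (\<integral>\<omega>. indicator A \<omega> * cos (s + (\<Sum>k=1..n. \<Sum>j\<in>J. t j * resid (clip c) k j \<omega>) / sqrt n) \<partial>M)\<bar>
    \<le> (\<Sum>j\<in>J. \<bar>t j\<bar> * sqrt (\<integral>\<omega>. (X 1 j \<omega> - clip c (X 1 j \<omega>))\<^sup>2 \<partial>M))"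
proof -
  define Y where "Y j k \<omega> = X k j \<omega> - clip c (X k j \<omega>)" for j k \<omega>
  define E where "E j \<omega> = (\<Sum>k=1..n. resid (\<lambda>x. x) k j \<omega> - resid (clip c) k j \<omega>)" for j \<omega>
  define \<delta> where "\<delta> j = (\<integral>\<omega>. (X 1 j \<omega> - clip c (X 1 j \<omega>))\<^sup>2 \<partial>M)" for j
  note [measurable] = A
  have XM[measurable]: "X k j \<in> borel_measurable M" if "k \<in> {1..n}" for k j using X_M[of k j] that by simp
  have YG: "Y j k \<in> borel_measurable (G k)" if "1 \<le> k" for j k
    unfolding Y_def[abs_def] using X_G[OF that, of j] by measurable
  have Y2: "integrable M (\<lambda>\<omega>. (Y j k \<omega>)\<^sup>2)" if "1 \<le> k" for j k
  proof (rule Bochner_Integration.integrable_bound[OF square_integrable[OF that, of j]])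
    show "(\<lambda>\<omega>. (Y j k \<omega>)\<^sup>2) \<in> borel_measurable M" using measurable_G_M[OF YG[OF that]] by simp
    show "AE \<omega> in M. norm ((Y j k \<omega>)\<^sup>2) \<le> norm ((X k j \<omega>)\<^sup>2)"
      unfolding Y_def using clip_diff_le[OF c] by (auto simp: abs_le_square_iff)
  qed
  have rM: "resid (\<lambda>x. x) k j \<in> borel_measurable M" "resid (clip c) k j \<in> borel_measurable M" if "k \<in> {1..n}" for k j
    using measurable_G_M[OF resid_G] that by auto
  have EM[measurable]: "E j \<in> borel_measurable M" for j
    unfolding E_def[abs_def] using rM by (intro borel_measurable_sum borel_measurable_diff)
  \<comment> \<open>By linearity of conditional expectation, the two residuals differ by the
    residual of the clipped-off part \<open>Y\<close>. Hence \<open>E j\<close> is a martingale sum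
    to which \<open>martingale_sum_L2\<close> applies.\<close>
  have E_ae: "AE \<omega> in M. E j \<omega> = (\<Sum>k=1..n. Y j k \<omega> - real_cond_exp M (G (k - 1)) (Y j k) \<omega>)" for j
  proof -
    have "AE \<omega> in M. \<forall>k\<in>{1..n}. real_cond_exp M (G (k - 1)) (Y j k) \<omega> =
      real_cond_exp M (G (k - 1)) (X k j) \<omega> - real_cond_exp M (G (k - 1)) (\<lambda>\<omega>. clip c (X k j \<omega>)) \<omega>"
    proof (rule AE_finite_allI)
      fix k assume k: "k \<in> {1..n}"
      interpret sigma_finite_subalgebra M "G (k - 1)" by (rule sigma_finite_G)
      have "integrable M (\<lambda>\<omega>. clip c (X k j \<omega>))"
        by (rule integrable_bounded_real[where B=c]) (use XM[OF k] abs_clip_le[OF c] in auto)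
      then show "AE \<omega> in M. real_cond_exp M (G (k - 1)) (Y j k) \<omega> =
        real_cond_exp M (G (k - 1)) (X k j) \<omega> - real_cond_exp M (G (k - 1)) (\<lambda>\<omega>. clip c (X k j \<omega>)) \<omega>"
        unfolding Y_def using k X_integrable[of k j] by (intro real_cond_exp_diff) auto
    qed simp
    then show ?thesis
    proof eventually_elim
      case (elim \<omega>)
      then show ?case
        unfolding E_def by (intro sum.cong refl) (simp add: resid_def Y_def)
    qed
  qed
  have E_bound: "(\<integral>\<omega>. \<bar>E j \<omega>\<bar> \<partial>M) \<le> sqrt n * sqrt (\<delta> j)" and E_int: "integrable M (E j)" for j
  proof -
    let ?E = "\<lambda>\<omega>. \<Sum>k=1..n. Y j k \<omega> - real_cond_exp M (G (k - 1)) (Y j k) \<omega>"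
    have L2: "integrable M (\<lambda>\<omega>. (?E \<omega>)\<^sup>2)" "(\<integral>\<omega>. (?E \<omega>)\<^sup>2 \<partial>M) \<le> (\<Sum>k=1..n. \<integral>\<omega>. (Y j k \<omega>)\<^sup>2 \<partial>M)"
      using martingale_sum_L2[of "Y j" n, OF YG Y2] by blast+
    have EM'[measurable]: "?E \<in> borel_measurable M"
      using measurable_G_M[OF YG] measurable_G_M[OF borel_measurable_cond_exp]
      by (intro borel_measurable_sum borel_measurable_diff) auto
    have "(\<integral>\<omega>. (Y j k \<omega>)\<^sup>2 \<partial>M) = \<delta> j" if "1 \<le> k" for k
      unfolding Y_def \<delta>_def by (rule integral_X_eq[OF that, where h="\<lambda>x. (x - clip c x)\<^sup>2"]) measurable
    then have "(\<Sum>k=1..n. \<integral>\<omega>. (Y j k \<omega>)\<^sup>2 \<partial>M) = (\<Sum>k=1..n. \<delta> j)"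
      by (intro sum.cong refl) (simp only: atLeastAtMost_iff)
    with L2(2) have "(\<integral>\<omega>. (?E \<omega>)\<^sup>2 \<partial>M) \<le> n * \<delta> j" by simp
    with power2_integral_abs_le[OF EM' L2(1)] have "(\<integral>\<omega>. \<bar>?E \<omega>\<bar> \<partial>M)\<^sup>2 \<le> n * \<delta> j" by linarith
    then have "(\<integral>\<omega>. \<bar>?E \<omega>\<bar> \<partial>M) \<le> sqrt n * sqrt (\<delta> j)"
      by (simp add: real_le_rsqrt flip: real_sqrt_mult)
    moreover have "(\<integral>\<omega>. \<bar>E j \<omega>\<bar> \<partial>M) = (\<integral>\<omega>. \<bar>?E \<omega>\<bar> \<partial>M)"
    proof (rule integral_cong_AE)
      show "AE \<omega> in M. \<bar>E j \<omega>\<bar> = \<bar>?E \<omega>\<bar>" using E_ae[of j] by eventually_elim simp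
    qed (intro borel_measurable_abs EM EM')+
    ultimately show "(\<integral>\<omega>. \<bar>E j \<omega>\<bar> \<partial>M) \<le> sqrt n * sqrt (\<delta> j)" by simp
    have "integrable M ?E" by (rule square_integrable_imp_integrable[OF EM' L2(1)])
    then show "integrable M (E j)"
      using integrable_cong_AE[OF EM EM' E_ae] by simp
  qed
  let ?S = "\<lambda>f \<omega>. \<Sum>k=1..n. \<Sum>j\<in>J. t j * resid f k j \<omega>"
  have SM[measurable]: "?S (\<lambda>x. x) \<in> borel_measurable M" "?S (clip c) \<in> borel_measurable M"
    using rM by (intro borel_measurable_sum borel_measurable_times borel_measurable_const; simp)+
  have i: "integrable M (\<lambda>\<omega>. indicator A \<omega> * cos (s + ?S (\<lambda>x. x) \<omega> / sqrt n))"
     "integrable M (\<lambda>\<omega>. indicator A \<omega> * cos (s + ?S (clip c) \<omega> / sqrt n))"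
    by (rule integrable_mult_bounded[where c=1 and d=1]; (measurable | simp add: indicator_def))+
  have "\<bar>\<integral>\<omega>. indicator A \<omega> * cos (s + ?S (\<lambda>x. x) \<omega> / sqrt n) - indicator A \<omega> * cos (s + ?S (clip c) \<omega> / sqrt n) \<partial>M\<bar>
    \<le> (\<integral>\<omega>. (\<Sum>j\<in>J. \<bar>t j\<bar> / sqrt n * \<bar>E j \<omega>\<bar>) \<partial>M)"
  proof (rule abs_integral_le_integral)
    fix \<omega>
    have "?S (\<lambda>x. x) \<omega> - ?S (clip c) \<omega> = (\<Sum>j\<in>J. t j * E j \<omega>)"
      unfolding E_def sum_distrib_left by (simp add: sum_subtractf right_diff_distrib sum.swap[of _ J])
    then have "(?S (\<lambda>x. x) \<omega> - ?S (clip c) \<omega>) / sqrt n = (\<Sum>j\<in>J. t j / sqrt n * E j \<omega>)"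
      by (simp only: sum_divide_distrib times_divide_eq_left)
    then have eq: "(s + ?S (\<lambda>x. x) \<omega> / sqrt n) - (s + ?S (clip c) \<omega> / sqrt n) = (\<Sum>j\<in>J. t j / sqrt n * E j \<omega>)"
      by (simp only: add_diff_cancel_left diff_divide_distrib)
    have "\<bar>cos (s + ?S (\<lambda>x. x) \<omega> / sqrt n) - cos (s + ?S (clip c) \<omega> / sqrt n)\<bar> \<le> \<bar>\<Sum>j\<in>J. t j / sqrt n * E j \<omega>\<bar>"
      unfolding eq[symmetric] by (rule abs_cos_diff_le)
    also have "\<dots> \<le> (\<Sum>j\<in>J. \<bar>t j\<bar> / sqrt n * \<bar>E j \<omega>\<bar>)"
      by (intro order_trans[OF sum_abs] sum_mono) (simp add: abs_mult)
    finally show "\<bar>indicator A \<omega> * cos (s + ?S (\<lambda>x. x) \<omega> / sqrt n) - indicator A \<omega> * cos (s + ?S (clip c) \<omega> / sqrt n)\<bar>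
      \<le> (\<Sum>j\<in>J. \<bar>t j\<bar> / sqrt n * \<bar>E j \<omega>\<bar>)"
      by (cases "\<omega> \<in> A") (auto intro: sum_nonneg)
  qed (use E_int in auto)
  also have "\<dots> = (\<Sum>j\<in>J. \<bar>t j\<bar> / sqrt n * (\<integral>\<omega>. \<bar>E j \<omega>\<bar> \<partial>M))"
    using E_int by simp
  also have "\<dots> \<le> (\<Sum>j\<in>J. \<bar>t j\<bar> / sqrt n * (sqrt n * sqrt (\<delta> j)))"
    by (intro sum_mono mult_left_mono E_bound) auto
  also have "\<dots> = (\<Sum>j\<in>J. \<bar>t j\<bar> * sqrt (\<delta> j))" using n by simp
  finally show ?thesis using i by (simp add: \<delta>_def)
qed

lemma truncation_tendsto:
  "(\<lambda>m. \<integral>\<omega>. (X 1 j \<omega> - clip (real m) (X 1 j \<omega>))\<^sup>2 \<partial>M) \<longlonglongrightarrow> 0"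
proof -
  note XM[measurable] = X_M[of 1 j, OF order.refl] X_M[of 1 j, OF order.refl, simplified]
  have "(\<lambda>m. \<integral>\<omega>. (X 1 j \<omega> - clip (real m) (X 1 j \<omega>))\<^sup>2 \<partial>M) \<longlonglongrightarrow> (\<integral>\<omega>. 0 \<partial>M)"
  proof (rule integral_dominated_convergence[where w="\<lambda>\<omega>. (X 1 j \<omega>)\<^sup>2"])
    show "AE \<omega> in M. (\<lambda>m. (X 1 j \<omega> - clip (real m) (X 1 j \<omega>))\<^sup>2) \<longlonglongrightarrow> 0"
    proof (rule AE_I2)
      fix \<omega>
      have "\<forall>\<^sub>F m in sequentially. (X 1 j \<omega> - clip (real m) (X 1 j \<omega>))\<^sup>2 = 0"
        using clip_eventually[of "X 1 j \<omega>"] by eventually_elim simp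
      then show "(\<lambda>m. (X 1 j \<omega> - clip (real m) (X 1 j \<omega>))\<^sup>2) \<longlonglongrightarrow> 0" by (rule tendsto_eventually)
    qed
    show "AE \<omega> in M. norm ((X 1 j \<omega> - clip (real m) (X 1 j \<omega>))\<^sup>2) \<le> (X 1 j \<omega>)\<^sup>2" for m
      using clip_diff_le[of "real m"] by (auto simp: abs_le_square_iff)
  qed (use square_integrable[of 1 j] in auto)
  then show ?thesis by simp
qed

text \<open>The truncation error is uniform in \<open>n\<close>, so a level \<open>m\<close> can be
  fixed first. One third of \<open>e\<close> goes to truncating the sums, one to the clipped
  variances in the limit, and one to the convergence for this fixed level.\<close>

lemma stable_cos_array:
  assumes J: "finite J" and A: "A \<in> sets M"
  shows "(\<lambda>n. \<integral>\<omega>. indicator A \<omega> * cos (s + (\<Sum>k=1..n. \<Sum>j\<in>J. t j * resid (\<lambda>x. x) k j \<omega>) / sqrt n) \<partial>M)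
    \<longlonglongrightarrow> (\<integral>\<omega>. indicator A \<omega> * (exp (- (\<Sum>j\<in>J. (t j)\<^sup>2 * var_measure (\<alpha> j \<omega>)) / 2) * cos s) \<partial>M)"
proof (rule LIMSEQ_I)
  fix e :: real assume e: "0 < e"
  let ?R = "\<lambda>f n. \<integral>\<omega>. indicator A \<omega> * cos (s + (\<Sum>k=1..n. \<Sum>j\<in>J. t j * resid f k j \<omega>) / sqrt n) \<partial>M"
  let ?L = "\<lambda>m. \<integral>\<omega>. indicator A \<omega> * (exp (- (\<Sum>j\<in>J. (t j)\<^sup>2 * avar (clip (real m)) j \<omega>) / 2) * cos s) \<partial>M"
  let ?V = "\<integral>\<omega>. indicator A \<omega> * (exp (- (\<Sum>j\<in>J. (t j)\<^sup>2 * var_measure (\<alpha> j \<omega>)) / 2) * cos s) \<partial>M"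
  note [measurable] = A
  have "(\<lambda>m. \<Sum>j\<in>J. \<bar>t j\<bar> * sqrt (\<integral>\<omega>. (X 1 j \<omega> - clip (real m) (X 1 j \<omega>))\<^sup>2 \<partial>M)) \<longlonglongrightarrow> (\<Sum>j\<in>J. \<bar>t j\<bar> * sqrt 0)"
    by (intro tendsto_intros truncation_tendsto)
  then have ev1: "\<forall>\<^sub>F m in sequentially. (\<Sum>j\<in>J. \<bar>t j\<bar> * sqrt (\<integral>\<omega>. (X 1 j \<omega> - clip (real m) (X 1 j \<omega>))\<^sup>2 \<partial>M)) < e / 3"
    using e by (intro order_tendstoD(2)) auto
  have "?L \<longlonglongrightarrow> ?V"
  proof (rule integral_dominated_convergence[where w="\<lambda>_. 1"])
    have clipc: "isCont (clip (real m)) x" "\<bar>clip (real m) x\<bar> \<le> real m" for m x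
      by (auto intro: isCont_clip abs_clip_le)
    have [measurable]: "avar (clip (real m)) j \<in> borel_measurable M" for m j
      by (rule avar_measurable[OF clipc])
    show "(\<lambda>\<omega>. indicator A \<omega> * (exp (- (\<Sum>j\<in>J. (t j)\<^sup>2 * avar (clip (real m)) j \<omega>) / 2) * cos s)) \<in> borel_measurable M" for m
      by measurable
    have [measurable]: "(\<lambda>\<omega>. var_measure (\<alpha> j \<omega>)) \<in> borel_measurable M" for j
      unfolding var_measure_def
      by (intro borel_measurable_diff borel_measurable_power alpha_integral_measurable; measurable)
    show "(\<lambda>\<omega>. indicator A \<omega> * (exp (- (\<Sum>j\<in>J. (t j)\<^sup>2 * var_measure (\<alpha> j \<omega>)) / 2) * cos s)) \<in> borel_measurable M"
      by measurable
    have "AE \<omega> in M. \<forall>j\<in>J. (\<lambda>m. avar (clip (real m)) j \<omega>) \<longlonglongrightarrow> var_measure (\<alpha> j \<omega>)"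
    proof (rule AE_finite_allI[OF J])
      fix j
      show "AE \<omega> in M. (\<lambda>m. avar (clip (real m)) j \<omega>) \<longlonglongrightarrow> var_measure (\<alpha> j \<omega>)"
        using avar_clip_tendsto[of j] by eventually_elim simp
    qed
    then show "AE \<omega> in M. (\<lambda>m. indicator A \<omega> * (exp (- (\<Sum>j\<in>J. (t j)\<^sup>2 * avar (clip (real m)) j \<omega>) / 2) * cos s))
       \<longlonglongrightarrow> indicator A \<omega> * (exp (- (\<Sum>j\<in>J. (t j)\<^sup>2 * var_measure (\<alpha> j \<omega>)) / 2) * cos s)"
      by eventually_elim (intro tendsto_intros; simp)
    show "AE \<omega> in M. norm (indicator A \<omega> * (exp (- (\<Sum>j\<in>J. (t j)\<^sup>2 * avar (clip (real m)) j \<omega>) / 2) * cos s)) \<le> 1" for m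
    proof (rule AE_I2)
      fix \<omega> assume "\<omega> \<in> space M"
      then have "0 \<le> (\<Sum>j\<in>J. (t j)\<^sup>2 * avar (clip (real m)) j \<omega>)"
        using avar_bounds(1)[OF clipc] by (intro sum_nonneg mult_nonneg_nonneg) auto
      then show "norm (indicator A \<omega> * (exp (- (\<Sum>j\<in>J. (t j)\<^sup>2 * avar (clip (real m)) j \<omega>) / 2) * cos s)) \<le> 1"
        by (auto simp: abs_mult indicator_def intro!: mult_le_one)
    qed
  qed simp
  from tendstoD[OF this, of "e / 3"] have ev2: "\<forall>\<^sub>F m in sequentially. \<bar>?L m - ?V\<bar> < e / 3"
    using e by (simp add: dist_real_def)
  obtain m where m1: "(\<Sum>j\<in>J. \<bar>t j\<bar> * sqrt (\<integral>\<omega>. (X 1 j \<omega> - clip (real m) (X 1 j \<omega>))\<^sup>2 \<partial>M)) < e / 3"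
    and m2: "\<bar>?L m - ?V\<bar> < e / 3"
    using eventually_happens[OF eventually_conj[OF ev1 ev2]] by auto
  have "?R (clip (real m)) \<longlonglongrightarrow> ?L m"
    by (rule stable_cos_bounded_array[OF isCont_clip abs_clip_le J A]) simp
  from LIMSEQ_D[OF this, of "e / 3"] obtain N where N: "\<And>n. N \<le> n \<Longrightarrow> \<bar>?R (clip (real m)) n - ?L m\<bar> < e / 3"
    using e by (auto simp: real_norm_def)
  show "\<exists>no. \<forall>n\<ge>no. norm (?R (\<lambda>x. x) n - ?V) < e"
  proof (intro exI allI impI)
    fix n assume "Suc N \<le> n"
    then have n: "N \<le> n" "1 \<le> n" by auto
    have "\<bar>?R (\<lambda>x. x) n - ?R (clip (real m)) n\<bar> < e / 3"
      using truncation_error[OF J A _ n(2), of "real m" s t] m1 by linarith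
    with N[OF n(1)] m2 show "norm (?R (\<lambda>x. x) n - ?V) < e"
      unfolding real_norm_def by linarith
  qed
qed

text \<open>Tightness needs a bound free of \<open>n\<close>: orthogonality bounds the second moment
  of the sum by that of \<open>n\<close> equally distributed entries, and the scaling divides by
  \<open>n\<close>.\<close>

lemma scaled_sum_second_moment:
  assumes "1 \<le> n"
  shows "integrable M (\<lambda>\<omega>. ((\<Sum>k=1..n. resid (\<lambda>x. x) k j \<omega>) / sqrt n)\<^sup>2)"
    and "(\<integral>\<omega>. ((\<Sum>k=1..n. resid (\<lambda>x. x) k j \<omega>) / sqrt n)\<^sup>2 \<partial>M) \<le> (\<integral>\<omega>. (X 1 j \<omega>)\<^sup>2 \<partial>M)"
proof -
  have L2: "integrable M (\<lambda>\<omega>. (\<Sum>k=1..n. resid (\<lambda>x. x) k j \<omega>)\<^sup>2)"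
      "(\<integral>\<omega>. (\<Sum>k=1..n. resid (\<lambda>x. x) k j \<omega>)\<^sup>2 \<partial>M) \<le> (\<Sum>k=1..n. \<integral>\<omega>. (X k j \<omega>)\<^sup>2 \<partial>M)"
    using martingale_sum_L2[of "\<lambda>k. X k j" n, OF X_G square_integrable] unfolding resid_def by blast+
  have eqX: "(\<integral>\<omega>. (X k j \<omega>)\<^sup>2 \<partial>M) = (\<integral>\<omega>. (X 1 j \<omega>)\<^sup>2 \<partial>M)" if "1 \<le> k" for k
    by (rule integral_X_eq[OF that, where h="\<lambda>x. x\<^sup>2"]) measurable
  have "(\<Sum>k=1..n. \<integral>\<omega>. (X k j \<omega>)\<^sup>2 \<partial>M) = (\<Sum>k=1..n. \<integral>\<omega>. (X 1 j \<omega>)\<^sup>2 \<partial>M)"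
    by (rule sum.cong[OF refl]) (rule eqX, simp)
  with L2(2) have le: "(\<integral>\<omega>. (\<Sum>k=1..n. resid (\<lambda>x. x) k j \<omega>)\<^sup>2 \<partial>M) \<le> n * (\<integral>\<omega>. (X 1 j \<omega>)\<^sup>2 \<partial>M)"
    by simp
  show "integrable M (\<lambda>\<omega>. ((\<Sum>k=1..n. resid (\<lambda>x. x) k j \<omega>) / sqrt n)\<^sup>2)"
    unfolding power_divide by (rule integrable_divide_zero) (use L2(1) in blast)
  show "(\<integral>\<omega>. ((\<Sum>k=1..n. resid (\<lambda>x. x) k j \<omega>) / sqrt n)\<^sup>2 \<partial>M) \<le> (\<integral>\<omega>. (X 1 j \<omega>)\<^sup>2 \<partial>M)"
    using le assms by (simp add: power_divide divide_le_eq mult.commute)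
qed

end

section \<open>From cosines to bounded continuous functions\<close>

text \<open>Amplitude and phase make this class an algebra over the reals: \<open>J = {}\<close>
  gives the constants, the phase -pi/2 gives the sines, and the product-to-sum formula gives closure
  under products.\<close>

inductive trig_sum :: "(('i \<Rightarrow> real) \<Rightarrow> real) \<Rightarrow> bool" where
  cos: "finite J \<Longrightarrow> trig_sum (\<lambda>x. c * cos (s + (\<Sum>j\<in>J. t j * x j)))"
| add: "trig_sum f \<Longrightarrow> trig_sum g \<Longrightarrow> trig_sum (\<lambda>x. f x + g x)"

lemma trig_sum_const: "trig_sum (\<lambda>x. c)"
  using trig_sum.cos[of "{}" c 0] by simp

lemma trig_sum_continuous: "trig_sum f \<Longrightarrow> continuous_on S f"
proof (induction rule: trig_sum.induct)
  case (cos J c s t)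
  have "continuous_on S (\<lambda>x. x j)" for j :: 'a
    by (rule continuous_on_subset[OF continuous_on_product_coordinates]) simp
  then have "continuous_on S (\<lambda>x. s + (\<Sum>j\<in>J. t j * x j))" by (intro continuous_intros)
  from continuous_on_compose2[OF continuous_on_cos[OF continuous_on_id] this, of UNIV] show ?case
    by (intro continuous_on_mult_left) simp
qed (intro continuous_intros)

lemma trig_sum_bounded: "trig_sum f \<Longrightarrow> \<exists>B. \<forall>x. \<bar>f x\<bar> \<le> B"
proof (induction rule: trig_sum.induct)
  case (cos J c s t)
  show ?case by (intro exI[of _ "\<bar>c\<bar>"]) (simp add: abs_mult mult_left_le)
next
  case (add f g)
  then obtain B C where "\<bar>f x\<bar> \<le> B" "\<bar>g x\<bar> \<le> C" for x by blast
  then show ?case by (intro exI[of _ "B + C"]) (meson abs_triangle_ineq add_mono order_trans)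
qed

lemma trig_sum_mult:
  assumes "trig_sum f" "trig_sum g"
  shows "trig_sum (\<lambda>x. f x * g x)"
  using assms(1)
proof (induction rule: trig_sum.induct)
  case (cos J c s t)
  from assms(2) show ?case
  proof (induction rule: trig_sum.induct)
    case (cos J' c' s' t')
    \<comment> \<open>Frequencies are extended by zero to the common index set, so that the two
      phases can be added and subtracted.\<close>
    let ?t = "\<lambda>j. if j \<in> J then t j else 0" and ?t' = "\<lambda>j. if j \<in> J' then t' j else 0"
    have J: "(\<Sum>j\<in>J. t j * x j) = (\<Sum>j\<in>J \<union> J'. ?t j * x j)" for x
      using cos \<open>finite J\<close> by (intro sum.mono_neutral_cong_left) auto
    have J': "(\<Sum>j\<in>J'. t' j * x j) = (\<Sum>j\<in>J \<union> J'. ?t' j * x j)" for x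
      using cos \<open>finite J\<close> by (intro sum.mono_neutral_cong_left) auto
    have "trig_sum (\<lambda>x. c * c' / 2 * cos ((s - s') + (\<Sum>j\<in>J \<union> J'. (?t j - ?t' j) * x j))
       + c * c' / 2 * cos ((s + s') + (\<Sum>j\<in>J \<union> J'. (?t j + ?t' j) * x j)))"
      using cos \<open>finite J\<close> by (intro trig_sum.intros) auto
    also have "(\<lambda>x. c * c' / 2 * cos ((s - s') + (\<Sum>j\<in>J \<union> J'. (?t j - ?t' j) * x j))
       + c * c' / 2 * cos ((s + s') + (\<Sum>j\<in>J \<union> J'. (?t j + ?t' j) * x j)))
      = (\<lambda>x. c * cos (s + (\<Sum>j\<in>J. t j * x j)) * (c' * cos (s' + (\<Sum>j\<in>J'. t' j * x j))))"
    proof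
      fix x
      define a where "a = s + (\<Sum>j\<in>J \<union> J'. ?t j * x j)"
      define b where "b = s' + (\<Sum>j\<in>J \<union> J'. ?t' j * x j)"
      have ab: "(s - s') + (\<Sum>j\<in>J \<union> J'. (?t j - ?t' j) * x j) = a - b"
        "(s + s') + (\<Sum>j\<in>J \<union> J'. (?t j + ?t' j) * x j) = a + b"
        unfolding a_def b_def by (simp_all only: left_diff_distrib distrib_right sum_subtractf sum.distrib)
      show "c * c' / 2 * cos ((s - s') + (\<Sum>j\<in>J \<union> J'. (?t j - ?t' j) * x j))
       + c * c' / 2 * cos ((s + s') + (\<Sum>j\<in>J \<union> J'. (?t j + ?t' j) * x j))
       = c * cos (s + (\<Sum>j\<in>J. t j * x j)) * (c' * cos (s' + (\<Sum>j\<in>J'. t' j * x j)))"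
        unfolding ab J J' a_def[symmetric] b_def[symmetric]
        by (simp add: cos_add cos_diff algebra_simps)
    qed
    finally show ?case .
  next
    case (add f g)
    from trig_sum.add[OF add.IH] show ?case by (simp add: distrib_left)
  qed
next
  case (add f g)
  from trig_sum.add[OF add.IH] show ?case by (simp add: distrib_right)
qed

lemma trig_sum_polynomial:
  fixes p :: "real \<Rightarrow> real"
  assumes f: "trig_sum f" and p: "real_polynomial_function p"
  shows "trig_sum (\<lambda>x. p (f x))"
  using p
proof (induction rule: real_polynomial_function.induct)
  case (linear h)
  have "h y = h 1 * y" for y
    using linear_scale[OF bounded_linear.linear[OF linear], of y 1] by (simp add: mult.commute)
  then have "(\<lambda>x. h (f x)) = (\<lambda>x. h 1 * f x)" by (intro ext)
  then show ?case using trig_sum_mult[OF trig_sum_const f] by metis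
qed (auto intro: trig_sum_const trig_sum.add trig_sum_mult)

lemma abs_clip_diff: "\<bar>clip c x - clip c y\<bar> \<le> \<bar>x - y\<bar>"
  by (auto simp: clip_def abs_if max_def min_def)

text \<open>Composing with a polynomial that approximates clipping keeps the approximant globally
  bounded, also off the compact set.\<close>

lemma trig_sum_approximation:
  fixes g :: "('i::countable \<Rightarrow> real) \<Rightarrow> real"
  assumes S: "compact S" and g: "continuous_on UNIV g" "\<And>x. \<bar>g x\<bar> \<le> B" and e: "0 < e"
  obtains h where "trig_sum h" "\<And>x. x \<in> S \<Longrightarrow> \<bar>g x - h x\<bar> \<le> e" "\<And>x. \<bar>h x\<bar> \<le> B + e"
proof -
  interpret function_ring_on "Collect (trig_sum :: (('i \<Rightarrow> real) \<Rightarrow> real) \<Rightarrow> bool)" S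
  proof (unfold_locales; (unfold mem_Collect_eq)?)
    fix x y :: "'i \<Rightarrow> real" assume "x \<noteq> y"
    then obtain i where "x i \<noteq> y i" by auto
    \<comment> \<open>The frequency is small enough to bring both coordinates into [-pi/2, pi/2],
      where the sine is injective; the summand 1 keeps the denominator positive.\<close>
    define r where "r = pi / 2 / (1 + \<bar>x i\<bar> + \<bar>y i\<bar>)"
    have pos: "0 < 1 + \<bar>x i\<bar> + \<bar>y i\<bar>" by linarith
    then have r0: "0 < r" unfolding r_def by (intro divide_pos_pos) auto
    have rz: "\<bar>r * z\<bar> \<le> pi / 2" if "\<bar>z\<bar> \<le> 1 + \<bar>x i\<bar> + \<bar>y i\<bar>" for z
    proof -
      have "r * \<bar>z\<bar> \<le> r * (1 + \<bar>x i\<bar> + \<bar>y i\<bar>)" using that r0 by (intro mult_left_mono) auto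
      also have "\<dots> = pi / 2" using pos unfolding r_def by (subst nonzero_eq_divide_eq[symmetric]) auto
      finally show ?thesis using r0 by (simp add: abs_mult)
    qed
    have "\<bar>r * x i\<bar> \<le> pi / 2" "\<bar>r * y i\<bar> \<le> pi / 2"
      by (rule rz; linarith)+
    then have r: "- (pi / 2) \<le> r * x i" "r * x i \<le> pi / 2" "- (pi / 2) \<le> r * y i" "r * y i \<le> pi / 2"
      by linarith+
    have "trig_sum (\<lambda>z. cos (- (pi / 2) + r * z i))"
      using trig_sum.cos[of "{i}" 1 "- (pi / 2)" "\<lambda>_. r"] by simp
    moreover have "cos (- (pi / 2) + u) = sin u" for u :: real
      by (simp only: cos_add cos_minus sin_minus) simp
    ultimately have "trig_sum (\<lambda>z. sin (r * z i))" by simp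
    moreover have "sin (r * x i) \<noteq> sin (r * y i)"
    proof
      assume "sin (r * x i) = sin (r * y i)"
      from sin_inj_pi[OF r this] show False using \<open>x i \<noteq> y i\<close> r0 by simp
    qed
    ultimately show "\<exists>f\<in>Collect trig_sum. f x \<noteq> f y"
      by (intro bexI[of _ "\<lambda>z. sin (r * z i)"] CollectI)
  qed (auto intro: S trig_sum_continuous trig_sum.add trig_sum_mult trig_sum_const)
  have B0: "0 \<le> B" by (rule order_trans[OF abs_ge_zero g(2)[of undefined]])
  obtain p where p: "trig_sum p" "\<And>x. x \<in> S \<Longrightarrow> \<bar>g x - p x\<bar> < e / 2"
    using Stone_Weierstrass_basic[of g "e / 2"] continuous_on_subset[OF g(1)] e by auto
  obtain R where R: "\<And>x. \<bar>p x\<bar> \<le> R" using trig_sum_bounded[OF p(1)] by blast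
  have "continuous_on {-R..R} (clip B)"
    using isCont_clip by (intro continuous_at_imp_continuous_on) auto
  from Stone_Weierstrass_real_polynomial_function[OF compact_Icc this, of "e / 2"] e
  obtain q where q: "real_polynomial_function q" "\<And>y. y \<in> {-R..R} \<Longrightarrow> \<bar>clip B y - q y\<bar> < e / 2" by auto
  have qp: "\<bar>clip B (p x) - q (p x)\<bar> < e / 2" for x
    using R[of x] by (intro q(2)) (auto simp: abs_le_iff)
  show ?thesis
  proof (rule that[of "\<lambda>x. q (p x)"])
    show "trig_sum (\<lambda>x. q (p x))" by (rule trig_sum_polynomial[OF p(1) q(1)])
    show "\<bar>q (p x)\<bar> \<le> B + e" for x
      using qp[of x] abs_clip_le[OF B0, of "p x"] e by linarith
    show "\<bar>g x - q (p x)\<bar> \<le> e" if "x \<in> S" for x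
    proof -
      \<comment> \<open>Clipping at \<open>B\<close> fixes \<open>g x\<close> and is 1-Lipschitz, so
        clipping \<open>p x\<close> does not increase its distance from \<open>g x\<close>.\<close>
      have "clip B (g x) = g x" using g(2)[of x] by (auto simp: clip_def)
      then show ?thesis
        using qp[of x] p(2)[OF that] abs_clip_diff[of B "g x" "p x"] by linarith
    qed
  qed
qed

section \<open>Compact boxes and tightness in the product space\<close>

lemma compact_box_fun: "compact {x :: 'i \<Rightarrow> real. \<forall>i. \<bar>x i\<bar> \<le> a i}"
proof -
  have "compactin (product_topology (\<lambda>_. euclidean) UNIV) (PiE UNIV (\<lambda>i. {- a i..a i}))"
    by (subst compactin_PiE) (simp add: compactin_euclidean_iff)
  moreover have "PiE UNIV (\<lambda>i. {- a i..a i}) = {x. \<forall>i. \<bar>x i\<bar> \<le> a i}"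
    by (auto simp: PiE_UNIV_domain abs_le_iff Pi_iff minus_le_iff)
  ultimately show ?thesis by (simp add: euclidean_product_topology compactin_euclidean_iff)
qed

lemma measurable_coordinate_fun: "(\<lambda>x :: 'i::countable \<Rightarrow> real. x i) \<in> borel_measurable borel"
  by (intro borel_measurable_continuous_onI continuous_on_product_coordinates)

text \<open>Chebyshev in each coordinate, followed by a union bound: the sides of the box grow so
  fast that the escape probabilities form a geometric series with sum \<open>d\<close>. The box
  depends on \<open>C\<close> and \<open>d\<close> alone, so one compact set serves all the measures
  \<open>N\<close>.\<close>

lemma second_moment_tightness:
  fixes C :: "'i::countable \<Rightarrow> real"
  assumes d: "0 < d" and C: "\<And>i. 0 \<le> C i"
  shows "\<exists>S :: ('i \<Rightarrow> real) set. compact S \<and> (\<forall>N. sets N = sets borel \<longrightarrow>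
    (\<forall>i. (\<integral>\<^sup>+x. ennreal ((x i)\<^sup>2) \<partial>N) \<le> ennreal (C i)) \<longrightarrow> emeasure N (- S) \<le> ennreal d)"
proof -
  \<comment> \<open>Chosen so that \<open>C i / (a i)\<^sup>2\<close> is at most
    \<open>d / 2 ^ Suc (to_nat i)\<close>; the added 1 keeps the side positive when
    \<open>C i\<close> is 0.\<close>
  define a where "a i = sqrt ((C i + 1) * 2 ^ Suc (to_nat i) / d)" for i
  have a2: "(a i)\<^sup>2 = (C i + 1) * 2 ^ Suc (to_nat i) / d" and a0: "0 < a i" for i
    using C[of i] d by (auto simp: a_def zero_less_divide_iff zero_less_mult_iff)
  define S where "S = {x. \<forall>i. \<bar>x i\<bar> \<le> a i}"
  show ?thesis
  proof (intro exI[of _ S] conjI allI impI)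
    show "compact S" unfolding S_def by (rule compact_box_fun)
    fix N :: "('i \<Rightarrow> real) measure"
    assume N[measurable_cong]: "sets N = sets borel"
      and m: "\<forall>i. (\<integral>\<^sup>+x. ennreal ((x i)\<^sup>2) \<partial>N) \<le> ennreal (C i)"
    have sp: "space N = UNIV" using sets_eq_imp_space_eq[OF N] by simp
    note [measurable] = measurable_coordinate_fun
    \<comment> \<open>Numbers that code no index receive the empty set. The union bound then runs
      over all naturals, for finite and infinite index types alike.\<close>
    define T where "T n = (if n \<in> range (to_nat :: 'i \<Rightarrow> nat) then {x \<in> space N. a (from_nat n) < \<bar>x (from_nat n)\<bar>} else {})" for n
    have T[measurable]: "T n \<in> sets N" for n unfolding T_def by auto
    have Tb: "emeasure N (T n) \<le> ennreal (d * (1 / 2) ^ Suc n)" for n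
    proof (cases "n \<in> range (to_nat :: 'i \<Rightarrow> nat)")
      case True
      then obtain i :: 'i where n: "n = to_nat i" by auto
      have "emeasure N (T n) \<le> emeasure N {x \<in> space N. 1 \<le> ennreal (1 / (a i)\<^sup>2) * ennreal ((x i)\<^sup>2)}"
      proof (rule emeasure_mono)
        show "T n \<subseteq> {x \<in> space N. 1 \<le> ennreal (1 / (a i)\<^sup>2) * ennreal ((x i)\<^sup>2)}"
        proof
          fix x assume "x \<in> T n"
          then have "a i < \<bar>x i\<bar>" by (auto simp: T_def n split: if_splits)
          then have "(a i)\<^sup>2 \<le> (x i)\<^sup>2" using a0[of i] by (auto simp flip: abs_le_square_iff)
          then have "1 \<le> 1 / (a i)\<^sup>2 * (x i)\<^sup>2" using a0[of i] by (simp add: le_divide_eq)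
          then have "ennreal 1 \<le> ennreal (1 / (a i)\<^sup>2) * ennreal ((x i)\<^sup>2)"
            by (subst ennreal_mult[symmetric]) (auto intro: ennreal_leI)
          then show "x \<in> {x \<in> space N. 1 \<le> ennreal (1 / (a i)\<^sup>2) * ennreal ((x i)\<^sup>2)}"
            by (simp add: sp)
        qed
      qed measurable
      also have "\<dots> \<le> ennreal (1 / (a i)\<^sup>2) * (\<integral>\<^sup>+x. ennreal ((x i)\<^sup>2) * indicator (space N) x \<partial>N)"
        by (rule nn_integral_Markov_inequality) auto
      also have "\<dots> \<le> ennreal (1 / (a i)\<^sup>2) * ennreal (C i)"
        using spec[OF m, of i] by (intro mult_left_mono) (auto simp: sp)
      also have "\<dots> = ennreal (C i / (a i)\<^sup>2)"
        using C[of i] by (simp flip: ennreal_mult)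
      also have "\<dots> \<le> ennreal (d * (1 / 2) ^ Suc n)"
      proof (rule ennreal_leI)
        have "C i / (a i)\<^sup>2 = C i / (C i + 1) * (d / 2 ^ Suc n)" unfolding a2 n by simp
        also have "\<dots> \<le> 1 * (d / 2 ^ Suc n)" using C[of i] d by (intro mult_right_mono) auto
        finally show "C i / (a i)\<^sup>2 \<le> d * (1 / 2) ^ Suc n" by (simp add: power_divide)
      qed
      finally show ?thesis .
    qed (simp add: T_def)
    have "- S \<subseteq> (\<Union>n. T n)"
    proof
      fix x assume "x \<in> - S"
      then obtain i where "a i < \<bar>x i\<bar>" by (auto simp: S_def not_le)
      then have "x \<in> T (to_nat i)" by (simp add: T_def sp)
      then show "x \<in> (\<Union>n. T n)" by blast
    qed
    then have "emeasure N (- S) \<le> emeasure N (\<Union>n. T n)" by (rule emeasure_mono) auto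
    also have "\<dots> \<le> (\<Sum>n. emeasure N (T n))" by (rule emeasure_subadditive_countably) auto
    also have "\<dots> \<le> (\<Sum>n. ennreal (d * (1 / 2) ^ Suc n))" by (intro suminf_le Tb) auto
    also have "\<dots> = ennreal d"
      using sums_mult[OF power_half_series, of d] d
      by (intro suminf_ennreal_eq) (auto simp: mult_ac)
    finally show "emeasure N (- S) \<le> ennreal d" .
  qed
qed

text \<open>Trigonometric sums approximate \<open>g\<close> only on compact sets. The second moments
  confine the laws of all \<open>Z n\<close> and the mean of \<open>\<beta>\<close> to one such set
  up to mass \<open>d\<close>, and off it the global bound on the approximant limits the
  damage.\<close>

lemma (in prob_space) stable_limit_of_cosines:
  fixes Z :: "nat \<Rightarrow> 'a \<Rightarrow> 'i::countable \<Rightarrow> real" and \<beta> :: "'a \<Rightarrow> ('i \<Rightarrow> real) measure"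
    and g :: "('i \<Rightarrow> real) \<Rightarrow> real" and C :: "'i \<Rightarrow> real"
  assumes Z: "\<And>n. Z n \<in> borel_measurable M"
    and \<beta>: "random_prob_measure M \<beta>"
    and C: "\<And>i. 0 \<le> C i"
    and Z2: "\<And>n i. (\<integral>\<^sup>+\<omega>. ennreal ((Z n \<omega> i)\<^sup>2) \<partial>M) \<le> ennreal (C i)"
    and \<beta>2: "\<And>i. (\<integral>\<^sup>+\<omega>. (\<integral>\<^sup>+x. ennreal ((x i)\<^sup>2) \<partial>\<beta> \<omega>) \<partial>M) \<le> ennreal (C i)"
    and A: "A \<in> sets M"
    and cosines: "\<And>J t s. finite J \<Longrightarrow> (\<lambda>n. \<integral>\<omega>. indicator A \<omega> * cos (s + (\<Sum>j\<in>J. t j * Z n \<omega> j)) \<partial>M)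
        \<longlonglongrightarrow> (\<integral>\<omega>. indicator A \<omega> * (\<integral>x. cos (s + (\<Sum>j\<in>J. t j * x j)) \<partial>\<beta> \<omega>) \<partial>M)"
    and g: "continuous_on UNIV g" "\<And>x. \<bar>g x\<bar> \<le> B"
  shows "(\<lambda>n. \<integral>\<omega>. indicator A \<omega> * g (Z n \<omega>) \<partial>M) \<longlonglongrightarrow> (\<integral>\<omega>. indicator A \<omega> * (\<integral>x. g x \<partial>\<beta> \<omega>) \<partial>M)"
proof (rule LIMSEQ_I)
  fix \<epsilon> :: real assume \<epsilon>: "0 < \<epsilon>"
  \<comment> \<open>Replacing \<open>g\<close> by its approximant costs \<open>2 * e\<close> before
    the limit and \<open>2 * e\<close> in it, and the convergence for the approximant costs
    \<open>e\<close>.\<close>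
  define e where "e = \<epsilon> / 6"
  have e: "0 < e" using \<epsilon> by (simp add: e_def)
  have B0: "0 \<le> B" by (rule order_trans[OF abs_ge_zero g(2)[of undefined]])
  have bp: "prob_space (\<beta> \<omega>)" "sets (\<beta> \<omega>) = sets borel" if "\<omega> \<in> space M" for \<omega>
    using \<beta> that by (auto simp: random_prob_measure_def)
  have bk[measurable]: "\<beta> \<in> measurable M (subprob_algebra borel)"
    using \<beta> by (intro subprob_kernel_measurable) (auto simp: random_prob_measure_def)
  note [measurable] = Z A measurable_coordinate_fun
  have \<beta>_bd: "\<bar>\<integral>x. f x \<partial>\<beta> \<omega>\<bar> \<le> b" if "\<And>x. \<bar>f x\<bar> \<le> b" "\<omega> \<in> space M" for f :: "_ \<Rightarrow> real" and b \<omega>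
    by (rule prob_space.abs_integral_le_const[OF bp(1)[OF that(2)]]) (rule that(1))
  have \<beta>_int: "integrable (\<beta> \<omega>) f" if "f \<in> borel_measurable borel" "\<And>x. \<bar>f x\<bar> \<le> b" "\<omega> \<in> space M" for f :: "_ \<Rightarrow> real" and b \<omega>
    by (rule prob_space.integrable_bounded_real[OF bp(1)[OF that(3)], OF _ that(2)])
       (simp add: that(1) bp(2)[OF that(3)] cong: measurable_cong_sets)
  have \<beta>_meas: "(\<lambda>\<omega>. \<integral>x. f x \<partial>\<beta> \<omega>) \<in> borel_measurable M" if "f \<in> borel_measurable borel" for f :: "_ \<Rightarrow> real"
    using measurable_compose[OF bk integral_measurable_subprob_algebra[OF that]] .
  have int1: "integrable M (\<lambda>\<omega>. indicator A \<omega> * f (Z n \<omega>))"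
    if [measurable]: "f \<in> borel_measurable borel" and "\<And>x. \<bar>f x\<bar> \<le> b" for f :: "_ \<Rightarrow> real" and b n
    by (rule integrable_mult_bounded[where c=1 and d=b]) (use that(2) in \<open>auto simp: indicator_def\<close>)
  have int2: "integrable M (\<lambda>\<omega>. indicator A \<omega> * (\<integral>x. f x \<partial>\<beta> \<omega>))"
    if "f \<in> borel_measurable borel" and "\<And>x. \<bar>f x\<bar> \<le> b" for f :: "_ \<Rightarrow> real" and b
    by (rule integrable_mult_bounded[where c=1 and d=b])
       (use \<beta>_meas[OF that(1)] \<beta>_bd[OF that(2)] in \<open>auto simp: indicator_def\<close>)
  have trig_meas: "f \<in> borel_measurable borel" if "trig_sum f" for f :: "('i \<Rightarrow> real) \<Rightarrow> real"
    by (rule borel_measurable_continuous_onI[OF trig_sum_continuous[OF that]])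
  have gm: "g \<in> borel_measurable borel" by (rule borel_measurable_continuous_onI[OF g(1)])
  have trig: "(\<lambda>n. \<integral>\<omega>. indicator A \<omega> * f (Z n \<omega>) \<partial>M) \<longlonglongrightarrow> (\<integral>\<omega>. indicator A \<omega> * (\<integral>x. f x \<partial>\<beta> \<omega>) \<partial>M)"
    if "trig_sum f" for f
    using that
  proof (induction rule: trig_sum.induct)
    case (cos J c s t)
    from tendsto_mult_left[OF cosines[OF cos, of s t], of c] show ?case
      by (simp add: mult.left_commute[of _ c])
  next
    case (add f f')
    obtain b b' where b: "\<And>x. \<bar>f x\<bar> \<le> b" "\<And>x. \<bar>f' x\<bar> \<le> b'"
      using trig_sum_bounded[OF add(1)] trig_sum_bounded[OF add(2)] by blast
    note m = trig_meas[OF add(1)] trig_meas[OF add(2)]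
    have "(\<integral>\<omega>. indicator A \<omega> * (\<integral>x. f x + f' x \<partial>\<beta> \<omega>) \<partial>M)
      = (\<integral>\<omega>. indicator A \<omega> * (\<integral>x. f x \<partial>\<beta> \<omega>) + indicator A \<omega> * (\<integral>x. f' x \<partial>\<beta> \<omega>) \<partial>M)"
      using \<beta>_int[OF m(1) b(1)] \<beta>_int[OF m(2) b(2)]
      by (intro Bochner_Integration.integral_cong refl) (simp add: distrib_left)
    then show ?case
      using tendsto_add[OF add.IH] int1[OF m(1) b(1)] int1[OF m(2) b(2)] int2[OF m(1) b(1)] int2[OF m(2) b(2)]
      by (simp add: distrib_left)
  qed
  \<comment> \<open>Off the compact set \<open>g\<close> and \<open>h\<close> may differ by
    \<open>2 * B + e\<close>, so mass \<open>d\<close> there costs \<open>e\<close> in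
    total.\<close>
  define d where "d = e / (2 * B + e)"
  have d: "0 < d" "(2 * B + e) * d = e" using e B0 by (auto simp: d_def)
  obtain S :: "('i \<Rightarrow> real) set" where S0: "compact S \<and> (\<forall>N. sets N = sets borel \<longrightarrow>
    (\<forall>i. (\<integral>\<^sup>+x. ennreal ((x i)\<^sup>2) \<partial>N) \<le> ennreal (C i)) \<longrightarrow> emeasure N (- S) \<le> ennreal d)"
    using second_moment_tightness[where C=C, OF d(1) C] by (rule exE)
  then have S: "compact S"
    "\<And>N. sets N = sets borel \<Longrightarrow> (\<And>i. (\<integral>\<^sup>+x. ennreal ((x i)\<^sup>2) \<partial>N) \<le> ennreal (C i)) \<Longrightarrow> emeasure N (- S) \<le> ennreal d"
    by simp_all
  have Sm[measurable]: "- S \<in> sets borel" using compact_imp_closed[OF S(1)] by auto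
  have tightZ: "measure M (Z n -` (- S) \<inter> space M) \<le> d" for n
  proof -
    have "emeasure (distr M borel (Z n)) (- S) \<le> ennreal d"
      by (rule S(2)) (use Z2[of n] in \<open>simp_all add: nn_integral_distr\<close>)
    then show ?thesis using d by (simp add: emeasure_distr emeasure_eq_measure)
  qed
  have tight\<beta>: "(\<integral>\<omega>. measure (\<beta> \<omega>) (- S) \<partial>M) \<le> d"
  proof -
    \<comment> \<open>The mixture \<open>M \<bind> \<beta>\<close> is a single measure with second
      moments bounded by \<open>C\<close>, so the box already used for the laws of
      \<open>Z n\<close> catches it too.\<close>
    have le: "emeasure (M \<bind> \<beta>) (- S) \<le> ennreal d"
    proof (rule S(2))
      show "sets (M \<bind> \<beta>) = sets borel" using bk not_empty by (rule sets_bind_measurable)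
      show "(\<integral>\<^sup>+x. ennreal ((x i)\<^sup>2) \<partial>(M \<bind> \<beta>)) \<le> ennreal (C i)" for i
      proof -
        have "(\<integral>\<^sup>+x. ennreal ((x i)\<^sup>2) \<partial>(M \<bind> \<beta>)) = (\<integral>\<^sup>+\<omega>. (\<integral>\<^sup>+x. ennreal ((x i)\<^sup>2) \<partial>\<beta> \<omega>) \<partial>M)"
          by (rule nn_integral_bind[OF _ bk]) measurable
        with \<beta>2[of i] show ?thesis by (simp only:)
      qed
    qed
    have "emeasure (M \<bind> \<beta>) (- S) = (\<integral>\<^sup>+\<omega>. emeasure (\<beta> \<omega>) (- S) \<partial>M)"
      by (rule emeasure_bind[OF not_empty bk Sm])
    also have "\<dots> = (\<integral>\<^sup>+\<omega>. ennreal (measure (\<beta> \<omega>) (- S)) \<partial>M)"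
      by (intro nn_integral_cong finite_measure.emeasure_eq_measure prob_space.finite_measure bp(1))
    finally have "(\<integral>\<^sup>+\<omega>. ennreal (measure (\<beta> \<omega>) (- S)) \<partial>M) \<le> ennreal d" using le by simp
    then show ?thesis
      using d by (intro integral_real_bounded) auto
  qed
  obtain h where h: "trig_sum h" "\<And>x. x \<in> S \<Longrightarrow> \<bar>g x - h x\<bar> \<le> e" "\<And>x. \<bar>h x\<bar> \<le> B + e"
    by (rule trig_sum_approximation[OF S(1) g e]) (rule that, simp_all)
  note hm = trig_meas[OF h(1)]
  note [measurable] = gm hm
  have gh: "\<bar>g x - h x\<bar> \<le> e + (2 * B + e) * indicator (- S) x" for x
    using h(2)[of x] h(3)[of x] g(2)[of x] e by (cases "x \<in> S") auto
  have errZ: "\<bar>(\<integral>\<omega>. indicator A \<omega> * g (Z n \<omega>) \<partial>M) - (\<integral>\<omega>. indicator A \<omega> * h (Z n \<omega>) \<partial>M)\<bar> \<le> 2 * e" for n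
  proof -
    have "\<bar>\<integral>\<omega>. indicator A \<omega> * g (Z n \<omega>) - indicator A \<omega> * h (Z n \<omega>) \<partial>M\<bar>
      \<le> (\<integral>\<omega>. e + (2 * B + e) * indicator (Z n -` (- S) \<inter> space M) \<omega> \<partial>M)"
    proof (rule abs_integral_le_integral)
      fix \<omega> assume "\<omega> \<in> space M"
      then show "\<bar>indicator A \<omega> * g (Z n \<omega>) - indicator A \<omega> * h (Z n \<omega>)\<bar>
        \<le> e + (2 * B + e) * indicator (Z n -` (- S) \<inter> space M) \<omega>"
        using gh[of "Z n \<omega>"] e B0 by (auto simp: indicator_def split: if_splits)
    qed (simp add: emeasure_eq_measure measurable_sets[OF Z Sm])
    also have "\<dots> = e + (2 * B + e) * measure M (Z n -` (- S) \<inter> space M)"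
      by (simp add: prob_space emeasure_eq_measure)
    also have "\<dots> \<le> e + (2 * B + e) * d"
      using tightZ[of n] e B0 by (intro add_left_mono mult_left_mono) auto
    finally show ?thesis using int1[OF gm g(2)] int1[OF hm h(3)] d(2) by simp
  qed
  have err\<beta>: "\<bar>(\<integral>\<omega>. indicator A \<omega> * (\<integral>x. g x \<partial>\<beta> \<omega>) \<partial>M) - (\<integral>\<omega>. indicator A \<omega> * (\<integral>x. h x \<partial>\<beta> \<omega>) \<partial>M)\<bar> \<le> 2 * e"
  proof -
    have mS: "(\<lambda>\<omega>. measure (\<beta> \<omega>) (- S)) \<in> borel_measurable M" by measurable
    have iS: "integrable M (\<lambda>\<omega>. measure (\<beta> \<omega>) (- S))"
      by (rule integrable_bounded_real[where B=1, OF mS]) (auto intro: prob_space.prob_le_1 bp)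
    have "\<bar>\<integral>\<omega>. indicator A \<omega> * (\<integral>x. g x \<partial>\<beta> \<omega>) - indicator A \<omega> * (\<integral>x. h x \<partial>\<beta> \<omega>) \<partial>M\<bar>
      \<le> (\<integral>\<omega>. e + (2 * B + e) * measure (\<beta> \<omega>) (- S) \<partial>M)"
    proof (rule abs_integral_le_integral)
      fix \<omega> assume \<omega>: "\<omega> \<in> space M"
      interpret \<beta>: prob_space "\<beta> \<omega>" by (rule bp(1)[OF \<omega>])
      have [measurable_cong]: "sets (\<beta> \<omega>) = sets borel" by (rule bp(2)[OF \<omega>])
      have ind: "integrable (\<beta> \<omega>) (indicator (- S) :: _ \<Rightarrow> real)"
        by (rule \<beta>_int[of _ 1]) (use \<omega> Sm in \<open>auto simp: indicator_def\<close>)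
      have "\<bar>\<integral>x. g x - h x \<partial>\<beta> \<omega>\<bar> \<le> (\<integral>x. e + (2 * B + e) * indicator (- S) x \<partial>\<beta> \<omega>)"
        by (rule \<beta>.abs_integral_le_integral[OF _ gh])
           (intro Bochner_Integration.integrable_add \<beta>.integrable_const integrable_mult_right ind)
      also have "\<dots> = e + (2 * B + e) * measure (\<beta> \<omega>) (- S)"
        by (simp add: \<beta>.prob_space \<beta>.emeasure_eq_measure bp(2)[OF \<omega>])
      finally have le: "\<bar>(\<integral>x. g x \<partial>\<beta> \<omega>) - (\<integral>x. h x \<partial>\<beta> \<omega>)\<bar> \<le> e + (2 * B + e) * measure (\<beta> \<omega>) (- S)"
        using \<beta>_int[OF gm g(2) \<omega>] \<beta>_int[OF hm h(3) \<omega>] by simp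
      show "\<bar>indicator A \<omega> * (\<integral>x. g x \<partial>\<beta> \<omega>) - indicator A \<omega> * (\<integral>x. h x \<partial>\<beta> \<omega>)\<bar> \<le> e + (2 * B + e) * measure (\<beta> \<omega>) (- S)"
        using le by (cases "\<omega> \<in> A") auto
    qed (use iS in auto)
    also have "\<dots> = e + (2 * B + e) * (\<integral>\<omega>. measure (\<beta> \<omega>) (- S) \<partial>M)"
      using iS by (simp add: prob_space)
    also have "\<dots> \<le> e + (2 * B + e) * d"
      using tight\<beta> e B0 by (intro add_left_mono mult_left_mono) auto
    finally show ?thesis using int2[OF gm g(2)] int2[OF hm h(3)] d(2) by simp
  qed
  from LIMSEQ_D[OF trig[OF h(1)] e] obtain N where N: "\<And>n. N \<le> n \<Longrightarrow>
     \<bar>(\<integral>\<omega>. indicator A \<omega> * h (Z n \<omega>) \<partial>M) - (\<integral>\<omega>. indicator A \<omega> * (\<integral>x. h x \<partial>\<beta> \<omega>) \<partial>M)\<bar> < e"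
    by (auto simp: real_norm_def)
  show "\<exists>no. \<forall>n\<ge>no. norm ((\<integral>\<omega>. indicator A \<omega> * g (Z n \<omega>) \<partial>M) - (\<integral>\<omega>. indicator A \<omega> * (\<integral>x. g x \<partial>\<beta> \<omega>) \<partial>M)) < \<epsilon>"
  proof (intro exI allI impI)
    fix n assume "N \<le> n"
    from N[OF this] errZ[of n] err\<beta>
    show "norm ((\<integral>\<omega>. indicator A \<omega> * g (Z n \<omega>) \<partial>M) - (\<integral>\<omega>. indicator A \<omega> * (\<integral>x. g x \<partial>\<beta> \<omega>) \<partial>M)) < \<epsilon>"
      unfolding real_norm_def e_def by linarith
  qed
qed

section \<open>Centered Gaussian measures with diagonal covariance\<close>

definition std_normal_field :: "('i \<Rightarrow> real) measure" where
  "std_normal_field = PiM UNIV (\<lambda>_. std_normal_distribution)"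

text \<open>All these measures are images of one fixed field of independent normals, which makes the
  dependence on \<open>v\<close> easy to control. The real \<open>sqrt\<close> is odd, so negative
  entries still give a probability measure. This matters because \<open>random_prob_measure\<close>
  speaks of every \<omega>, including those with negative \<open>var_measure\<close>.\<close>

definition diag_gaussian :: "('i \<Rightarrow> real) \<Rightarrow> ('i \<Rightarrow> real) measure" where
  "diag_gaussian v = distr std_normal_field borel (\<lambda>x i. sqrt (v i) * x i)"

interpretation std_normal: product_prob_space "\<lambda>_. std_normal_distribution" UNIV
  by (intro product_prob_spaceI) (rule real_distribution.axioms(1)[OF real_dist_normal_dist])

text \<open>Countability of the index set makes the product sigma-algebra equal to the Borel
  sigma-algebra of the product topology.\<close>

lemma sets_std_normal_field [measurable_cong]:
  "sets (std_normal_field :: ('i::countable \<Rightarrow> real) measure) = sets borel"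
proof -
  have "sets (std_normal_field :: ('i \<Rightarrow> real) measure) = sets (PiM UNIV (\<lambda>_. borel))"
    unfolding std_normal_field_def by (intro sets_PiM_cong) auto
  then show ?thesis by (simp add: sets_PiM_equal_borel)
qed

lemma prob_space_std_normal_field: "prob_space (std_normal_field :: ('i::countable \<Rightarrow> real) measure)"
  unfolding std_normal_field_def by (rule std_normal.P.prob_space_axioms)

lemma measurable_fun_borel:
  fixes f :: "'a \<Rightarrow> 'i::countable \<Rightarrow> real"
  assumes "\<And>i. (\<lambda>x. f x i) \<in> borel_measurable N"
  shows "f \<in> borel_measurable N"
proof -
  have "f \<in> measurable N (PiM UNIV (\<lambda>_. borel))"
    using assms by (intro measurable_PiM_single') auto
  then show ?thesis using measurable_cong_sets[OF refl sets_PiM_equal_borel] by blast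
qed

lemma measurable_scale_fun:
  "(\<lambda>x i. c i * x i) \<in> measurable (borel :: ('i::countable \<Rightarrow> real) measure) borel"
  by (intro measurable_fun_borel borel_measurable_times borel_measurable_const measurable_coordinate_fun)

lemma scale_fun_std_normal: "(\<lambda>x i. c i * x i) \<in> measurable (std_normal_field :: ('i::countable \<Rightarrow> real) measure) borel"
  using measurable_scale_fun by (simp cong: measurable_cong_sets add: sets_std_normal_field)

lemma prob_space_diag_gaussian: "prob_space (diag_gaussian (v :: 'i::countable \<Rightarrow> real))"
  unfolding diag_gaussian_def
  by (rule prob_space.prob_space_distr[OF prob_space_std_normal_field scale_fun_std_normal])

lemma sets_diag_gaussian [simp]: "sets (diag_gaussian v) = sets borel"
  by (simp add: diag_gaussian_def)

text \<open>The base measure does not move with \<omega>; only the scaling map does, and it is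
  jointly measurable.\<close>

lemma diag_gaussian_measurable:
  fixes v :: "'a \<Rightarrow> 'i::countable \<Rightarrow> real"
  assumes v: "\<And>i. (\<lambda>\<omega>. v \<omega> i) \<in> borel_measurable M"
  shows "(\<lambda>\<omega>. diag_gaussian (v \<omega>)) \<in> measurable M (subprob_algebra borel)"
  unfolding diag_gaussian_def
proof (rule measurable_distr2[where M=std_normal_field])
  show "(\<lambda>(\<omega>, x) i. sqrt (v \<omega> i) * x i) \<in> borel_measurable (M \<Otimes>\<^sub>M (std_normal_field :: ('i \<Rightarrow> real) measure))"
  proof (rule measurable_fun_borel)
    fix i
    note [measurable] = v measurable_coordinate_fun
    show "(\<lambda>p. (case p of (\<omega>, x) \<Rightarrow> \<lambda>i. sqrt (v \<omega> i) * x i) i) \<in> borel_measurable (M \<Otimes>\<^sub>M (std_normal_field :: ('i \<Rightarrow> real) measure))"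
      by (simp add: split_beta)
  qed
  show "(\<lambda>_. std_normal_field) \<in> measurable M (subprob_algebra (std_normal_field :: ('i \<Rightarrow> real) measure))"
    by (intro measurable_const) (simp add: space_subprob_algebra prob_space_imp_subprob_space prob_space_std_normal_field)
qed

lemma char_std_normal_field:
  fixes u :: "'i::countable \<Rightarrow> real"
  assumes J: "finite J"
  shows "(CLINT x|std_normal_field. cis (\<Sum>j\<in>J. u j * x j)) = complex_of_real (exp (- (\<Sum>j\<in>J. (u j)\<^sup>2) / 2))"
proof -
  have cis_sum: "cis (\<Sum>j\<in>J. w j) = (\<Prod>j\<in>J. cis (w j))" for w :: "'i \<Rightarrow> real"
    using J by (induction J rule: finite_induct) (auto simp flip: cis_mult)
  let ?P = "\<lambda>x. \<Prod>j\<in>J. cis (u j * x j)"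
  have Pm: "?P \<in> borel_measurable (PiM J (\<lambda>_. std_normal_distribution))"
  proof (intro borel_measurable_prod)
    fix j assume "j \<in> J"
    then have [measurable]: "(\<lambda>x. x j) \<in> measurable (PiM J (\<lambda>_. std_normal_distribution)) std_normal_distribution"
      by (rule measurable_component_singleton)
    have "(\<lambda>y. cis (u j * y)) \<in> borel_measurable std_normal_distribution"
      unfolding cis_conv_exp by measurable
    then show "(\<lambda>x. cis (u j * x j)) \<in> borel_measurable (PiM J (\<lambda>_. std_normal_distribution))"
      by measurable
  qed
  \<comment> \<open>Only the coordinates in \<open>J\<close> occur. Restricting to them replaces the
    infinite product measure by a finite one, over which the integral factorizes.\<close>
  have "(CLINT x|std_normal_field. cis (\<Sum>j\<in>J. u j * x j)) = (CLINT x|std_normal_field. ?P (restrict x J))"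
    by (simp add: cis_sum)
  also have "\<dots> = (CLINT x|distr (PiM UNIV (\<lambda>_. std_normal_distribution)) (PiM J (\<lambda>_. std_normal_distribution)) (\<lambda>x. restrict x J). ?P x)"
    unfolding std_normal_field_def by (rule integral_distr[symmetric, OF measurable_restrict_subset Pm]) simp
  also have "\<dots> = (CLINT x|PiM J (\<lambda>_. std_normal_distribution). ?P x)"
    using std_normal.distr_PiM_restrict_finite[OF J] by simp
  also have "\<dots> = (\<Prod>j\<in>J. CLINT y|std_normal_distribution. cis (u j * y))"
  proof (rule std_normal.product_integral_prod[OF J])
    fix j
    have "prob_space std_normal_distribution" by (rule real_distribution.axioms(1)[OF real_dist_normal_dist])
    then show "integrable std_normal_distribution (\<lambda>y. cis (u j * y))"
      unfolding cis_conv_exp by (rule prob_space.integrable_iexp) auto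
  qed
  also have "\<dots> = (\<Prod>j\<in>J. complex_of_real (exp (- (u j)\<^sup>2 / 2)))"
    using char_std_normal_distribution by (intro prod.cong refl) (simp add: char_def fun_eq_iff cis_conv_exp)
  also have "\<dots> = complex_of_real (exp (\<Sum>j\<in>J. - (u j)\<^sup>2 / 2))"
    using J by (simp add: exp_sum)
  also have "(\<Sum>j\<in>J. - (u j)\<^sup>2 / 2) = - (\<Sum>j\<in>J. (u j)\<^sup>2) / 2"
    by (simp add: sum_negf sum_divide_distrib)
  finally show ?thesis .
qed

lemma char_diag_gaussian:
  fixes v :: "'i::countable \<Rightarrow> real"
  assumes J: "finite J" and v: "\<And>i. 0 \<le> v i"
  shows "(CLINT x|diag_gaussian v. cis (\<Sum>j\<in>J. t j * x j)) = complex_of_real (exp (- (\<Sum>j\<in>J. (t j)\<^sup>2 * v j) / 2))"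
proof -
  have [measurable]: "(\<lambda>x. \<Sum>j\<in>J. t j * x j) \<in> borel_measurable (borel :: ('i \<Rightarrow> real) measure)"
    by (intro borel_measurable_sum borel_measurable_times borel_measurable_const measurable_coordinate_fun)
  have "(CLINT x|diag_gaussian v. cis (\<Sum>j\<in>J. t j * x j)) = (CLINT x|std_normal_field. cis (\<Sum>j\<in>J. t j * (sqrt (v j) * x j)))"
    unfolding diag_gaussian_def cis_conv_exp by (intro integral_distr scale_fun_std_normal) measurable
  also have "\<dots> = complex_of_real (exp (- (\<Sum>j\<in>J. (t j * sqrt (v j))\<^sup>2) / 2))"
    using char_std_normal_field[OF J, of "\<lambda>j. t j * sqrt (v j)"] by (simp add: mult.assoc)
  finally show ?thesis using v by (simp add: power_mult_distrib)
qed

lemma centered_gaussian_diag_gaussian: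
  fixes v :: "'i::countable \<Rightarrow> real"
  assumes v: "\<And>i. 0 \<le> v i"
  shows "centered_gaussian (diag_gaussian v) (\<lambda>i j. if i = j then v i else 0)"
  unfolding centered_gaussian_def
proof (intro conjI allI impI prob_space_diag_gaussian sets_diag_gaussian)
  fix J :: "'i set" and t :: "'i \<Rightarrow> real" assume J: "finite J"
  have "(\<Sum>i\<in>J. \<Sum>j\<in>J. t i * t j * (if i = j then v i else 0)) = (\<Sum>j\<in>J. (t j)\<^sup>2 * v j)"
    using J by (intro sum.cong) (auto simp: power2_eq_square if_distrib[of "(*) _"] cong: if_cong)
  then show "(CLINT x|diag_gaussian v. cis (\<Sum>j\<in>J. t j * x j))
     = complex_of_real (exp (- (\<Sum>i\<in>J. \<Sum>j\<in>J. t i * t j * (if i = j then v i else 0)) / 2))"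
    using char_diag_gaussian[OF J v] by simp
qed

text \<open>The integral is the real part of the characteristic function rotated by
  \<open>cis s\<close>. The characteristic function is real, so only \<open>cos s\<close> survives.
  This is the limit produced by \<open>stable_cos_array\<close>.\<close>

lemma cos_diag_gaussian:
  fixes v :: "'i::countable \<Rightarrow> real"
  assumes J: "finite J" and v: "\<And>i. 0 \<le> v i"
  shows "(\<integral>x. cos (s + (\<Sum>j\<in>J. t j * x j)) \<partial>diag_gaussian v) = exp (- (\<Sum>j\<in>J. (t j)\<^sup>2 * v j) / 2) * cos s"
proof -
  interpret prob_space "diag_gaussian v" by (rule prob_space_diag_gaussian)
  have [measurable]: "(\<lambda>x. \<Sum>j\<in>J. t j * x j) \<in> borel_measurable (diag_gaussian v)"
    using borel_measurable_sum[of J "\<lambda>j x. t j * x j" borel] measurable_coordinate_fun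
    by (simp cong: measurable_cong_sets)
  have int: "integrable (diag_gaussian v) (\<lambda>x. cis (\<Sum>j\<in>J. t j * x j))"
    unfolding cis_conv_exp by (rule integrable_iexp) measurable
  have "(\<integral>x. cos (s + (\<Sum>j\<in>J. t j * x j)) \<partial>diag_gaussian v) = (\<integral>x. Re (cis s * cis (\<Sum>j\<in>J. t j * x j)) \<partial>diag_gaussian v)"
    by (simp add: cis_mult)
  also have "\<dots> = Re (CLINT x|diag_gaussian v. cis s * cis (\<Sum>j\<in>J. t j * x j))"
    using int by (intro integral_Re) auto
  also have "\<dots> = Re (cis s * complex_of_real (exp (- (\<Sum>j\<in>J. (t j)\<^sup>2 * v j) / 2)))"
    using char_diag_gaussian[where t=t, OF J v] by simp
  finally show ?thesis by simp
qed

lemma diag_gaussian_second_moment: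
  fixes v :: "'i::countable \<Rightarrow> real"
  assumes v: "0 \<le> v i"
  shows "(\<integral>\<^sup>+x. ennreal ((x i)\<^sup>2) \<partial>diag_gaussian v) = ennreal (v i)"
proof -
  note [measurable] = measurable_coordinate_fun
  have "(\<integral>\<^sup>+x. ennreal ((x i)\<^sup>2) \<partial>diag_gaussian v) = (\<integral>\<^sup>+x. ennreal ((sqrt (v i) * x i)\<^sup>2) \<partial>std_normal_field)"
    unfolding diag_gaussian_def by (rule nn_integral_distr[OF scale_fun_std_normal]) measurable
  also have "\<dots> = (\<integral>\<^sup>+x. ennreal (v i) * ennreal ((x i)\<^sup>2) \<partial>std_normal_field)"
    using v by (simp add: power_mult_distrib ennreal_mult)
  also have "\<dots> = ennreal (v i) * (\<integral>\<^sup>+x. ennreal ((x i)\<^sup>2) \<partial>std_normal_field)"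
    by (rule nn_integral_cmult) measurable
  also have "(\<integral>\<^sup>+x. ennreal ((x i)\<^sup>2) \<partial>std_normal_field)
     = (\<integral>\<^sup>+y. ennreal (y\<^sup>2) \<partial>distr (PiM UNIV (\<lambda>_. std_normal_distribution)) std_normal_distribution (\<lambda>x. x i))"
    unfolding std_normal_field_def
    by (rule nn_integral_distr[symmetric, OF measurable_component_singleton]) auto
  also have "distr (PiM UNIV (\<lambda>_. std_normal_distribution)) std_normal_distribution (\<lambda>x. x i) = std_normal_distribution"
    by (rule std_normal.PiM_component) simp
  also have "(\<integral>\<^sup>+y. ennreal (y\<^sup>2) \<partial>std_normal_distribution) = ennreal (\<integral>y. y\<^sup>2 \<partial>std_normal_distribution)"
    using std_normal_distribution_even_moments(2)[of 1] by (intro nn_integral_eq_integral) auto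
  also have "(\<integral>y. y\<^sup>2 \<partial>std_normal_distribution) = 1"
    using std_normal_distribution_even_moments(1)[of 1] by (simp add: fact_numeral)
  finally show ?thesis by simp
qed

section \<open>Stable convergence of the whole array\<close>

context cid_array
begin

text \<open>Sequences start at index 0, whereas the scaled sums start at \<open>n = 1\<close>; index
  \<open>m\<close> therefore stands for \<open>n = Suc m\<close>.\<close>

lemma scaled_sum_eq:
  "(let n = Suc m in (1 / sqrt (real n)) * (\<Sum>k=1..n. X k i \<omega> - real_cond_exp M (G (k - 1)) (X k i) \<omega>))
    = (\<Sum>k=1..Suc m. resid (\<lambda>x. x) k i \<omega>) / sqrt (Suc m)"
  by (simp add: Let_def resid_def)

lemma var_measure_measurable: "(\<lambda>\<omega>. var_measure (\<alpha> i \<omega>)) \<in> borel_measurable M"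
  unfolding var_measure_def
  by (intro borel_measurable_diff borel_measurable_power alpha_integral_measurable; measurable)

lemma var_measure_nonneg: "AE \<omega> in M. \<forall>i. 0 \<le> var_measure (\<alpha> i \<omega>)"
  unfolding AE_all_countable
proof
  show "AE \<omega> in M. 0 \<le> var_measure (\<alpha> i \<omega>)" for i
    using avar_clip_tendsto[of i] by eventually_elim simp
qed

lemma var_measure_integral_le:
  "(\<integral>\<^sup>+\<omega>. ennreal (var_measure (\<alpha> i \<omega>)) \<partial>M) \<le> ennreal (\<integral>\<omega>. (X 1 i \<omega>)\<^sup>2 \<partial>M)"
proof -
  have "(\<integral>\<^sup>+\<omega>. ennreal (var_measure (\<alpha> i \<omega>)) \<partial>M) \<le> (\<integral>\<^sup>+\<omega>. (\<integral>\<^sup>+x. ennreal (x\<^sup>2) \<partial>\<alpha> i \<omega>) \<partial>M)"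
  proof (rule nn_integral_mono_AE)
    show "AE \<omega> in M. ennreal (var_measure (\<alpha> i \<omega>)) \<le> (\<integral>\<^sup>+x. ennreal (x\<^sup>2) \<partial>\<alpha> i \<omega>)"
      using alpha_second_moment(1)[of i]
    proof eventually_elim
      case (elim \<omega>)
      have "(\<integral>\<^sup>+x. ennreal (x\<^sup>2) \<partial>\<alpha> i \<omega>) = ennreal (\<integral>x. x\<^sup>2 \<partial>\<alpha> i \<omega>)"
        by (rule nn_integral_eq_integral[OF elim]) simp
      then show ?case by (simp add: var_measure_def ennreal_leI)
    qed
  qed
  with alpha_second_moment(2)[of i] show ?thesis by (rule order_trans[rotated])
qed

lemma stably_conv_diag_gaussian:
  "stably_conv M (\<lambda>m \<omega> i. (\<Sum>k=1..Suc m. resid (\<lambda>x. x) k i \<omega>) / sqrt (Suc m))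
     (\<lambda>\<omega>. diag_gaussian (\<lambda>i. var_measure (\<alpha> i \<omega>)))"
  (is "stably_conv M ?Z ?\<beta>")
  unfolding stably_conv_def
proof (intro conjI ballI allI impI)
  have \<beta>k: "?\<beta> \<in> measurable M (subprob_algebra borel)"
    by (rule diag_gaussian_measurable[OF var_measure_measurable])
  show rpm\<beta>: "random_prob_measure M ?\<beta>"
    unfolding random_prob_measure_def
    using prob_space_diag_gaussian measurable_emeasure_kernel[OF \<beta>k] by auto
  have rM: "resid (\<lambda>x. x) k i \<in> borel_measurable M" if "k \<in> {1..n}" for k n i
    using measurable_G_M[OF resid_G] that by auto
  have SM: "(\<lambda>\<omega>. \<Sum>k=1..n. resid (\<lambda>x. x) k i \<omega>) \<in> borel_measurable M" for n i
    using rM by (intro borel_measurable_sum)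
  have ZM: "?Z m \<in> borel_measurable M" for m
    by (intro measurable_fun_borel borel_measurable_divide borel_measurable_const SM)
  fix A and g :: "('i \<Rightarrow> real) \<Rightarrow> real"
  assume A: "A \<in> sets M" and g: "continuous_on UNIV g" "bounded (range g)"
  then obtain B where B: "\<And>x. \<bar>g x\<bar> \<le> B" by (auto simp: bounded_iff)
  show "(\<lambda>m. \<integral>\<omega>. indicator A \<omega> * g (?Z m \<omega>) \<partial>M) \<longlonglongrightarrow> (\<integral>\<omega>. indicator A \<omega> * (\<integral>x. g x \<partial>?\<beta> \<omega>) \<partial>M)"
  \<comment> \<open>The second moment of the first row bounds both sides: that of the scaled sums by
    orthogonality, and the averaged limit variance because a variance is at most a second
    moment.\<close>
  proof (rule stable_limit_of_cosines[where Z="?Z" and C="\<lambda>i. \<integral>\<omega>. (X 1 i \<omega>)\<^sup>2 \<partial>M", OF ZM rpm\<beta> _ _ _ A _ g(1) B])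
    show "0 \<le> (\<integral>\<omega>. (X 1 i \<omega>)\<^sup>2 \<partial>M)" for i by simp
    show "(\<integral>\<^sup>+\<omega>. ennreal ((?Z m \<omega> i)\<^sup>2) \<partial>M) \<le> ennreal (\<integral>\<omega>. (X 1 i \<omega>)\<^sup>2 \<partial>M)" for m i
    proof -
      have "(\<integral>\<^sup>+\<omega>. ennreal ((?Z m \<omega> i)\<^sup>2) \<partial>M) = ennreal (\<integral>\<omega>. (?Z m \<omega> i)\<^sup>2 \<partial>M)"
        by (rule nn_integral_eq_integral[OF scaled_sum_second_moment(1)]) auto
      also have "\<dots> \<le> ennreal (\<integral>\<omega>. (X 1 i \<omega>)\<^sup>2 \<partial>M)"
        by (rule ennreal_leI[OF scaled_sum_second_moment(2)]) simp
      finally show ?thesis .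
    qed
    show "(\<integral>\<^sup>+\<omega>. (\<integral>\<^sup>+x. ennreal ((x i)\<^sup>2) \<partial>?\<beta> \<omega>) \<partial>M) \<le> ennreal (\<integral>\<omega>. (X 1 i \<omega>)\<^sup>2 \<partial>M)" for i
    proof -
      have "(\<integral>\<^sup>+\<omega>. (\<integral>\<^sup>+x. ennreal ((x i)\<^sup>2) \<partial>?\<beta> \<omega>) \<partial>M) = (\<integral>\<^sup>+\<omega>. ennreal (var_measure (\<alpha> i \<omega>)) \<partial>M)"
      proof (rule nn_integral_cong_AE)
        show "AE \<omega> in M. (\<integral>\<^sup>+x. ennreal ((x i)\<^sup>2) \<partial>?\<beta> \<omega>) = ennreal (var_measure (\<alpha> i \<omega>))"
          using var_measure_nonneg by eventually_elim (rule diag_gaussian_second_moment, simp)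
      qed
      then show ?thesis using var_measure_integral_le[of i] by simp
    qed
    fix J :: "'i set" and t :: "'i \<Rightarrow> real" and s :: real assume J: "finite J"
    have eqZ: "(\<Sum>j\<in>J. t j * ?Z m \<omega> j) = (\<Sum>k=1..Suc m. \<Sum>j\<in>J. t j * resid (\<lambda>x. x) k j \<omega>) / sqrt (Suc m)" for m \<omega>
      by (subst sum.swap) (simp only: sum_divide_distrib sum_distrib_left times_divide_eq_right)
    have [measurable]: "(\<lambda>x. \<Sum>j\<in>J. t j * x j) \<in> borel_measurable (borel :: ('i \<Rightarrow> real) measure)"
      by (intro borel_measurable_sum borel_measurable_times borel_measurable_const measurable_coordinate_fun)
    note [measurable] = A var_measure_measurable
    have eqL: "(\<integral>\<omega>. indicator A \<omega> * (\<integral>x. cos (s + (\<Sum>j\<in>J. t j * x j)) \<partial>?\<beta> \<omega>) \<partial>M)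
      = (\<integral>\<omega>. indicator A \<omega> * (exp (- (\<Sum>j\<in>J. (t j)\<^sup>2 * var_measure (\<alpha> j \<omega>)) / 2) * cos s) \<partial>M)"
    proof (rule integral_cong_AE)
      show "AE \<omega> in M. indicator A \<omega> * (\<integral>x. cos (s + (\<Sum>j\<in>J. t j * x j)) \<partial>?\<beta> \<omega>)
        = indicator A \<omega> * (exp (- (\<Sum>j\<in>J. (t j)\<^sup>2 * var_measure (\<alpha> j \<omega>)) / 2) * cos s)"
        using var_measure_nonneg by eventually_elim (simp add: cos_diag_gaussian[OF J])
      show "(\<lambda>\<omega>. indicator A \<omega> * (\<integral>x. cos (s + (\<Sum>j\<in>J. t j * x j)) \<partial>?\<beta> \<omega>)) \<in> borel_measurable M"
        by (intro borel_measurable_times borel_measurable_indicator A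
            measurable_compose[OF \<beta>k integral_measurable_subprob_algebra]) measurable
    qed measurable
    show "(\<lambda>m. \<integral>\<omega>. indicator A \<omega> * cos (s + (\<Sum>j\<in>J. t j * ?Z m \<omega> j)) \<partial>M)
      \<longlonglongrightarrow> (\<integral>\<omega>. indicator A \<omega> * (\<integral>x. cos (s + (\<Sum>j\<in>J. t j * x j)) \<partial>?\<beta> \<omega>) \<partial>M)"
      unfolding eqZ eqL by (rule LIMSEQ_Suc[OF stable_cos_array[OF J A]])
  qed
qed

end

theorem mainTheorem14:
  fixes M :: "'a measure"
    and G :: "nat \<Rightarrow> 'a measure"
    and X :: "nat \<Rightarrow> 'i::countable \<Rightarrow> 'a \<Rightarrow> real"
    and \<alpha> :: "'i \<Rightarrow> 'a \<Rightarrow> real measure"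
  assumes "prob_space M"
    and "partially_cid M G X"
    and "\<And>n i. n \<ge> 1 \<Longrightarrow> integrable M (\<lambda>\<omega>. (X n i \<omega>)\<^sup>2)"
    and "\<And>i. directing_measure M G X i (\<alpha> i)"
  shows "\<exists>\<beta>. (AE \<omega> in M. centered_gaussian (\<beta> \<omega>)
              (\<lambda>i j. if i = j then var_measure (\<alpha> i \<omega>) else 0)) \<and>
            stably_conv M
              (\<lambda>m \<omega> i. let n = Suc m in (1 / sqrt (real n)) *
                 (\<Sum>k=1..n. X k i \<omega> - real_cond_exp M (G (k - 1)) (X k i) \<omega>))
              \<beta>"
proof -
  \<comment> \<open>Choice over the columns turns the kernels that exist for each column into the
    family \<open>K\<close> which the locale expects.\<close>
  have "\<forall>i. \<exists>K. (\<forall>n. regular_cond_dist M (G n) (X (Suc n) i) (K n)) \<and>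
          (AE \<omega> in M. weak_conv_m (\<lambda>n. K n \<omega>) (\<alpha> i \<omega>))"
    using assms(4) unfolding directing_measure_def by blast
  from choice[OF this] obtain K where K: "\<forall>i. (\<forall>n. regular_cond_dist M (G n) (X (Suc n) i) (K i n)) \<and>
          (AE \<omega> in M. weak_conv_m (\<lambda>n. K i n \<omega>) (\<alpha> i \<omega>))" ..
  interpret cid_array M G X \<alpha> K
  proof (intro cid_array.intro filtered_prob_space.intro filtered_prob_space_axioms.intro cid_array_axioms.intro)
    show "filtration M G" using assms(2) by (simp add: partially_cid_def)
    show "random_prob_measure M (\<alpha> i)" for i using assms(4)[of i] by (simp add: directing_measure_def)
  qed (use assms K in auto)
  show ?thesis
  proof (intro exI conjI)
    show "AE \<omega> in M. centered_gaussian (diag_gaussian (\<lambda>i. var_measure (\<alpha> i \<omega>)))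
        (\<lambda>i j. if i = j then var_measure (\<alpha> i \<omega>) else 0)"
      using var_measure_nonneg by eventually_elim (rule centered_gaussian_diag_gaussian, simp)
    show "stably_conv M
       (\<lambda>m \<omega> i. let n = Suc m in (1 / sqrt (real n)) *
          (\<Sum>k=1..n. X k i \<omega> - real_cond_exp M (G (k - 1)) (X k i) \<omega>))
       (\<lambda>\<omega>. diag_gaussian (\<lambda>i. var_measure (\<alpha> i \<omega>)))"
      unfolding scaled_sum_eq by (rule stably_conv_diag_gaussian)
  qed
qed

end
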